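(* For $i\in\{0,1,2\}$ let $0<p_i,q_i,r_i\le\infty$ and $\beta_i\in\mathbb{R}$, and assume $$\tfrac1{p_0}=\tfrac1{p_1}+\tfrac1{p_2},\quad \tfrac1{q_0}=\tfrac1{q_1}+\tfrac1{q_2},\quad \tfrac1{r_0}=\tfrac1{r_1}+\tfrac1{r_2},\quad \beta_0=\beta_1+\beta_2$$ (with $1/\infty=0$). Then both the multiplication $T^{p_0,r_0}_{q_0,\beta_0}\leftarrow T^{p_1,r_1}_{q_1,\beta_1}\cdot T^{p_2,r_2}_{q_2,\beta_2}$ and the factorization $T^{p_0,r_0}_{q_0,\beta_0}\rightarrow T^{p_1,r_1}_{q_1,\beta_1}\cdot T^{p_2,r_2}_{q_2,\beta_2}$ hold.
   Context: Let $\mathbb{R}^{n+1}_+=\mathbb{R}^n\times(0,\infty)$; functions are complex-valued measurable, identified a.e. $B(y,t)=\{z:|z-y|<t\}$, $\Gamma(x)=\{(y,t):|y-x|<t\}$, $\widehat{B}=\{(y,t):B(y,t)\subset B\}$ for an open ball $B\subset\mathbb{R}^n$. Fix Whitney parameters $0<\alpha_1<\alpha_2^{-1}<1$, $W(y,t)=\{(z,s):|z-y|<\alpha_1t,\ \alpha_2^{-1}t<s<\alpha_2t\}$, $\mathcal{W}_r(f)(y,t)=|W(y,t)|^{-1/r}\|f\|_{L^r(W(y,t))}$ ($r<\infty$), $\mathcal{W}_\infty(f)(y,t)=\operatorname{ess\,sup}_{W(y,t)}|f|$. Tent spaces $T^p_q$: (A) $p,q<\infty$: $\|g\|=\|(\iint_{\Gamma(x)}|g|^q\,dy\,dt/t^{n+1})^{1/q}\|_{L^p(dx)}$;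 (B) $q<p=\infty$: $\|g\|=\sup_x\sup_{B\ni x}|B|^{-1/q}(\iint_{\widehat B}|g|^q\,dy\,dt/t)^{1/q}$; (C) $p<q=\infty$: $\|g\|=\|\sup_{(y,t)\in\Gamma(x)}|g(y,t)|\|_{L^p(dx)}$; (D) $T^\infty_\infty=L^\infty$. $\|f\|_{T^{p,r}_q}=\|\mathcal{W}_r(f)\|_{T^p_q}$ and $\|f\|_{T^{p,r}_{q,\beta}}=\|f(z,s)s^{-\beta}\|_{T^{p,r}_q}$. Multiplication $X_0\leftarrow X_1\cdot X_2$: for all $f_i\in X_i$, $f_1f_2\in X_0$ and $\|f_1f_2\|_{X_0}\le C\|f_1\|_{X_1}\|f_2\|_{X_2}$. Factorization $X_0\rightarrow X_1\cdot X_2$: every $f_0\in X_0$ admits $f_i\in X_i$ with $|f_0|=|f_1||f_2|$ a.e. and $\|f_1\|_{X_1}\|f_2\|_{X_2}\le C\|f_0\|_{X_0}$; constants independent of the functions. *)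

theory Defs
  imports "HOL-Analysis.Analysis"
begin

text \<open>Points of the upper half-space are pairs (y,t) with y :: real^'n and t > 0;
  functions are defined on all of (real^'n) \<times> real, only their values for t > 0 matter.
  The measure on (real^'n) \<times> real (= R^(n+1)) is Lebesgue measure.
  Quasi-norms take values in ennreal (possibly infinite); exponents p,q,r are in ennreal,
  with top standing for infinity.\<close>

definition epow :: "ennreal \<Rightarrow> real \<Rightarrow> ennreal" where
  "epow x a = (if x = \<infinity> then \<infinity> else ennreal (enn2real x powr a))"
  \<comment> \<open>x^a for a > 0 (the only case used)\<close>

definition ess_sup_on :: "('a::euclidean_space) set \<Rightarrow> ('a \<Rightarrow> ennreal) \<Rightarrow> ennreal" where
  "ess_sup_on S g = Inf {c. AE z in lebesgue. z \<in> S \<longrightarrow> g z \<le> c}"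

definition cone :: "real^'n \<Rightarrow> ((real^'n) \<times> real) set" where
  "cone x = {(y,t). t > 0 \<and> dist y x < t}"

definition tent_hat :: "real^'n \<Rightarrow> real \<Rightarrow> ((real^'n) \<times> real) set" where
  "tent_hat c \<rho> = {(y,t). t > 0 \<and> ball y t \<subseteq> ball c \<rho>}"

definition whitney :: "real \<Rightarrow> real \<Rightarrow> real^'n \<Rightarrow> real \<Rightarrow> ((real^'n) \<times> real) set" where
  "whitney a1 a2 y t = {(z,s). dist z y < a1 * t \<and> t / a2 < s \<and> s < a2 * t}"

definition whitney_avg ::
  "real \<Rightarrow> real \<Rightarrow> ennreal \<Rightarrow> ((real^'n) \<times> real \<Rightarrow> complex) \<Rightarrow> (real^'n) \<times> real \<Rightarrow> ennreal" where
  "whitney_avg a1 a2 r f yt =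
     (let W = whitney a1 a2 (fst yt) (snd yt) in
      if r = \<infinity> then ess_sup_on W (\<lambda>z. ennreal (cmod (f z)))
      else epow ((\<integral>\<^sup>+z\<in>W. ennreal (cmod (f z) powr enn2real r) \<partial>lebesgue) / emeasure lebesgue W)
                (1 / enn2real r))"

definition tent_norm :: "ennreal \<Rightarrow> ennreal \<Rightarrow> ((real^'n) \<times> real \<Rightarrow> ennreal) \<Rightarrow> ennreal" where
  "tent_norm p q g =
    (if p < \<infinity> \<and> q < \<infinity> then
       epow (\<integral>\<^sup>+x. epow (epow (\<integral>\<^sup>+z\<in>cone x. epow (g z) (enn2real q)
                                    / ennreal (snd z ^ (CARD('n) + 1)) \<partial>lebesgue)
                             (1 / enn2real q)) (enn2real p) \<partial>lebesgue) (1 / enn2real p)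
     else if p = \<infinity> \<and> q < \<infinity> then
       (SUP x. SUP B\<in>{(c, \<rho>). \<rho> > 0 \<and> x \<in> ball c \<rho>}.
          epow (1 / emeasure lebesgue (ball (fst B) (snd B))) (1 / enn2real q)
          * epow (\<integral>\<^sup>+z\<in>tent_hat (fst B) (snd B). epow (g z) (enn2real q) / ennreal (snd z) \<partial>lebesgue)
                 (1 / enn2real q))
     else if p < \<infinity> \<and> q = \<infinity> then
       epow (\<integral>\<^sup>+x. epow (SUP z\<in>cone x. g z) (enn2real p) \<partial>lebesgue) (1 / enn2real p)
     else ess_sup_on {z. snd z > 0} g)"

definition T_norm ::
  "real \<Rightarrow> real \<Rightarrow> ennreal \<Rightarrow> ennreal \<Rightarrow> ennreal \<Rightarrow> real \<Rightarrow> ((real^'n) \<times> real \<Rightarrow> complex) \<Rightarrow> ennreal" where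
  "T_norm a1 a2 p q r \<beta> f =
     tent_norm p q (whitney_avg a1 a2 r (\<lambda>(z,s). f (z,s) * complex_of_real (s powr (- \<beta>))))"

definition in_T ::
  "real \<Rightarrow> real \<Rightarrow> ennreal \<Rightarrow> ennreal \<Rightarrow> ennreal \<Rightarrow> real \<Rightarrow> ((real^'n) \<times> real \<Rightarrow> complex) \<Rightarrow> bool" where
  "in_T a1 a2 p q r \<beta> f \<longleftrightarrow> f \<in> borel_measurable lebesgue \<and> T_norm a1 a2 p q r \<beta> f < \<infinity>"

end

theory Submission
  imports Defs
begin

text \<open>
  Up to constants, \<open>T^p_q\<close> is the product of \<open>T^p_\<infinity>\<close> and \<open>T^\<infinity>_q\<close>. For the factorization, let \<open>u\<close> be the
  \<open>q\<close>-th power of the area function of \<open>g\<close>, let \<open>k(y,t)^q\<close> be the harmonic mean of \<open>u\<close> over \<open>B(y,t)\<close>, and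
  split \<open>g = k (g/k)\<close>: the Carleson bound for \<open>g/k\<close> is Fubini's theorem together with \<open>u/u \<le> 1\<close>, and the
  nontangential maximal function of \<open>k\<close> has superlevel sets controlled by those of \<open>u\<close> through a Vitali
  covering. The converse inclusion is a Carleson embedding, combined with Hoelder's inequality or with
  duality and the maximal theorem. Once norms are expressed through such products \<open>k m\<close>,
  multiplication is Hoelder's inequality for the factors.

  For factorization with Whitney averages, the half-space is cut into cells \<open>Q\<close> comparable to Whitney
  boxes; \<open>k\<close> and \<open>m\<close> are replaced by cellwise constants \<open>k_Q\<close>, \<open>m_Q\<close>, and \<open>|f| = k_Q m_Q h\<close> where the average
  of \<open>h\<close> over each cell is bounded. Powers of \<open>k_Q\<close>, \<open>m_Q\<close> and \<open>h\<close> with exponents \<open>p0/pi\<close>, \<open>q0/qi\<close>, \<open>r0/ri\<close>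
  give the two factors.
\<close>

section \<open>Powers of extended nonnegative reals\<close>

text \<open>The harmonic mean lets one construction serve every ratio \<open>p/q\<close>, including
  \<open>p/q \<le> 1\<close>, where the maximal operator is unbounded. If \<open>k^q > l\<close> at
  \<open>z\<close>, then \<open>1/u\<close> has mean below \<open>1/l\<close> over the ball of
  \<open>z\<close>, so by Chebyshev's inequality \<open>2u > l\<close> on at least half of that
  ball. Superlevel sets for \<open>k^q\<close> are thus covered by balls half filled by a superlevel
  set of \<open>u\<close>. The Fubini step in turn needs exactly the average of \<open>1/u\<close>.

  Factoring the Whitney average of \<open>f\<close> does not factor \<open>f\<close>, since averages
  hide local oscillation. The oscillation is left to \<open>h\<close>, while \<open>k\<close> and
  \<open>m\<close> enter only through one number per cell: a supremum of \<open>k\<close> and a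
  \<open>q0\<close>-average of \<open>m\<close>. The exponent \<open>q0\<close> matches the Carleson
  condition, because \<open>q\<close>-th powers of \<open>q\<close>-averages can be moved through
  the integral by Fubini.

  The definitions mix suprema with essential suprema. Where a nontangential supremum occurs, null
  sets count, so inequalities between averages are kept pointwise there, and functions are altered
  on null sets only before they are averaged.\<close>

lemma epow_top [simp]: "epow top a = top"
  by (simp add: epow_def)

lemma epow_0 [simp]: "epow 0 a = 0"
  by (simp add: epow_def)

lemma epow_one [simp]: "epow 1 a = 1"
  by (simp add: epow_def)

lemma epow_ennreal: "0 \<le> x \<Longrightarrow> epow (ennreal x) a = ennreal (x powr a)"
  by (simp add: epow_def)

lemma epow_1 [simp]: "epow x 1 = x"
  by (cases x) (auto simp: epow_ennreal)

lemma epow_eq_0_iff [simp]: "epow x a = 0 \<longleftrightarrow> x = 0"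
  by (cases x) (auto simp: epow_ennreal)

lemma epow_eq_top_iff [simp]: "epow x a = top \<longleftrightarrow> x = top"
  by (cases x) (auto simp: epow_ennreal)

lemma epow_less_top_iff [simp]: "epow x a < top \<longleftrightarrow> x < top"
  by (simp flip: less_top)

lemma epow_mult: "epow (x * y) a = epow x a * epow y a"
proof (cases "x = 0 \<or> y = 0 \<or> x = top \<or> y = top")
  case True
  then show ?thesis by (auto simp: ennreal_top_mult ennreal_mult_top)
next
  case False
  then show ?thesis
    by (cases x; cases y) (auto simp: epow_ennreal powr_mult simp flip: ennreal_mult)
qed

lemma epow_epow: "epow (epow x a) b = epow x (a * b)"
  by (cases x) (auto simp: epow_ennreal powr_powr)

lemma epow_add: "epow x (a + b) = epow x a * epow x b"
  by (cases x) (auto simp: epow_ennreal powr_add simp flip: ennreal_mult)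

lemma epow_inverse: "epow (inverse x) a = inverse (epow x a)"
proof (cases "x = 0 \<or> x = top")
  case False
  then show ?thesis
    by (cases x) (auto simp: epow_ennreal inverse_ennreal inverse_powr)
qed auto

lemma epow_mono: "0 \<le> a \<Longrightarrow> x \<le> y \<Longrightarrow> epow x a \<le> epow y a"
  by (cases x; cases y) (auto simp: epow_ennreal powr_mono2 top_unique)

lemma epow_strict_mono: "0 < a \<Longrightarrow> x < y \<Longrightarrow> epow x a < epow y a"
  by (cases x; cases y) (auto simp: epow_ennreal ennreal_less_iff powr_less_mono2 less_top)

lemma epow_le_iff [simp]: "0 < a \<Longrightarrow> epow x a \<le> epow y a \<longleftrightarrow> x \<le> y"
  by (meson epow_mono epow_strict_mono less_le not_le)

lemma epow_less_iff [simp]: "0 < a \<Longrightarrow> epow x a < epow y a \<longleftrightarrow> x < y"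
  by (meson epow_le_iff not_le)

lemma epow_inverse_exponent [simp]:
  "0 < a \<Longrightarrow> epow (epow x a) (1 / a) = x" "0 < a \<Longrightarrow> epow (epow x (1 / a)) a = x"
  by (simp_all add: epow_epow)

lemma epow_le_swap: "0 < a \<Longrightarrow> epow x a \<le> y \<longleftrightarrow> x \<le> epow y (1 / a)"
  by (metis epow_inverse_exponent(2) epow_le_iff)

lemma epow_le_swap': "0 < a \<Longrightarrow> epow x (1 / a) \<le> y \<longleftrightarrow> x \<le> epow y a"
  using epow_le_swap[of "1 / a" x y] by simp

lemma epow_less_swap: "0 < a \<Longrightarrow> y < epow x a \<longleftrightarrow> epow y (1 / a) < x"
  by (metis epow_inverse_exponent(2) epow_less_iff)

lemma epow_SUP:
  assumes "0 < a"
  shows "epow (SUP i\<in>I. f i) a = (SUP i\<in>I. epow (f i) a)"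
proof (rule antisym)
  show "epow (SUP i\<in>I. f i) a \<le> (SUP i\<in>I. epow (f i) a)"
    unfolding epow_le_swap[OF assms]
    by (rule SUP_least) (auto simp flip: epow_le_swap[OF assms] intro: SUP_upper)
  show "(SUP i\<in>I. epow (f i) a) \<le> epow (SUP i\<in>I. f i) a"
    using assms by (intro SUP_least) (auto intro: SUP_upper)
qed

lemma borel_measurable_epow [measurable (raw)]:
  assumes [measurable]: "f \<in> borel_measurable M"
  shows "(\<lambda>x. epow (f x) a) \<in> borel_measurable M"
  unfolding epow_def infinity_ennreal_def by measurable

section \<open>Hoelder's inequality and distribution functions\<close>

lemma ennreal_Young:
  assumes "0 < a" "0 < b" "a + b = 1"
  shows "epow x a * epow y b \<le> ennreal a * x + ennreal b * y"
proof (cases "x = 0 \<or> y = 0 \<or> x = top \<or> y = top")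
  case True
  then show ?thesis using assms by (auto simp: ennreal_top_mult ennreal_mult_top)
next
  case False
  then obtain x' y' where "x = ennreal x'" "x' > 0" "y = ennreal y'" "y' > 0"
    by (cases x; cases y) (auto simp: less_le)
  with Youngs_inequality_0[of a b x' y'] assms show ?thesis
    by (simp add: epow_ennreal flip: ennreal_mult ennreal_plus)
qed

text \<open>Covers the degenerate case of Hoelder's inequality in which one integral is zero and the
  other may be infinite, where normalization is impossible.\<close>

lemma nn_integral_eq_0_mult:
  assumes [measurable]: "F \<in> borel_measurable M" and "(\<integral>\<^sup>+x. F x \<partial>M) = 0"
    and "\<And>x. F x = 0 \<Longrightarrow> P x = 0"
  shows "(\<integral>\<^sup>+x. P x \<partial>M) = 0"
proof -
  have "AE x in M. F x = 0" using assms by (simp add: nn_integral_0_iff_AE)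
  then have "AE x in M. P x = 0" by eventually_elim (rule assms)
  then have "(\<integral>\<^sup>+x. P x \<partial>M) = (\<integral>\<^sup>+x. 0 \<partial>M)" by (intro nn_integral_cong_AE) auto
  then show ?thesis by simp
qed

text \<open>Normalize both integrals to one and integrate Young's inequality. The exponents sit on
  the integrands and sum to one, so the same form serves target exponents below one. Vanishing and
  infinite integrals are separated because of \<open>0 * top = 0\<close>.\<close>

lemma nn_integral_Hoelder:
  assumes [measurable]: "F \<in> borel_measurable M" "G \<in> borel_measurable M"
    and ab: "0 < a" "0 < b" "a + b = 1"
  shows "(\<integral>\<^sup>+x. epow (F x) a * epow (G x) b \<partial>M)
    \<le> epow (\<integral>\<^sup>+x. F x \<partial>M) a * epow (\<integral>\<^sup>+x. G x \<partial>M) b" (is "?L \<le> epow ?X a * epow ?Y b")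
proof -
  consider "?X = 0" | "?Y = 0" | "?X \<noteq> 0" "?Y \<noteq> 0" "?X = top \<or> ?Y = top"
    | "?X \<noteq> 0" "?Y \<noteq> 0" "?X < top" "?Y < top" using less_top by blast
  then show ?thesis
  proof cases
    case 1
    then have "?L = 0" by (rule nn_integral_eq_0_mult[of F, rotated]) auto
    then show ?thesis by simp
  next
    case 2
    then have "?L = 0" by (rule nn_integral_eq_0_mult[of G, rotated]) auto
    then show ?thesis by simp
  next
    case 3
    then have "epow ?X a * epow ?Y b = top" by (auto simp: ennreal_mult_eq_top_iff)
    then show ?thesis by simp
  next
    case 4
    define X Y where "X = ?X" and "Y = ?Y"
    have XY: "X \<noteq> 0" "Y \<noteq> 0" "X < top" "Y < top" using 4 by (auto simp: X_def Y_def)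
    have eq: "epow (F x) a * epow (G x) b
        = epow X a * epow Y b * (epow (F x / X) a * epow (G x / Y) b)" for x
    proof -
      have "F x = X * (F x / X)" "G x = Y * (G x / Y)"
        using XY by (simp_all add: ennreal_mult_divide_eq ennreal_times_divide mult.commute[of _ "F x"] mult.commute[of _ "G x"])
      then have "epow (F x) a * epow (G x) b = epow (X * (F x / X)) a * epow (Y * (G x / Y)) b" by simp
      then show ?thesis by (simp add: epow_mult mult_ac)
    qed
    have "(\<integral>\<^sup>+x. epow (F x / X) a * epow (G x / Y) b \<partial>M) \<le> (\<integral>\<^sup>+x. ennreal a * (F x / X) + ennreal b * (G x / Y) \<partial>M)"
      using ab by (intro nn_integral_mono ennreal_Young)
    also have "\<dots> = ennreal a * (X / X) + ennreal b * (Y / Y)"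
      by (simp add: nn_integral_add nn_integral_cmult nn_integral_divide X_def Y_def)
    also have "\<dots> = 1" using XY ab by (simp flip: ennreal_plus)
    finally have "epow X a * epow Y b * (\<integral>\<^sup>+x. epow (F x / X) a * epow (G x / Y) b \<partial>M) \<le> epow X a * epow Y b * 1"
      by (intro mult_left_mono) auto
    then show ?thesis unfolding eq by (simp add: nn_integral_cmult X_def Y_def)
  qed
qed

lemma nn_integral_indicator_below: "(\<integral>\<^sup>+t. indicator {t. 0 < t \<and> ennreal t < v} t \<partial>lborel) = v"
proof -
  have [measurable]: "{t. 0 < t \<and> ennreal t < v} \<in> sets lborel" by measurable
  show ?thesis
  proof (cases v)
    case (real r)
    then have "{t. 0 < t \<and> ennreal t < v} = {0<..<r}" by (auto simp: ennreal_less_iff)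
    then show ?thesis using real by simp
  next
    case top
    have "of_nat n \<le> emeasure lborel {0::real<..}" for n
    proof -
      have "emeasure lborel {0::real<..<of_nat n} \<le> emeasure lborel {0::real<..}" by (rule emeasure_mono) auto
      then show ?thesis by (simp add: ennreal_of_nat_eq_real_of_nat)
    qed
    then have "(SUP n. of_nat n) \<le> emeasure lborel {0::real<..}" by (rule SUP_least)
    then have "emeasure lborel {0::real<..} = top" by (simp add: ennreal_SUP_of_nat_eq_top top_unique)
    moreover have "{t. 0 < t \<and> ennreal t < v} = {0<..}" using top by auto
    ultimately show ?thesis using top by simp
  qed
qed

text \<open>Write \<open>F x\<close> as the length of the interval below it and exchange integrals.
  The weight \<open>\<rho>\<close> admits measures given by a density, in particular Carleson
  measures.\<close>

lemma nn_integral_layer_cake: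
  fixes F \<rho> :: "'a::euclidean_space \<Rightarrow> ennreal"
  assumes [measurable]: "F \<in> borel_measurable borel" "\<rho> \<in> borel_measurable borel"
  shows "(\<integral>\<^sup>+x. F x * \<rho> x \<partial>lborel)
    = (\<integral>\<^sup>+t. indicator {0<..} t * (\<integral>\<^sup>+x\<in>{x. ennreal t < F x}. \<rho> x \<partial>lborel) \<partial>lborel)"
proof -
  have "(\<integral>\<^sup>+x. F x * \<rho> x \<partial>lborel) = (\<integral>\<^sup>+x. (\<integral>\<^sup>+t. indicator {t. 0 < t \<and> ennreal t < F x} t * \<rho> x \<partial>lborel) \<partial>lborel)"
    by (subst nn_integral_multc) (auto simp: nn_integral_indicator_below)
  also have "\<dots> = (\<integral>\<^sup>+t. (\<integral>\<^sup>+x. indicator {t. 0 < t \<and> ennreal t < F x} t * \<rho> x \<partial>lborel) \<partial>lborel)"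
    by (rule lborel_pair.Fubini') measurable
  also have "\<dots> = (\<integral>\<^sup>+t. indicator {0<..} t * (\<integral>\<^sup>+x\<in>{x. ennreal t < F x}. \<rho> x \<partial>lborel) \<partial>lborel)"
    by (intro nn_integral_cong, subst nn_integral_cmult[symmetric])
       (auto intro!: nn_integral_cong simp: indicator_def)
  finally show ?thesis .
qed

text \<open>Turns estimates of superlevel sets into integral inequalities. The two sides may live on
  different spaces, since a Carleson measure on the half-space is compared with Lebesgue measure on
  its boundary.\<close>

lemma layer_comparison:
  fixes F \<rho> :: "'a::euclidean_space \<Rightarrow> ennreal" and H :: "'b::euclidean_space \<Rightarrow> ennreal"
  assumes [measurable]: "F \<in> borel_measurable borel" "\<rho> \<in> borel_measurable borel" "H \<in> borel_measurable borel"
    and le: "\<And>t. 0 < t \<Longrightarrow> (\<integral>\<^sup>+x\<in>{x. ennreal t < F x}. \<rho> x \<partial>lborel) \<le> C * emeasure lborel {x. ennreal t < H x}"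
  shows "(\<integral>\<^sup>+x. F x * \<rho> x \<partial>lborel) \<le> C * (\<integral>\<^sup>+x. H x \<partial>lborel)"
proof -
  have "(\<integral>\<^sup>+x. F x * \<rho> x \<partial>lborel)
      \<le> (\<integral>\<^sup>+t. C * (indicator {0<..} t * emeasure lborel {x. ennreal t < H x}) \<partial>lborel)"
    unfolding nn_integral_layer_cake[OF assms(1,2)]
    by (intro nn_integral_mono) (use le in \<open>auto simp: indicator_def\<close>)
  also have "\<dots> = (\<integral>\<^sup>+t. C * (indicator {0<..} t * (\<integral>\<^sup>+x\<in>{x. ennreal t < H x}. 1 \<partial>lborel)) \<partial>lborel)"
    by simp
  also have "\<dots> = C * (\<integral>\<^sup>+x. H x * 1 \<partial>lborel)"
    unfolding nn_integral_layer_cake[OF assms(3) borel_measurable_const]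
    by (rule nn_integral_cmult) measurable
  finally show ?thesis by simp
qed

section \<open>Vitali coverings and Carleson densities\<close>

lemma emeasure_ball_vec:
  "0 \<le> t \<Longrightarrow> emeasure lborel (ball (y::real^'n) t) = ennreal (unit_ball_vol (real CARD('n)) * t ^ CARD('n))"
  by (simp add: emeasure_ball)

lemma unit_ball_vol_pos' [simp]: "0 < unit_ball_vol (real n)"
  by (intro unit_ball_vol_pos) simp

lemma unit_ball_vol_nonzero [simp]: "unit_ball_vol (real n) \<noteq> 0"
  using unit_ball_vol_pos'[of n] by linarith

lemma emeasure_ball_scale:
  assumes "0 \<le> c" "0 \<le> t"
  shows "emeasure lborel (ball (y::real^'n) (c * t)) = ennreal (c ^ CARD('n)) * emeasure lborel (ball (x::real^'n) t)"
  using assms by (simp add: emeasure_ball_vec power_mult_distrib mult_ac flip: ennreal_mult)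

lemma emeasure_ball_bounds:
  assumes "0 < t"
  shows "emeasure lborel (ball (y::real^'n) t) \<noteq> 0" "emeasure lborel (ball y t) < top"
    "emeasure lborel (ball y t) \<noteq> top"
  using assms by (auto simp: emeasure_ball_vec)

text \<open>The half-space carries \<open>borel\<close> of the product type, which is not
  syntactically a product of sigma-algebras; continuity gives measurability of the
  projections.\<close>

lemma borel_measurable_fst' [measurable (raw)]:
  fixes f :: "'c \<Rightarrow> 'a::second_countable_topology \<times> 'b::second_countable_topology"
  assumes "f \<in> borel_measurable M"
  shows "(\<lambda>x. fst (f x)) \<in> borel_measurable M"
  using assms by (rule measurable_compose) (intro borel_measurable_continuous_onI continuous_intros)

lemma borel_measurable_snd' [measurable (raw)]:
  fixes f :: "'c \<Rightarrow> 'a::second_countable_topology \<times> 'b::second_countable_topology"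
  assumes "f \<in> borel_measurable M"
  shows "(\<lambda>x. snd (f x)) \<in> borel_measurable M"
  using assms by (rule measurable_compose) (intro borel_measurable_continuous_onI continuous_intros)

lemma in_ball_measurable [measurable]:
  assumes [measurable]: "f \<in> borel_measurable M" "g \<in> borel_measurable M" "h \<in> borel_measurable M"
  shows "Measurable.pred M (\<lambda>x. h x \<in> ball (f x :: 'a::euclidean_space) (g x))"
  unfolding mem_ball by measurable

text \<open>Sums over a countable family are written as integrals over \<open>count_space\<close>,
  so that exchanging them with Lebesgue integrals is again a case of Tonelli's theorem. The integral
  here counts the sets that contain \<open>x\<close>.\<close>

lemma nn_integral_count_space_disjoint:
  assumes "\<And>i j. i \<in> C \<Longrightarrow> j \<in> C \<Longrightarrow> i \<noteq> j \<Longrightarrow> X i \<inter> X j = {}"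
  shows "(\<integral>\<^sup>+i. indicator (X i) x \<partial>count_space C) \<le> (1::ennreal)"
proof (cases "\<exists>i\<in>C. x \<in> X i")
  case True
  then obtain i where i: "i \<in> C" "x \<in> X i" by blast
  have "(\<integral>\<^sup>+j. indicator (X j) x \<partial>count_space C) = (\<integral>\<^sup>+j. indicator {i} j \<partial>count_space C)"
    using i assms by (intro nn_integral_cong) (auto simp: indicator_def)
  also have "\<dots> = 1" using i by (subst nn_integral_indicator) (auto simp: one_ennreal_def)
  finally show ?thesis by simp
next
  case False
  then have "(\<integral>\<^sup>+j. indicator (X j) x \<partial>count_space C) = (\<integral>\<^sup>+j. 0 \<partial>count_space C)"
    by (intro nn_integral_cong) (auto simp: indicator_def)
  then show ?thesis by simp
qed

lemma indicator_le_count_space: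
  assumes "j \<in> C" "x \<in> X j"
  shows "1 \<le> (\<integral>\<^sup>+i. indicator (X i) x \<partial>count_space C :: ennreal)"
proof -
  have "(1::ennreal) = (\<integral>\<^sup>+i. indicator {j} i \<partial>count_space C)"
    using assms by (subst nn_integral_indicator) (auto simp: one_ennreal_def)
  also have "\<dots> \<le> (\<integral>\<^sup>+i. indicator (X i) x \<partial>count_space C)"
    using assms by (intro nn_integral_mono) (auto simp: indicator_def)
  finally show ?thesis .
qed

text \<open>Vitali's lemma for closed balls, with disjointness recorded as an overlap count of at
  most one, the form in which it gets integrated.\<close>

lemma Vitali_selection:
  fixes K :: "((real^'n) \<times> real) set"
  assumes "\<And>i. i \<in> K \<Longrightarrow> 0 < snd i \<and> snd i \<le> B"
  obtains C where "countable C" "C \<subseteq> K"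
    "\<And>x. (\<integral>\<^sup>+i. indicator (ball (fst i) (snd i)) x \<partial>count_space C) \<le> (1::ennreal)"
    "\<And>i. i \<in> K \<Longrightarrow> \<exists>j\<in>C. ball (fst i) (snd i) \<subseteq> ball (fst j) (5 * snd j)"
proof -
  obtain C where C: "countable C" "C \<subseteq> K"
    "pairwise (\<lambda>i j. disjnt (cball (fst i) (snd i)) (cball (fst j) (snd j))) C"
    and cov: "\<And>i. i \<in> K \<Longrightarrow> \<exists>j. j \<in> C \<and> \<not> disjnt (cball (fst i) (snd i)) (cball (fst j) (snd j)) \<and>
                        cball (fst i) (snd i) \<subseteq> ball (fst j) (5 * snd j)"
    by (rule Vitali_covering_lemma_cballs_balls[of K snd B fst, OF assms]) blast+
  have "(\<integral>\<^sup>+i. indicator (ball (fst i) (snd i)) x \<partial>count_space C) \<le> (1::ennreal)" for x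
  proof (rule nn_integral_count_space_disjoint)
    fix i j assume "i \<in> C" "j \<in> C" "i \<noteq> j"
    then have "disjnt (cball (fst i) (snd i)) (cball (fst j) (snd j))"
      using C(3) by (auto simp: pairwise_def)
    then show "ball (fst i) (snd i) \<inter> ball (fst j) (snd j) = {}"
      using ball_subset_cball[of "fst i" "snd i"] ball_subset_cball[of "fst j" "snd j"]
      unfolding disjnt_def by blast
  qed
  moreover have "\<exists>j\<in>C. ball (fst i) (snd i) \<subseteq> ball (fst j) (5 * snd j)" if "i \<in> K" for i
    using cov[OF that] ball_subset_cball[of "fst i" "snd i"] by blast
  ultimately show ?thesis using C that by blast
qed

text \<open>Derives the bounded radii required by Vitali's lemma from a bound on volumes. The
  maximum with one appears in the proof because \<open>t \<le> t^n\<close> needs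
  \<open>t \<ge> 1\<close>.\<close>

lemma ball_radius_bounded:
  assumes "R < top"
  obtains B where "\<And>(y::real^'n) t. 0 < t \<Longrightarrow> emeasure lborel (ball y t) \<le> R \<Longrightarrow> t \<le> B"
proof -
  let ?w = "unit_ball_vol (real CARD('n))"
  obtain R' where R: "R = ennreal R'" "R' \<ge> 0" using assms by (cases R) auto
  have "t \<le> max 1 (R' / ?w)" if "0 < t" "emeasure lborel (ball (y::real^'n) t) \<le> R" for y t
  proof (cases "t \<le> 1")
    case False
    have "?w * t ^ CARD('n) \<le> R'" using that R by (simp add: emeasure_ball_vec)
    then have "t ^ CARD('n) \<le> R' / ?w" by (simp add: field_simps)
    moreover have "t \<le> t ^ CARD('n)" using False self_le_power[of t "CARD('n)"] by simp
    ultimately show ?thesis by simp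
  qed simp
  then show ?thesis using that by blast
qed

text \<open>The dilated balls are thinned out by Vitali's lemma. The selected ones are disjoint, so
  the masses of \<open>\<rho>\<close> in the undilated balls inside them add up to at most the whole
  integral, and enlarging by five covers the union. The weak maximal estimate, the change of
  aperture and the bound for harmonic means all come from it by a choice of
  \<open>\<rho>\<close>.\<close>

lemma ball_covering:
  fixes \<rho> :: "real^'n \<Rightarrow> ennreal" and K :: "((real^'n) \<times> real) set"
  assumes [measurable]: "\<rho> \<in> borel_measurable borel" and a: "1 \<le> a"
    and K: "\<And>y t. (y, t) \<in> K \<Longrightarrow> 0 < t \<and> emeasure lborel (ball y t) \<le> (\<integral>\<^sup>+x\<in>ball y t. \<rho> x \<partial>lborel)"
  shows "emeasure lborel (\<Union>i\<in>K. ball (fst i) (a * snd i)) \<le> ennreal ((5 * a) ^ CARD('n)) * (\<integral>\<^sup>+x. \<rho> x \<partial>lborel)"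
proof (cases "(\<integral>\<^sup>+x. \<rho> x \<partial>lborel) < top")
  case False
  then show ?thesis using a by (auto simp: less_top[symmetric] ennreal_mult_top not_le)
next
  case True
  then obtain B where B: "\<And>(y::real^'n) t. 0 < t \<Longrightarrow> emeasure lborel (ball y t) \<le> (\<integral>\<^sup>+x. \<rho> x \<partial>lborel) \<Longrightarrow> t \<le> B"
    by (rule ball_radius_bounded) blast
  have "(\<integral>\<^sup>+x\<in>X. \<rho> x \<partial>lborel) \<le> (\<integral>\<^sup>+x. \<rho> x \<partial>lborel)" for X
    by (intro nn_integral_mono) (auto simp: indicator_def)
  with B K have bound: "t \<le> B" if "(y, t) \<in> K" for y t
    using that by (meson order_trans)
  define K' where "K' = (\<lambda>i. (fst i, a * snd i)) ` K"
  obtain C where C: "countable C" "C \<subseteq> K'"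
    and one: "\<And>x. (\<integral>\<^sup>+i. indicator (ball (fst i) (snd i)) x \<partial>count_space C) \<le> (1::ennreal)"
    and cov: "\<And>i. i \<in> K' \<Longrightarrow> \<exists>j\<in>C. ball (fst i) (snd i) \<subseteq> ball (fst j) (5 * snd j)"
  proof (rule Vitali_selection[of K' "a * B"])
    show "0 < snd i \<and> snd i \<le> a * B" if "i \<in> K'" for i
      using that K bound a by (auto simp: K'_def)
  qed blast
  have ball_le: "emeasure lborel (ball (fst i) (5 * snd i))
      \<le> ennreal ((5 * a) ^ CARD('n)) * (\<integral>\<^sup>+x. \<rho> x * indicator (ball (fst i) (snd i)) x \<partial>lborel)" if iC: "i \<in> C" for i
  proof -
    obtain y t where yt: "(y, t) \<in> K" "i = (y, a * t)"
      using iC C(2) by (auto simp: K'_def)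
    then have t: "0 < t" using K by blast
    have "emeasure lborel (ball (fst i) (5 * snd i)) = emeasure lborel (ball y ((5 * a) * t))"
      using yt by (simp add: mult_ac)
    also have "\<dots> = ennreal ((5 * a) ^ CARD('n)) * emeasure lborel (ball y t)"
      using a t by (intro emeasure_ball_scale) auto
    also have "emeasure lborel (ball y t) \<le> (\<integral>\<^sup>+x\<in>ball y t. \<rho> x \<partial>lborel)" using K yt by blast
    also have "(\<integral>\<^sup>+x\<in>ball y t. \<rho> x \<partial>lborel) \<le> (\<integral>\<^sup>+x. \<rho> x * indicator (ball (fst i) (snd i)) x \<partial>lborel)"
    proof -
      have "ball y t \<subseteq> ball y (a * t)" using a t by (intro subset_ball) (simp add: mult_le_cancel_right1)
      then show ?thesis using yt by (intro nn_integral_mono) (auto simp: indicator_def)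
    qed
    finally show ?thesis by (simp add: mult_left_mono)
  qed
  have "emeasure lborel (\<Union>i\<in>K. ball (fst i) (a * snd i)) = (\<integral>\<^sup>+x. indicator (\<Union>i\<in>K. ball (fst i) (a * snd i)) x \<partial>lborel)"
    by (subst nn_integral_indicator) (auto intro!: borel_open open_UN)
  also have "\<dots> \<le> (\<integral>\<^sup>+x. (\<integral>\<^sup>+i. indicator (ball (fst i) (5 * snd i)) x \<partial>count_space C) \<partial>lborel)"
  proof (rule nn_integral_mono)
    fix x :: "real^'n"
    show "indicator (\<Union>i\<in>K. ball (fst i) (a * snd i)) x \<le> (\<integral>\<^sup>+i. indicator (ball (fst i) (5 * snd i)) x \<partial>count_space C :: ennreal)"
    proof (cases "x \<in> (\<Union>i\<in>K. ball (fst i) (a * snd i))")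
      case True
      then obtain i where "i \<in> K'" "x \<in> ball (fst i) (snd i)" by (force simp: K'_def)
      with cov obtain j where "j \<in> C" "x \<in> ball (fst j) (5 * snd j)" by blast
      from indicator_le_count_space[of j C x "\<lambda>i. ball (fst i) (5 * snd i)", OF this] True show ?thesis by simp
    qed simp
  qed
  also have "\<dots> = (\<integral>\<^sup>+i. (\<integral>\<^sup>+x. indicator (ball (fst i) (5 * snd i)) x \<partial>lborel) \<partial>count_space C)"
    using C by (intro nn_integral_count_space_nn_integral) auto
  also have "\<dots> \<le> (\<integral>\<^sup>+i. ennreal ((5 * a) ^ CARD('n)) * (\<integral>\<^sup>+x. \<rho> x * indicator (ball (fst i) (snd i)) x \<partial>lborel) \<partial>count_space C)"
    using ball_le by (intro nn_integral_mono) auto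
  also have "\<dots> = ennreal ((5 * a) ^ CARD('n)) * (\<integral>\<^sup>+i. (\<integral>\<^sup>+x. \<rho> x * indicator (ball (fst i) (snd i)) x \<partial>lborel) \<partial>count_space C)"
    by (rule nn_integral_cmult) simp
  also have "(\<integral>\<^sup>+i. (\<integral>\<^sup>+x. \<rho> x * indicator (ball (fst i) (snd i)) x \<partial>lborel) \<partial>count_space C)
      = (\<integral>\<^sup>+x. (\<integral>\<^sup>+i. \<rho> x * indicator (ball (fst i) (snd i)) x \<partial>count_space C) \<partial>lborel)"
    using C by (intro nn_integral_count_space_nn_integral[symmetric]) auto
  also have "\<dots> \<le> (\<integral>\<^sup>+x. \<rho> x * 1 \<partial>lborel)"
    by (intro nn_integral_mono, subst nn_integral_cmult) (simp_all add: mult_left_mono[OF one, simplified])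
  finally show ?thesis by (simp add: mult_left_mono)
qed

definition Carleson_density :: "((real^'n) \<times> real \<Rightarrow> ennreal) \<Rightarrow> ennreal \<Rightarrow> bool" where
  "Carleson_density \<mu> A \<longleftrightarrow>
     (\<forall>c r. 0 < r \<longrightarrow> (\<integral>\<^sup>+z\<in>tent_hat c r. \<mu> z \<partial>lborel) \<le> A * emeasure lborel (ball c r))"

text \<open>Among the balls contained in \<open>S\<close>, a disjoint family is selected whose
  fivefold enlargements have tents covering the tent over \<open>S\<close>; the Carleson bound on
  balls is then summed. \<open>A \<noteq> 0\<close> keeps the right side infinite when
  \<open>S\<close> has infinite measure.\<close>

lemma tent_over_open:
  fixes \<mu> :: "(real^'n) \<times> real \<Rightarrow> ennreal"
  assumes [measurable]: "\<mu> \<in> borel_measurable borel" and S: "open S" and A: "A \<noteq> 0"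
    and car: "Carleson_density \<mu> A"
  shows "(\<integral>\<^sup>+z\<in>{z. 0 < snd z \<and> ball (fst z) (snd z) \<subseteq> S}. \<mu> z \<partial>lborel)
    \<le> ennreal (5 ^ CARD('n)) * A * emeasure lborel S"
proof (cases "emeasure lborel S < top")
  case False
  then show ?thesis using A by (auto simp: less_top[symmetric] ennreal_mult_top)
next
  case True
  then obtain B where B: "\<And>(y::real^'n) t. 0 < t \<Longrightarrow> emeasure lborel (ball y t) \<le> emeasure lborel S \<Longrightarrow> t \<le> B"
    using ball_radius_bounded by blast
  have Sm [measurable]: "S \<in> sets lborel" using S by simp
  define K where "K = {z. 0 < snd z \<and> ball (fst z) (snd z) \<subseteq> S}"
  obtain C where C: "countable C" "C \<subseteq> K"
    and one: "\<And>x. (\<integral>\<^sup>+i. indicator (ball (fst i) (snd i)) x \<partial>count_space C) \<le> (1::ennreal)"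
    and cov: "\<And>i. i \<in> K \<Longrightarrow> \<exists>j\<in>C. ball (fst i) (snd i) \<subseteq> ball (fst j) (5 * snd j)"
  proof (rule Vitali_selection[of K B])
    show "0 < snd i \<and> snd i \<le> B" if "i \<in> K" for i
      using that Sm by (auto simp: K_def intro!: B emeasure_mono)
  qed blast
  have hat_meas [measurable]: "tent_hat c r \<in> sets borel" for c :: "real^'n" and r
    unfolding tent_hat_def ball_subset_ball_iff case_prod_beta' by measurable
  have "(\<integral>\<^sup>+z\<in>K. \<mu> z \<partial>lborel) \<le> (\<integral>\<^sup>+z. (\<integral>\<^sup>+i. \<mu> z * indicator (tent_hat (fst i) (5 * snd i)) z \<partial>count_space C) \<partial>lborel)"
  proof (rule nn_integral_mono)
    fix z :: "(real^'n) \<times> real"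
    show "\<mu> z * indicator K z \<le> (\<integral>\<^sup>+i. \<mu> z * indicator (tent_hat (fst i) (5 * snd i)) z \<partial>count_space C)"
    proof (cases "z \<in> K")
      case True
      with cov obtain j where "j \<in> C" "ball (fst z) (snd z) \<subseteq> ball (fst j) (5 * snd j)" by blast
      then have "j \<in> C" "z \<in> tent_hat (fst j) (5 * snd j)" using True
        by (auto simp: tent_hat_def K_def split: prod.splits)
      from indicator_le_count_space[of j C z "\<lambda>i. tent_hat (fst i) (5 * snd i)", OF this]
      have "\<mu> z * 1 \<le> \<mu> z * (\<integral>\<^sup>+i. indicator (tent_hat (fst i) (5 * snd i)) z \<partial>count_space C)"
        by (rule mult_left_mono) simp
      then show ?thesis using True by (simp add: nn_integral_cmult)
    qed simp
  qed
  also have "\<dots> = (\<integral>\<^sup>+i. (\<integral>\<^sup>+z. \<mu> z * indicator (tent_hat (fst i) (5 * snd i)) z \<partial>lborel) \<partial>count_space C)"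
    using C by (intro nn_integral_count_space_nn_integral) auto
  also have "\<dots> \<le> (\<integral>\<^sup>+i. (A * ennreal (5 ^ CARD('n))) * (\<integral>\<^sup>+x. indicator S x * indicator (ball (fst i) (snd i)) x \<partial>lborel) \<partial>count_space C)"
  proof (rule nn_integral_mono)
    fix i assume "i \<in> space (count_space C)"
    then have i: "0 < snd i" "ball (fst i) (snd i) \<subseteq> S" using C by (auto simp: K_def)
    have "(\<integral>\<^sup>+z. \<mu> z * indicator (tent_hat (fst i) (5 * snd i)) z \<partial>lborel) \<le> A * emeasure lborel (ball (fst i) (5 * snd i))"
      using i car by (simp add: Carleson_density_def)
    also have "emeasure lborel (ball (fst i) (5 * snd i)) = ennreal (5 ^ CARD('n)) * emeasure lborel (ball (fst i) (snd i))"
      using i by (intro emeasure_ball_scale) auto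
    also have "emeasure lborel (ball (fst i) (snd i)) = (\<integral>\<^sup>+x. indicator (ball (fst i) (snd i)) x \<partial>lborel)"
      by (subst nn_integral_indicator) auto
    also have "\<dots> = (\<integral>\<^sup>+x. indicator S x * indicator (ball (fst i) (snd i)) x \<partial>lborel)"
      using i(2) by (intro nn_integral_cong) (auto simp: indicator_def)
    finally show "(\<integral>\<^sup>+z. \<mu> z * indicator (tent_hat (fst i) (5 * snd i)) z \<partial>lborel)
       \<le> (A * ennreal (5 ^ CARD('n))) * (\<integral>\<^sup>+x. indicator S x * indicator (ball (fst i) (snd i)) x \<partial>lborel)"
      by (simp add: mult_ac)
  qed
  also have "\<dots> = (A * ennreal (5 ^ CARD('n))) * (\<integral>\<^sup>+i. (\<integral>\<^sup>+x. indicator S x * indicator (ball (fst i) (snd i)) x \<partial>lborel) \<partial>count_space C)"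
    by (rule nn_integral_cmult) simp
  also have "(\<integral>\<^sup>+i. (\<integral>\<^sup>+x. indicator S x * indicator (ball (fst i) (snd i)) x \<partial>lborel) \<partial>count_space C)
      = (\<integral>\<^sup>+x. (\<integral>\<^sup>+i. indicator S x * indicator (ball (fst i) (snd i)) x \<partial>count_space C) \<partial>lborel)"
    using C by (intro nn_integral_count_space_nn_integral[symmetric]) auto
  also have "\<dots> \<le> (\<integral>\<^sup>+x. indicator S x * 1 \<partial>lborel)"
    by (intro nn_integral_mono, subst nn_integral_cmult) (simp_all add: mult_left_mono[OF one, simplified])
  also have "\<dots> = emeasure lborel S" using nn_integral_indicator[OF Sm] by simp
  finally show ?thesis unfolding K_def by (simp add: mult_ac mult_left_mono mult_right_mono)
qed

section \<open>Nontangential maximal functions and the Carleson embedding\<close>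

definition ntmax :: "real \<Rightarrow> ((real^'n) \<times> real \<Rightarrow> ennreal) \<Rightarrow> real^'n \<Rightarrow> ennreal" where
  "ntmax a k x = (SUP z\<in>{z. 0 < snd z \<and> dist (fst z) x < a * snd z}. k z)"

lemma ntmax_1: "ntmax 1 k x = (SUP z\<in>cone x. k z)"
  unfolding ntmax_def cone_def by (intro SUP_cong) auto

lemma ntmax_upper: "0 < snd z \<Longrightarrow> dist (fst z) x < a * snd z \<Longrightarrow> k z \<le> ntmax a k x"
  unfolding ntmax_def by (rule SUP_upper) simp

text \<open>The supremum at \<open>x\<close> exceeds \<open>c\<close> exactly if some
  \<open>z\<close> with \<open>k z > c\<close> has \<open>x\<close> in its dilated ball. So
  superlevel sets are open for every function \<open>k\<close>, and they have the form to which
  \<open>ball_covering\<close> applies.\<close>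

lemma ntmax_superlevel:
  "{x. c < ntmax a k x} = (\<Union>z\<in>{z. 0 < snd z \<and> c < k z}. ball (fst z) (a * snd z))"
  unfolding ntmax_def less_SUP_iff by (auto; force)

lemma open_ntmax_superlevel: "open {x. c < ntmax a k x}"
  unfolding ntmax_superlevel by auto

lemma borel_measurable_ntmax [measurable]: "ntmax a k \<in> borel_measurable borel"
  by (rule borel_measurableI_greater) (simp add: borel_open open_ntmax_superlevel)

lemma epow_ntmax: "0 < s \<Longrightarrow> ntmax a (\<lambda>z. epow (k z) s) x = epow (ntmax a k x) s"
  unfolding ntmax_def by (simp add: epow_SUP)

text \<open>If \<open>k z > t\<close>, every \<open>x\<close> in the ball of \<open>z\<close> has
  \<open>z\<close> in its cone, so that ball lies in the open set where the maximal function exceeds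
  \<open>t\<close>. The Carleson bound for tents over open sets is then integrated over all
  levels.\<close>

lemma Carleson_embedding:
  fixes \<mu> k :: "(real^'n) \<times> real \<Rightarrow> ennreal"
  assumes [measurable]: "\<mu> \<in> borel_measurable borel" "k \<in> borel_measurable borel" and A: "A \<noteq> 0"
    and car: "Carleson_density \<mu> A"
  shows "(\<integral>\<^sup>+z\<in>{z. 0 < snd z}. k z * \<mu> z \<partial>lborel) \<le> ennreal (5 ^ CARD('n)) * A * (\<integral>\<^sup>+x. ntmax 1 k x \<partial>lborel)"
proof -
  have "(\<integral>\<^sup>+z. k z * (\<mu> z * indicator {z. 0 < snd z} z) \<partial>lborel) \<le> ennreal (5 ^ CARD('n)) * A * (\<integral>\<^sup>+x. ntmax 1 k x \<partial>lborel)"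
  proof (rule layer_comparison)
    fix t :: real
    let ?S = "{x. ennreal t < ntmax 1 k x}"
    have "(\<integral>\<^sup>+z\<in>{z. ennreal t < k z}. \<mu> z * indicator {z. 0 < snd z} z \<partial>lborel)
        \<le> (\<integral>\<^sup>+z\<in>{z. 0 < snd z \<and> ball (fst z) (snd z) \<subseteq> ?S}. \<mu> z \<partial>lborel)"
    proof (intro nn_integral_mono)
      fix z :: "(real^'n) \<times> real"
      have "ball (fst z) (snd z) \<subseteq> ?S" if "ennreal t < k z" "0 < snd z"
        using that ntmax_upper[of z _ 1 k] by (auto intro: less_le_trans)
      then show "\<mu> z * indicator {z. 0 < snd z} z * indicator {z. ennreal t < k z} z
         \<le> \<mu> z * indicator {z. 0 < snd z \<and> ball (fst z) (snd z) \<subseteq> ?S} z"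
        by (auto simp: indicator_def)
    qed
    also have "\<dots> \<le> ennreal (5 ^ CARD('n)) * A * emeasure lborel ?S"
      using A car open_ntmax_superlevel by (intro tent_over_open) auto
    finally show "(\<integral>\<^sup>+z\<in>{z. ennreal t < k z}. \<mu> z * indicator {z. 0 < snd z} z \<partial>lborel)
       \<le> ennreal (5 ^ CARD('n)) * A * emeasure lborel ?S" .
  qed measurable
  then show ?thesis by (simp add: mult_ac)
qed

section \<open>The maximal theorem\<close>

definition ball_avg :: "(real^'n \<Rightarrow> ennreal) \<Rightarrow> (real^'n) \<times> real \<Rightarrow> ennreal" where
  "ball_avg h z = (\<integral>\<^sup>+x\<in>ball (fst z) (snd z). h x \<partial>lborel) / emeasure lborel (ball (fst z) (snd z))"

lemma mem_cone [simp]: "z \<in> cone x \<longleftrightarrow> 0 < snd z \<and> dist (fst z) x < snd z"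
  by (auto simp: cone_def)

lemma pred_cone [measurable]:
  assumes [measurable]: "f \<in> borel_measurable M" "g \<in> borel_measurable M"
  shows "Measurable.pred M (\<lambda>w. g w \<in> cone (f w))"
  by simp

lemma borel_measurable_emeasure_ball [measurable (raw)]:
  fixes f :: "'a \<Rightarrow> real^'n"
  assumes [measurable]: "f \<in> borel_measurable M" "g \<in> borel_measurable M"
  shows "(\<lambda>w. emeasure lborel (ball (f w) (g w))) \<in> borel_measurable M"
proof -
  have "emeasure lborel (ball y t) = (if t \<le> 0 then 0 else
      ennreal (unit_ball_vol (real CARD('n)) * t ^ CARD('n)))" for y :: "real^'n" and t
    by (auto simp: emeasure_ball_vec ball_empty)
  then show ?thesis by simp
qed

lemma borel_measurable_ball_integral [measurable]:
  fixes h :: "real^'n \<Rightarrow> ennreal"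
  assumes [measurable]: "h \<in> borel_measurable borel"
  shows "(\<lambda>z. \<integral>\<^sup>+x\<in>ball (fst z) (snd z). h x \<partial>lborel) \<in> borel_measurable borel"
  by measurable

lemma borel_measurable_ball_avg [measurable]:
  assumes [measurable]: "h \<in> borel_measurable borel"
  shows "ball_avg h \<in> borel_measurable borel"
  unfolding ball_avg_def[abs_def] by measurable

lemma ball_avg_1: "0 < snd z \<Longrightarrow> ball_avg (\<lambda>_. 1) z = 1"
  unfolding ball_avg_def by (simp add: emeasure_ball_bounds)

lemma borel_measurable_cone_integral [measurable]:
  assumes [measurable]: "F \<in> borel_measurable borel"
  shows "(\<lambda>x. \<integral>\<^sup>+z\<in>cone x. F z \<partial>lborel) \<in> borel_measurable borel"
  by measurable

text \<open>For fixed \<open>z = (y,t)\<close> the points \<open>x\<close> with \<open>z\<close> in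
  their cone fill the ball \<open>B(y,t)\<close>, whose volume is a constant times
  \<open>t^n\<close>. This reduces the density \<open>1/t^(n+1)\<close> to \<open>1/t\<close> and
  turns the integral of \<open>h\<close> into its average.\<close>

lemma cone_integral_Fubini:
  fixes h :: "real^'n \<Rightarrow> ennreal" and F :: "(real^'n) \<times> real \<Rightarrow> ennreal"
  assumes [measurable]: "h \<in> borel_measurable borel" "F \<in> borel_measurable borel"
  shows "(\<integral>\<^sup>+x. h x * (\<integral>\<^sup>+z\<in>cone x. F z / ennreal (snd z ^ (CARD('n) + 1)) \<partial>lborel) \<partial>lborel)
    = ennreal (unit_ball_vol (real CARD('n))) * (\<integral>\<^sup>+z\<in>{z. 0 < snd z}. F z / ennreal (snd z) * ball_avg h z \<partial>lborel)"
proof -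
  let ?w = "unit_ball_vol (real CARD('n))"
  have "(\<integral>\<^sup>+x. h x * (\<integral>\<^sup>+z\<in>cone x. F z / ennreal (snd z ^ (CARD('n) + 1)) \<partial>lborel) \<partial>lborel)
    = (\<integral>\<^sup>+x. (\<integral>\<^sup>+z. h x * (F z / ennreal (snd z ^ (CARD('n) + 1)) * indicator (cone x) z) \<partial>lborel) \<partial>lborel)"
    by (simp add: nn_integral_cmult)
  also have "\<dots> = (\<integral>\<^sup>+z. (\<integral>\<^sup>+x. h x * (F z / ennreal (snd z ^ (CARD('n) + 1)) * indicator (cone x) z) \<partial>lborel) \<partial>lborel)"
    by (rule lborel_pair.Fubini') measurable
  also have "\<dots> = (\<integral>\<^sup>+z. ennreal ?w * (F z / ennreal (snd z) * ball_avg h z * indicator {z. 0 < snd z} z) \<partial>lborel)"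
  proof (rule nn_integral_cong)
    fix z :: "(real^'n) \<times> real"
    show "(\<integral>\<^sup>+x. h x * (F z / ennreal (snd z ^ (CARD('n) + 1)) * indicator (cone x) z) \<partial>lborel)
      = ennreal ?w * (F z / ennreal (snd z) * ball_avg h z * indicator {z. 0 < snd z} z)"
    proof (cases "0 < snd z")
      case True
      let ?t = "snd z"
      define I where "I = (\<integral>\<^sup>+x\<in>ball (fst z) ?t. h x \<partial>lborel)"
      have "(\<integral>\<^sup>+x. h x * (F z / ennreal (?t ^ (CARD('n) + 1)) * indicator (cone x) z) \<partial>lborel)
        = (\<integral>\<^sup>+x. F z / ennreal (?t ^ (CARD('n) + 1)) * (h x * indicator (ball (fst z) ?t) x) \<partial>lborel)"
        using True by (intro nn_integral_cong) (auto simp: indicator_def mult_ac)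
      also have "\<dots> = F z / ennreal (?t ^ (CARD('n) + 1)) * I"
        unfolding I_def by (rule nn_integral_cmult) simp
      also have "\<dots> = ennreal ?w * (F z / ennreal ?t * (I / ennreal (?w * ?t ^ CARD('n))))"
      proof -
        have "F z / ennreal (?t ^ (CARD('n) + 1)) * I = F z * I * ennreal (inverse (?t ^ (CARD('n) + 1)))"
          using True by (simp add: divide_ennreal_def inverse_ennreal mult_ac del: power_Suc)
        also have "inverse (?t ^ (CARD('n) + 1)) = ?w * (inverse ?t * inverse (?w * ?t ^ CARD('n)))"
          using True by (simp add: field_simps)
        also have "ennreal \<dots> = ennreal ?w * (ennreal (inverse ?t) * ennreal (inverse (?w * ?t ^ CARD('n))))"
          using True by (simp add: less_imp_le flip: ennreal_mult)
        finally show ?thesis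
          using True by (simp add: divide_ennreal_def inverse_ennreal mult_ac del: inverse_mult_distrib)
      qed
      finally show ?thesis
        using True by (simp add: ball_avg_def emeasure_ball_vec I_def)
    qed simp
  qed
  also have "\<dots> = ennreal ?w * (\<integral>\<^sup>+z\<in>{z. 0 < snd z}. F z / ennreal (snd z) * ball_avg h z \<partial>lborel)"
    by (rule nn_integral_cmult) measurable
  finally show ?thesis .
qed

text \<open>The part of \<open>h\<close> below \<open>\<tau>\<close> contributes at most
  \<open>\<tau>\<close> to an average, so an average above \<open>2 * \<tau>\<close> leaves mean at
  least one to \<open>h/\<tau>\<close> restricted to \<open>h > \<tau>\<close>; this is the
  hypothesis of \<open>ball_covering\<close>. The restriction to large values of \<open>h\<close> is
  what makes the estimate integrable over the levels.\<close>

lemma maximal_weak_type: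
  fixes h :: "real^'n \<Rightarrow> ennreal"
  assumes [measurable]: "h \<in> borel_measurable borel" and \<tau>: "0 < \<tau>"
  shows "emeasure lborel {x. ennreal (2 * \<tau>) < ntmax 1 (ball_avg h) x}
    \<le> ennreal (5 ^ CARD('n)) * (\<integral>\<^sup>+x\<in>{x. ennreal \<tau> < h x}. h x / ennreal \<tau> \<partial>lborel)"
proof -
  let ?\<rho> = "\<lambda>x. h x / ennreal \<tau> * indicator {x. ennreal \<tau> < h x} x"
  let ?K = "{z. 0 < snd z \<and> ennreal (2 * \<tau>) < ball_avg h z}"
  have "emeasure lborel (\<Union>i\<in>?K. ball (fst i) (1 * snd i)) \<le> ennreal ((5 * 1) ^ CARD('n)) * (\<integral>\<^sup>+x. ?\<rho> x \<partial>lborel)"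
  proof (rule ball_covering)
    fix y :: "real^'n" and t assume "(y, t) \<in> ?K"
    then have t: "0 < t" and avg: "ennreal (2 * \<tau>) < (\<integral>\<^sup>+x\<in>ball y t. h x \<partial>lborel) / emeasure lborel (ball y t)"
      by (auto simp: ball_avg_def)
    let ?B = "emeasure lborel (ball y t)"
    have "ennreal (2 * \<tau>) * ?B \<le> (\<integral>\<^sup>+x\<in>ball y t. h x \<partial>lborel)"
    proof -
      have "ennreal (2 * \<tau>) * ?B \<le> (\<integral>\<^sup>+x\<in>ball y t. h x \<partial>lborel) / ?B * ?B"
        using avg by (intro mult_right_mono) auto
      also have "\<dots> = (\<integral>\<^sup>+x\<in>ball y t. h x \<partial>lborel)"
        using t emeasure_ball_bounds[of t y] by (simp add: ennreal_divide_times)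
      finally show ?thesis .
    qed
    then have "ennreal (2 * \<tau>) * ?B / ennreal \<tau> \<le> (\<integral>\<^sup>+x\<in>ball y t. h x \<partial>lborel) / ennreal \<tau>"
      by (rule divide_right_mono_ennreal)
    moreover have "ennreal (2 * \<tau>) * ?B / ennreal \<tau> = 2 * ?B"
    proof -
      have "ennreal (2 * \<tau>) * ?B = (2 * ?B) * ennreal \<tau>"
        using \<tau> by (simp add: ennreal_mult mult_ac)
      then show ?thesis using \<tau> by (simp only: mult_divide_eq_ennreal ennreal_neq_top) (simp add: mult_divide_eq_ennreal)
    qed
    ultimately have "2 * ?B \<le> (\<integral>\<^sup>+x\<in>ball y t. h x \<partial>lborel) / ennreal \<tau>" by simp
    also have "\<dots> = (\<integral>\<^sup>+x. h x * indicator (ball y t) x / ennreal \<tau> \<partial>lborel)"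
      by (rule nn_integral_divide[symmetric]) simp
    also have "\<dots> \<le> (\<integral>\<^sup>+x. ?\<rho> x * indicator (ball y t) x + indicator (ball y t) x \<partial>lborel)"
    proof (rule nn_integral_mono)
      fix x
      show "h x * indicator (ball y t) x / ennreal \<tau> \<le> ?\<rho> x * indicator (ball y t) x + indicator (ball y t) x"
      proof (cases "ennreal \<tau> < h x")
        case False
        then have "h x / ennreal \<tau> \<le> ennreal \<tau> / ennreal \<tau>" by (intro divide_right_mono_ennreal) simp
        then show ?thesis using \<tau> by (auto simp: indicator_def)
      qed (auto simp: indicator_def)
    qed
    also have "\<dots> = (\<integral>\<^sup>+x\<in>ball y t. ?\<rho> x \<partial>lborel) + ?B"
      by (subst nn_integral_add) auto
    finally have "2 * ?B \<le> (\<integral>\<^sup>+x\<in>ball y t. ?\<rho> x \<partial>lborel) + ?B" .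
    then have "?B + ?B \<le> ?B + (\<integral>\<^sup>+x\<in>ball y t. ?\<rho> x \<partial>lborel)"
      unfolding mult_2 by (subst (2) add.commute)
    then show "0 < t \<and> ?B \<le> (\<integral>\<^sup>+x\<in>ball y t. ?\<rho> x \<partial>lborel)"
      using t emeasure_ball_bounds[of t y] by (simp add: ennreal_add_left_cancel_le)
  qed auto
  then show ?thesis by (simp add: ntmax_superlevel)
qed

lemma nn_integral_powr_below:
  assumes a: "0 < a" "a < 1"
  shows "(\<integral>\<^sup>+t. indicator {t. 0 < t \<and> ennreal t < v} t * ennreal (t powr (- a)) \<partial>lborel) \<le> ennreal (1 / (1 - a)) * epow v (1 - a)"
proof (cases v)
  case (real r)
  have "((\<lambda>t. t powr (-a)) has_integral (r powr (-a + 1) / (-a + 1))) {0..r}"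
    using a real by (intro has_integral_powr_from_0) auto
  then have "integral\<^sup>N lborel (\<lambda>t. ennreal (t powr (-a)) * indicator {0..r} t) = ennreal (r powr (-a + 1) / (-a + 1))"
    by (intro nn_integral_has_integral_lebesgue') auto
  moreover have "(\<integral>\<^sup>+t. indicator {t. 0 < t \<and> ennreal t < v} t * ennreal (t powr (- a)) \<partial>lborel)
      \<le> integral\<^sup>N lborel (\<lambda>t. ennreal (t powr (-a)) * indicator {0..r} t)"
    using real by (intro nn_integral_mono) (auto simp: indicator_def ennreal_less_iff)
  ultimately show ?thesis using real a by (simp add: epow_ennreal flip: ennreal_mult)
next
  case top
  then show ?thesis using a by (simp add: ennreal_mult_top)
qed

text \<open>With aperture one the nontangential maximal function of the ball averages is the
  uncentred Hardy-Littlewood maximal function. Its weak estimate is integrated over levels;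
  exchanging integrals leaves the integral of \<open>t^(-1/p)\<close> up to \<open>(2 h)^p\<close>,
  which converges at zero since \<open>p > 1\<close>. The constant \<open>c\<close> is the conjugate
  exponent of \<open>p\<close>.\<close>

lemma maximal_strong_type:
  assumes p: "1 < p"
  obtains C where "0 \<le> C" "\<And>h :: real^'n \<Rightarrow> ennreal. h \<in> borel_measurable borel \<Longrightarrow>
    (\<integral>\<^sup>+x. epow (ntmax 1 (ball_avg h) x) p \<partial>lborel) \<le> ennreal C * (\<integral>\<^sup>+x. epow (h x) p \<partial>lborel)"
proof -
  define c where "c = 1 / (1 - 1 / p)"
  have c: "0 \<le> c" using p by (simp add: c_def)
  have main: "(\<integral>\<^sup>+x. epow (ntmax 1 (ball_avg h) x) p \<partial>lborel) \<le> ennreal (5 ^ CARD('n) * c * 2 powr p) * (\<integral>\<^sup>+x. epow (h x) p \<partial>lborel)"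
    if [measurable]: "h \<in> borel_measurable borel" for h :: "real^'n \<Rightarrow> ennreal"
  proof -
    let ?M = "ntmax 1 (ball_avg h)"
    have "(\<integral>\<^sup>+x. epow (?M x) p * 1 \<partial>lborel)
        = (\<integral>\<^sup>+t. indicator {0<..} t * (\<integral>\<^sup>+x\<in>{x. ennreal t < epow (?M x) p}. 1 \<partial>lborel) \<partial>lborel)"
      by (rule nn_integral_layer_cake) measurable
    also have "\<dots> \<le> (\<integral>\<^sup>+t. ennreal (5 ^ CARD('n)) * (\<integral>\<^sup>+x. 2 * h x * (indicator {t. 0 < t \<and> ennreal t < epow (2 * h x) p} t * ennreal (t powr (- (1 / p)))) \<partial>lborel) \<partial>lborel)"
    proof (rule nn_integral_mono)
      fix t :: real
      show "indicator {0<..} t * (\<integral>\<^sup>+x\<in>{x. ennreal t < epow (?M x) p}. 1 \<partial>lborel) \<le>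
        ennreal (5 ^ CARD('n)) * (\<integral>\<^sup>+x. 2 * h x * (indicator {t. 0 < t \<and> ennreal t < epow (2 * h x) p} t * ennreal (t powr (- (1 / p)))) \<partial>lborel)"
      proof (cases "0 < t")
        case True
        \<comment> \<open>The level of the maximal function itself is
          \<open>t^(1/p) = 2 * \<tau>\<close>, to match the weak estimate.\<close>
        define \<tau> where "\<tau> = t powr (1 / p) / 2"
        have \<tau>: "0 < \<tau>" using True by (simp add: \<tau>_def)
        have "(ennreal t < epow (?M x) p) = (ennreal (2 * \<tau>) < ?M x)" for x
          using True p by (simp add: epow_less_swap epow_ennreal \<tau>_def)
        then have "(\<integral>\<^sup>+x\<in>{x. ennreal t < epow (?M x) p}. 1 \<partial>lborel) = emeasure lborel {x. ennreal (2 * \<tau>) < ?M x}"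
          by simp
        also have "\<dots> \<le> ennreal (5 ^ CARD('n)) * (\<integral>\<^sup>+x\<in>{x. ennreal \<tau> < h x}. h x / ennreal \<tau> \<partial>lborel)"
          using \<tau> by (intro maximal_weak_type) auto
        also have "(\<integral>\<^sup>+x\<in>{x. ennreal \<tau> < h x}. h x / ennreal \<tau> \<partial>lborel)
          = (\<integral>\<^sup>+x. 2 * h x * (indicator {t. 0 < t \<and> ennreal t < epow (2 * h x) p} t * ennreal (t powr (- (1 / p)))) \<partial>lborel)"
        proof (rule nn_integral_cong)
          fix x
          have "(ennreal t < epow (2 * h x) p) = (2 * ennreal \<tau> < 2 * h x)"
            using True p by (simp add: epow_less_swap epow_ennreal \<tau>_def numeral_mult_ennreal)
          also have "\<dots> = (ennreal \<tau> < h x)"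
          proof -
            have "(2 * h x \<le> 2 * ennreal \<tau>) = (h x \<le> ennreal \<tau>)"
              by (rule ennreal_mult_le_mult_iff) auto
            then show ?thesis by (metis linorder_not_le)
          qed
          finally have eq: "(ennreal t < epow (2 * h x) p) = (ennreal \<tau> < h x)" .
          have "h x / ennreal \<tau> = 2 * h x * ennreal (t powr (- (1 / p)))"
          proof -
            have "h x / ennreal \<tau> = h x * ennreal (2 * t powr (- (1 / p)))"
            proof -
              have "inverse \<tau> = 2 * t powr (- (1 / p))"
                using True by (simp add: \<tau>_def powr_minus_divide)
              then show ?thesis using \<tau> by (simp add: divide_ennreal_def inverse_ennreal)
            qed
            then show ?thesis by (simp add: ennreal_mult mult_ac)
          qed
          then show "h x / ennreal \<tau> * indicator {x. ennreal \<tau> < h x} x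
            = 2 * h x * (indicator {t. 0 < t \<and> ennreal t < epow (2 * h x) p} t * ennreal (t powr (- (1 / p))))"
            using True eq by (auto simp: indicator_def)
        qed
        finally show ?thesis using True by simp
      qed simp
    qed
    also have "\<dots> = ennreal (5 ^ CARD('n)) * (\<integral>\<^sup>+t. (\<integral>\<^sup>+x. 2 * h x * (indicator {t. 0 < t \<and> ennreal t < epow (2 * h x) p} t * ennreal (t powr (- (1 / p)))) \<partial>lborel) \<partial>lborel)"
      by (rule nn_integral_cmult) measurable
    also have "(\<integral>\<^sup>+t. (\<integral>\<^sup>+x. 2 * h x * (indicator {t. 0 < t \<and> ennreal t < epow (2 * h x) p} t * ennreal (t powr (- (1 / p)))) \<partial>lborel) \<partial>lborel)
        = (\<integral>\<^sup>+x. (\<integral>\<^sup>+t. 2 * h x * (indicator {t. 0 < t \<and> ennreal t < epow (2 * h x) p} t * ennreal (t powr (- (1 / p)))) \<partial>lborel) \<partial>lborel)"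
      by (rule lborel_pair.Fubini') measurable
    also have "\<dots> \<le> (\<integral>\<^sup>+x. ennreal (c * 2 powr p) * epow (h x) p \<partial>lborel)"
    proof (rule nn_integral_mono)
      fix x
      have "(\<integral>\<^sup>+t. 2 * h x * (indicator {t. 0 < t \<and> ennreal t < epow (2 * h x) p} t * ennreal (t powr (- (1 / p)))) \<partial>lborel)
        = 2 * h x * (\<integral>\<^sup>+t. indicator {t. 0 < t \<and> ennreal t < epow (2 * h x) p} t * ennreal (t powr (- (1 / p))) \<partial>lborel)"
        by (rule nn_integral_cmult) measurable
      also have "\<dots> \<le> 2 * h x * (ennreal c * epow (epow (2 * h x) p) (1 - 1 / p))"
        unfolding c_def using p by (intro mult_left_mono nn_integral_powr_below) auto
      also have "epow (epow (2 * h x) p) (1 - 1 / p) = epow (2 * h x) (p - 1)"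
      proof -
        have "p * (1 - 1 / p) = p - 1" using p by (simp add: right_diff_distrib)
        then show ?thesis by (simp add: epow_epow)
      qed
      also have "2 * h x * (ennreal c * epow (2 * h x) (p - 1)) = ennreal c * (epow (2 * h x) 1 * epow (2 * h x) (p - 1))"
        by (simp add: mult_ac)
      also have "epow (2 * h x) 1 * epow (2 * h x) (p - 1) = epow (2 * h x) p"
        unfolding epow_add[symmetric] by simp
      also have "ennreal c * epow (2 * h x) p = ennreal c * (ennreal (2 powr p) * epow (h x) p)"
        using epow_ennreal[of 2 p] by (simp add: epow_mult)
      finally show "(\<integral>\<^sup>+t. 2 * h x * (indicator {t. 0 < t \<and> ennreal t < epow (2 * h x) p} t * ennreal (t powr (- (1 / p)))) \<partial>lborel)
        \<le> ennreal (c * 2 powr p) * epow (h x) p" using c by (simp add: ennreal_mult mult.assoc)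
    qed
    also have "\<dots> = ennreal (c * 2 powr p) * (\<integral>\<^sup>+x. epow (h x) p \<partial>lborel)"
      by (rule nn_integral_cmult) measurable
    finally have "(\<integral>\<^sup>+x. epow (?M x) p * 1 \<partial>lborel) \<le> ennreal (5 ^ CARD('n)) * (ennreal (c * 2 powr p) * (\<integral>\<^sup>+x. epow (h x) p \<partial>lborel))"
      by (simp add: mult_left_mono)
    then show ?thesis using c by (simp add: ennreal_mult mult.assoc)
  qed
  show ?thesis
    by (rule that[of "5 ^ CARD('n) * c * 2 powr p"]) (use c main in auto)
qed

section \<open>Products with Carleson densities\<close>

text \<open>Absorption: as \<open>X\<close> is finite, the power \<open>X^b\<close> on the right can
  be divided out, leaving \<open>X^a \<le> P\<close>.\<close>

lemma epow_self_bound: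
  assumes "X \<le> P * epow X b" "X < top" "0 < a" "a + b = 1"
  shows "X \<le> epow P (1 / a)"
proof (cases "X = 0")
  case False
  have "epow X b * epow X a = X"
    using assms(4) epow_add[of X b a] by (simp add: add.commute)
  then have "epow X b * epow X a \<le> epow X b * P" using assms(1) by (simp add: mult.commute)
  then have "epow X a \<le> P"
    using False assms(2) by (subst (asm) ennreal_mult_le_mult_iff) (auto simp: less_top)
  then show ?thesis using assms(3) by (simp add: epow_le_swap)
qed simp

text \<open>Testing the area function against \<open>h\<close> moves \<open>h\<close> into the
  half-space as its ball averages. The Carleson embedding then applies to \<open>k\<close> times
  these averages, and a supremum of products is at most the product of the suprema. The second
  factor is the Hardy-Littlewood maximal function of \<open>h\<close>.\<close>

lemma cone_integral_Carleson:
  fixes k m :: "(real^'n) \<times> real \<Rightarrow> ennreal" and h :: "real^'n \<Rightarrow> ennreal"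
  assumes [measurable]: "k \<in> borel_measurable borel" "m \<in> borel_measurable borel" "h \<in> borel_measurable borel"
    and A: "A \<noteq> 0"
    and car: "Carleson_density (\<lambda>z. m z / ennreal (snd z)) A"
  shows "(\<integral>\<^sup>+x. h x * (\<integral>\<^sup>+z\<in>cone x. k z * m z / ennreal (snd z ^ (CARD('n) + 1)) \<partial>lborel) \<partial>lborel)
    \<le> ennreal (unit_ball_vol (real CARD('n)) * 5 ^ CARD('n)) * A * (\<integral>\<^sup>+x. ntmax 1 k x * ntmax 1 (ball_avg h) x \<partial>lborel)"
proof -
  have "(\<integral>\<^sup>+z\<in>{z. 0 < snd z}. k z * m z / ennreal (snd z) * ball_avg h z \<partial>lborel)
      = (\<integral>\<^sup>+z\<in>{z. 0 < snd z}. (k z * ball_avg h z) * (m z / ennreal (snd z)) \<partial>lborel)"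
    by (intro nn_integral_cong) (simp add: divide_ennreal_def mult_ac)
  also have "\<dots> \<le> ennreal (5 ^ CARD('n)) * A * (\<integral>\<^sup>+x. ntmax 1 (\<lambda>z. k z * ball_avg h z) x \<partial>lborel)"
    using A car by (intro Carleson_embedding) auto
  also have "(\<integral>\<^sup>+x. ntmax 1 (\<lambda>z. k z * ball_avg h z) x \<partial>lborel) \<le> (\<integral>\<^sup>+x. ntmax 1 k x * ntmax 1 (ball_avg h) x \<partial>lborel)"
  proof (rule nn_integral_mono)
    fix x :: "real^'n"
    show "ntmax 1 (\<lambda>z. k z * ball_avg h z) x \<le> ntmax 1 k x * ntmax 1 (ball_avg h) x"
      unfolding ntmax_def[of 1 "\<lambda>z. k z * ball_avg h z"]
      by (intro SUP_least mult_mono ntmax_upper) auto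
  qed
  finally have "(\<integral>\<^sup>+z\<in>{z. 0 < snd z}. k z * m z / ennreal (snd z) * ball_avg h z \<partial>lborel)
     \<le> ennreal (5 ^ CARD('n)) * A * (\<integral>\<^sup>+x. ntmax 1 k x * ntmax 1 (ball_avg h) x \<partial>lborel)"
    by (simp add: mult_left_mono)
  then have "ennreal (unit_ball_vol (real CARD('n))) * (\<integral>\<^sup>+z\<in>{z. 0 < snd z}. k z * m z / ennreal (snd z) * ball_avg h z \<partial>lborel)
     \<le> ennreal (unit_ball_vol (real CARD('n))) * (ennreal (5 ^ CARD('n)) * A * (\<integral>\<^sup>+x. ntmax 1 k x * ntmax 1 (ball_avg h) x \<partial>lborel))"
    by (rule mult_left_mono) simp
  then show ?thesis
    by (subst cone_integral_Fubini) (auto simp: ennreal_mult mult.assoc less_imp_le)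
qed

lemma ntmax_ball_avg_1: "ntmax 1 (ball_avg (\<lambda>_. 1)) (x :: real^'n) = 1"
proof -
  have "ntmax 1 (ball_avg (\<lambda>_. 1)) x = (SUP z\<in>{z. 0 < snd z \<and> dist (fst z) x < 1 * snd z}. 1)"
    unfolding ntmax_def by (intro SUP_cong) (auto simp: ball_avg_1)
  also have "\<dots> = 1"
  proof -
    have "(x, 1) \<in> {z. 0 < snd z \<and> dist (fst z) x < 1 * snd z}" by simp
    then show ?thesis by (intro cSUP_const) blast
  qed
  finally show ?thesis .
qed

definition area :: "((real^'n) \<times> real \<Rightarrow> ennreal) \<Rightarrow> real^'n \<Rightarrow> ennreal" where
  "area F x = (\<integral>\<^sup>+z\<in>cone x. F z / ennreal (snd z ^ (CARD('n) + 1)) \<partial>lborel)"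

lemma borel_measurable_area [measurable]:
  assumes [measurable]: "F \<in> borel_measurable borel"
  shows "area F \<in> borel_measurable borel"
  unfolding area_def by measurable

text \<open>Since \<open>k = k^(1-s) k^s\<close> and the first factor is at most \<open>N k^(1-s)\<close> on the cone, Hoelder's inequality
  reduces the claim to the case \<open>s = 1\<close>, which is the Carleson embedding.\<close>

lemma area_mult_le_small:
  fixes k m :: "(real^'n) \<times> real \<Rightarrow> ennreal"
  assumes [measurable]: "k \<in> borel_measurable borel" "m \<in> borel_measurable borel" and A: "A \<noteq> 0"
    and car: "Carleson_density (\<lambda>z. m z / ennreal (snd z)) A"
    and s: "0 < s" "s \<le> 1"
  shows "(\<integral>\<^sup>+x. epow (area (\<lambda>z. k z * m z) x) s \<partial>lborel)
    \<le> epow (ennreal (unit_ball_vol (real CARD('n)) * 5 ^ CARD('n)) * A) s * (\<integral>\<^sup>+x. epow (ntmax 1 k x) s \<partial>lborel)"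
proof -
  let ?c = "ennreal (unit_ball_vol (real CARD('n)) * 5 ^ CARD('n))"
  have one: "(\<integral>\<^sup>+x. area (\<lambda>z. k z * m z) x \<partial>lborel) \<le> ?c * A * (\<integral>\<^sup>+x. ntmax 1 k x \<partial>lborel)"
    if [measurable]: "k \<in> borel_measurable borel" for k
    using cone_integral_Carleson[of k m "\<lambda>_. 1" A] A car by (simp add: area_def ntmax_ball_avg_1)
  show ?thesis
  proof (cases "s = 1")
    case True
    then show ?thesis using one[of k] by simp
  next
    case False
    with s have s': "0 < 1 - s" "0 < s" "1 - s + s = 1" by auto
    let ?u = "area (\<lambda>z. epow (k z) s * m z)" and ?V = "\<lambda>x. epow (ntmax 1 k x) s"
    have "(\<integral>\<^sup>+x. epow (area (\<lambda>z. k z * m z) x) s \<partial>lborel) \<le> (\<integral>\<^sup>+x. epow (?V x) (1 - s) * epow (?u x) s \<partial>lborel)"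
    proof (rule nn_integral_mono)
      fix x :: "real^'n"
      have "area (\<lambda>z. k z * m z) x \<le> (\<integral>\<^sup>+z. epow (ntmax 1 k x) (1 - s) *
          (epow (k z) s * m z / ennreal (snd z ^ (CARD('n) + 1)) * indicator (cone x) z) \<partial>lborel)"
        unfolding area_def
      proof (rule nn_integral_mono)
        fix z :: "(real^'n) \<times> real"
        show "k z * m z / ennreal (snd z ^ (CARD('n) + 1)) * indicator (cone x) z
          \<le> epow (ntmax 1 k x) (1 - s) * (epow (k z) s * m z / ennreal (snd z ^ (CARD('n) + 1)) * indicator (cone x) z)"
        proof (cases "z \<in> cone x")
          case True
          then have "k z \<le> ntmax 1 k x" by (intro ntmax_upper) auto
          then have "epow (k z) (1 - s) * epow (k z) s \<le> epow (ntmax 1 k x) (1 - s) * epow (k z) s"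
            using s' by (intro mult_right_mono epow_mono) auto
          then have "k z \<le> epow (ntmax 1 k x) (1 - s) * epow (k z) s"
            by (simp flip: epow_add)
          then have "k z * (m z / ennreal (snd z ^ (CARD('n) + 1)))
              \<le> (epow (ntmax 1 k x) (1 - s) * epow (k z) s) * (m z / ennreal (snd z ^ (CARD('n) + 1)))"
            by (rule mult_right_mono) simp
          then show ?thesis using True by (simp add: ennreal_times_divide mult_ac)
        qed simp
      qed
      also have "\<dots> = epow (ntmax 1 k x) (1 - s) * ?u x"
        unfolding area_def by (rule nn_integral_cmult) measurable
      finally have "epow (area (\<lambda>z. k z * m z) x) s \<le> epow (epow (ntmax 1 k x) (1 - s) * ?u x) s"
        using s' by simp
      also have "\<dots> = epow (?V x) (1 - s) * epow (?u x) s"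
        by (simp add: epow_mult epow_epow mult.commute)
      finally show "epow (area (\<lambda>z. k z * m z) x) s \<le> epow (?V x) (1 - s) * epow (?u x) s" .
    qed
    also have "\<dots> \<le> epow (\<integral>\<^sup>+x. ?V x \<partial>lborel) (1 - s) * epow (\<integral>\<^sup>+x. ?u x \<partial>lborel) s"
      using s' by (intro nn_integral_Hoelder) auto
    also have "\<dots> \<le> epow (\<integral>\<^sup>+x. ?V x \<partial>lborel) (1 - s) * epow (?c * A * (\<integral>\<^sup>+x. ?V x \<partial>lborel)) s"
      using one[of "\<lambda>z. epow (k z) s"] s' by (intro mult_left_mono) (auto simp: epow_ntmax)
    also have "\<dots> = epow (?c * A) s * (epow (\<integral>\<^sup>+x. ?V x \<partial>lborel) (1 - s) * epow (\<integral>\<^sup>+x. ?V x \<partial>lborel) s)"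
      by (simp add: epow_mult mult_ac)
    also have "epow (\<integral>\<^sup>+x. ?V x \<partial>lborel) (1 - s) * epow (\<integral>\<^sup>+x. ?V x \<partial>lborel) s = (\<integral>\<^sup>+x. ?V x \<partial>lborel)"
      by (simp flip: epow_add)
    finally show ?thesis .
  qed
qed

text \<open>The area function \<open>u\<close> is tested against its own truncated power \<open>min(u,K)^(s-1)\<close> on a ball; the
  truncation makes the resulting integral finite, so that it can be absorbed.\<close>

lemma area_mult_le_large:
  assumes s: "1 < s"
  obtains C where "0 \<le> C" "\<And>(k :: (real^'n) \<times> real \<Rightarrow> ennreal) m A. k \<in> borel_measurable borel \<Longrightarrow> m \<in> borel_measurable borel \<Longrightarrow> A \<noteq> 0 \<Longrightarrow>
    Carleson_density (\<lambda>z. m z / ennreal (snd z)) A \<Longrightarrow>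
    (\<integral>\<^sup>+x. epow (area (\<lambda>z. k z * m z) x) s \<partial>lborel)
    \<le> epow (ennreal C * A) s * (\<integral>\<^sup>+x. epow (ntmax 1 k x) s \<partial>lborel)"
proof -
  define s' where "s' = s / (s - 1)"
  have s': "1 < s'" "0 < 1 / s" "0 < 1 / s'" "1 / s + 1 / s' = 1" "(s - 1) * s' = s"
    using s by (auto simp: s'_def field_simps)
  obtain M where M: "0 \<le> M" "\<And>h :: real^'n \<Rightarrow> ennreal. h \<in> borel_measurable borel \<Longrightarrow>
    (\<integral>\<^sup>+x. epow (ntmax 1 (ball_avg h) x) s' \<partial>lborel) \<le> ennreal M * (\<integral>\<^sup>+x. epow (h x) s' \<partial>lborel)"
    using maximal_strong_type[OF s'(1)] by metis
  define c where "c = unit_ball_vol (real CARD('n)) * 5 ^ CARD('n)"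
  define C where "C = c * M powr (1 / s')"
  have c: "0 \<le> c" by (simp add: c_def less_imp_le)
  have "(\<integral>\<^sup>+x. epow (area (\<lambda>z. k z * m z) x) s \<partial>lborel) \<le> epow (ennreal C * A) s * (\<integral>\<^sup>+x. epow (ntmax 1 k x) s \<partial>lborel)"
    if [measurable]: "k \<in> borel_measurable borel" "m \<in> borel_measurable borel" and A: "A \<noteq> 0"
      and car: "Carleson_density (\<lambda>z. m z / ennreal (snd z)) A"
    for k m :: "(real^'n) \<times> real \<Rightarrow> ennreal" and A
  proof -
    define u where "u = area (\<lambda>z. k z * m z)"
    have [measurable]: "u \<in> borel_measurable borel" unfolding u_def by measurable
    define uK where "uK K x = min (u x) (of_nat K) * indicator (ball 0 (real K)) x" for K and x :: "real^'n"
    have [measurable]: "uK K \<in> borel_measurable borel" for K unfolding uK_def by measurable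
    let ?V = "(\<integral>\<^sup>+x. epow (ntmax 1 k x) s \<partial>lborel)"
    have bound: "(\<integral>\<^sup>+x. epow (uK K x) s \<partial>lborel) \<le> epow (ennreal C * A) s * ?V" for K
    proof -
      define X where "X = (\<integral>\<^sup>+x. epow (uK K x) s \<partial>lborel)"
      define h where "h x = epow (uK K x) (s - 1)" for x
      have [measurable]: "h \<in> borel_measurable borel" unfolding h_def by measurable
      \<comment> \<open>As \<open>(s - 1) * s' = s\<close>, the dual norm of the test function is
        controlled by \<open>X\<close> itself; after the maximal theorem \<open>X\<close> reappears
        on the right with exponent \<open>1/s'\<close> and is absorbed.\<close>
      have hs: "epow (h x) s' = epow (uK K x) s" for x
        using s' by (simp add: h_def epow_epow)
      have "X \<le> (\<integral>\<^sup>+x. epow (of_nat K) s * indicator (ball (0::real^'n) (real K)) x \<partial>lborel)"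
        unfolding X_def using s by (intro nn_integral_mono) (auto simp: uK_def indicator_def)
      also have "\<dots> = epow (of_nat K) s * emeasure lborel (ball (0::real^'n) (real K))"
        by (simp add: nn_integral_cmult_indicator)
      also have "\<dots> < top" by (simp add: ennreal_mult_less_top emeasure_ball_vec of_nat_less_top)
      finally have Xfin: "X < top" .
      have "X \<le> (\<integral>\<^sup>+x. h x * u x \<partial>lborel)"
        unfolding X_def
      proof (rule nn_integral_mono)
        fix x
        have "epow (uK K x) s = epow (uK K x) (s - 1) * epow (uK K x) 1"
          unfolding epow_add[symmetric] by simp
        also have "\<dots> \<le> h x * u x" unfolding h_def
          by (intro mult_mono) (auto simp: uK_def indicator_def)
        finally show "epow (uK K x) s \<le> h x * u x" .
      qed
      also have "\<dots> \<le> ennreal c * A * (\<integral>\<^sup>+x. ntmax 1 k x * ntmax 1 (ball_avg h) x \<partial>lborel)"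
        unfolding u_def area_def c_def using A car by (intro cone_integral_Carleson) auto
      also have "(\<integral>\<^sup>+x. ntmax 1 k x * ntmax 1 (ball_avg h) x \<partial>lborel)
        = (\<integral>\<^sup>+x. epow (epow (ntmax 1 k x) s) (1 / s) * epow (epow (ntmax 1 (ball_avg h) x) s') (1 / s') \<partial>lborel)"
        using s s' by simp
      also have "\<dots> \<le> epow ?V (1 / s) * epow (\<integral>\<^sup>+x. epow (ntmax 1 (ball_avg h) x) s' \<partial>lborel) (1 / s')"
        using s' by (intro nn_integral_Hoelder) auto
      also have "\<dots> \<le> epow ?V (1 / s) * epow (ennreal M * X) (1 / s')"
        using M(2)[of h] s' by (intro mult_left_mono) (auto simp: hs X_def)
      finally have "X \<le> ennreal c * A * (epow ?V (1 / s) * epow (ennreal M * X) (1 / s'))"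
        by (simp add: mult_left_mono)
      also have "\<dots> = (ennreal C * A * epow ?V (1 / s)) * epow X (1 / s')"
        using c M by (simp add: C_def epow_mult epow_ennreal ennreal_mult mult_ac)
      finally have "X \<le> epow (ennreal C * A * epow ?V (1 / s)) (1 / (1 / s))"
        using Xfin s' by (intro epow_self_bound) auto
      also have "\<dots> = epow (ennreal C * A) s * ?V" using s by (simp add: epow_mult epow_epow)
      finally show ?thesis unfolding X_def .
    qed
    have SUP: "epow (u x) s = (SUP K. epow (uK K x) s)" for x
    proof -
      have "u x = (SUP K. uK K x)"
      proof (rule antisym)
        show "(SUP K. uK K x) \<le> u x" by (intro SUP_least) (auto simp: uK_def indicator_def)
        show "u x \<le> (SUP K. uK K x)" unfolding le_SUP_iff
        proof (intro allI impI)
          fix y assume y: "y < u x"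
          then have "y < top" by (meson less_le_trans top_greatest)
          then obtain K1 where K1: "y < of_nat K1" using ennreal_Ex_less_of_nat by blast
          obtain K2 where K2: "norm x < real K2" using reals_Archimedean2 by blast
          have "of_nat K1 \<le> (of_nat (max K1 K2) :: ennreal)" by simp
          with K1 have "y < of_nat (max K1 K2)" by (rule less_le_trans)
          moreover have "x \<in> ball 0 (real (max K1 K2))" using K2 by simp
          ultimately have "y < uK (max K1 K2) x" using y by (simp add: uK_def)
          then show "\<exists>K\<in>UNIV. y < uK K x" by blast
        qed
      qed
      then show ?thesis using s by (simp add: epow_SUP)
    qed
    have "(\<integral>\<^sup>+x. epow (u x) s \<partial>lborel) = (SUP K. (\<integral>\<^sup>+x. epow (uK K x) s \<partial>lborel))"
      unfolding SUP
    proof (rule nn_integral_monotone_convergence_SUP)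
      have "uK i x \<le> uK j x" if "i \<le> j" for i j x
        using that unfolding uK_def
        by (auto simp: indicator_def min_le_iff_disj)
      then show "incseq (\<lambda>K x. epow (uK K x) s)" using s by (auto simp: incseq_def le_fun_def)
    qed measurable
    also have "\<dots> \<le> epow (ennreal C * A) s * ?V" by (rule SUP_least) (rule bound)
    finally show ?thesis unfolding u_def .
  qed
  then show ?thesis using c by (intro that[of C]) (auto simp: C_def)
qed

lemma area_mult_le:
  assumes s: "0 < s"
  obtains C where "0 \<le> C" "\<And>(k :: (real^'n) \<times> real \<Rightarrow> ennreal) m A. k \<in> borel_measurable borel \<Longrightarrow> m \<in> borel_measurable borel \<Longrightarrow> A \<noteq> 0 \<Longrightarrow>
    Carleson_density (\<lambda>z. m z / ennreal (snd z)) A \<Longrightarrow>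
    (\<integral>\<^sup>+x. epow (area (\<lambda>z. k z * m z) x) s \<partial>lborel)
    \<le> epow (ennreal C * A) s * (\<integral>\<^sup>+x. epow (ntmax 1 k x) s \<partial>lborel)"
proof (cases "s \<le> 1")
  case True
  have "0 \<le> unit_ball_vol (real CARD('n)) * 5 ^ CARD('n)" by (simp add: less_imp_le)
  then show ?thesis by (rule that) (rule area_mult_le_small[OF _ _ _ _ s True])
next
  case False
  then have "1 < s" by simp
  with area_mult_le_large show ?thesis using that by blast
qed

section \<open>Factorization by harmonic means\<close>

lemma hat_measurable [measurable (raw)]:
  fixes c :: "real^'n"
  assumes [measurable]: "f \<in> borel_measurable M"
  shows "Measurable.pred M (\<lambda>w. f w \<in> tent_hat c r)"
  unfolding tent_hat_def ball_subset_ball_iff case_prod_beta' mem_Collect_eq by measurable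

lemma tent_hat_exhausts:
  assumes "0 < snd z"
  obtains N :: nat where "0 < N" "z \<in> tent_hat 0 (real N)"
proof -
  obtain N :: nat where N: "norm (fst z) + snd z < real N" using reals_Archimedean2 by blast
  moreover from this assms have "0 < N" by (metis add_nonneg_pos gr0I norm_ge_zero not_less_iff_gr_or_eq of_nat_0)
  moreover have "z \<in> tent_hat 0 (real N)"
    using N assms by (auto simp: tent_hat_def ball_subset_ball_iff case_prod_beta')
  ultimately show ?thesis using that by blast
qed

text \<open>If \<open>z\<close> lies in the cone of \<open>x\<close> and the ball of
  \<open>z\<close> lies in \<open>B(c,r)\<close>, then \<open>x\<close> lies in
  \<open>B(c,r)\<close>. So after Fubini the cone integral of the truncated \<open>G\<close> lives
  on that ball and is at most \<open>area G\<close>, against the weight \<open>1 / area G\<close>.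
  The conventions \<open>inverse 0 = top\<close> and \<open>0 * top = 0\<close> keep the quotient at
  most one also at zeros and infinities.\<close>

lemma harmonic_average_Carleson:
  fixes G :: "(real^'n) \<times> real \<Rightarrow> ennreal"
  assumes [measurable]: "G \<in> borel_measurable borel"
  shows "(\<integral>\<^sup>+z\<in>tent_hat c r. G z * ball_avg (\<lambda>x. inverse (area G x)) z / ennreal (snd z) \<partial>lborel)
    \<le> ennreal (1 / unit_ball_vol (real CARD('n))) * emeasure lborel (ball c r)"
proof -
  let ?w = "unit_ball_vol (real CARD('n))"
  let ?F = "\<lambda>z. G z * indicator (tent_hat c r) z"
  let ?h = "\<lambda>x. inverse (area G x)"
  have "ennreal ?w * (\<integral>\<^sup>+z\<in>{z. 0 < snd z}. ?F z / ennreal (snd z) * ball_avg ?h z \<partial>lborel)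
      = (\<integral>\<^sup>+x. ?h x * area ?F x \<partial>lborel)"
    unfolding area_def[of ?F] by (rule cone_integral_Fubini[symmetric]) measurable
  also have "\<dots> \<le> (\<integral>\<^sup>+x. indicator (ball c r) x \<partial>lborel)"
  proof (rule nn_integral_mono)
    fix x
    have "area ?F x \<le> area G x * indicator (ball c r) x"
    proof (cases "x \<in> ball c r")
      case True
      then show ?thesis
        by (auto simp: area_def indicator_def intro!: nn_integral_mono)
    next
      case False
      have 0: "?F z / ennreal (snd z ^ (CARD('n) + 1)) * indicator (cone x) z = 0" for z
      proof (cases "z \<in> cone x \<and> z \<in> tent_hat c r")
        case True
        then have "x \<in> ball (fst z) (snd z)" "ball (fst z) (snd z) \<subseteq> ball c r"
          by (auto simp: tent_hat_def)
        with False show ?thesis by blast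
      qed auto
      have "area ?F x = (\<integral>\<^sup>+(z :: (real^'n) \<times> real). 0 \<partial>lborel)"
        unfolding area_def by (rule nn_integral_cong) (rule 0)
      then show ?thesis by simp
    qed
    then have "?h x * area ?F x \<le> ?h x * (area G x * indicator (ball c r) x)"
      by (rule mult_left_mono) simp
    also have "\<dots> = (area G x / area G x) * indicator (ball c r) x"
      by (simp add: divide_ennreal_def mult_ac)
    also have "\<dots> \<le> 1 * indicator (ball c r) x"
    proof (rule mult_right_mono)
      show "area G x / area G x \<le> 1"
        by (cases "area G x = 0 \<or> area G x = top") (auto simp: less_top)
    qed simp
    finally show "?h x * area ?F x \<le> indicator (ball c r) x" by simp
  qed
  finally have le: "ennreal ?w * (\<integral>\<^sup>+z\<in>{z. 0 < snd z}. ?F z / ennreal (snd z) * ball_avg ?h z \<partial>lborel)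
    \<le> emeasure lborel (ball c r)" by simp
  have "(\<integral>\<^sup>+z\<in>tent_hat c r. G z * ball_avg ?h z / ennreal (snd z) \<partial>lborel)
    = (\<integral>\<^sup>+z\<in>{z. 0 < snd z}. ?F z / ennreal (snd z) * ball_avg ?h z \<partial>lborel)"
    by (intro nn_integral_cong) (auto simp: divide_ennreal_def mult_ac indicator_def tent_hat_def)
  also have "\<dots> = ennreal (1 / ?w) * (ennreal ?w * (\<integral>\<^sup>+z\<in>{z. 0 < snd z}. ?F z / ennreal (snd z) * ball_avg ?h z \<partial>lborel))"
    by (simp add: less_imp_le flip: mult.assoc ennreal_mult)
  also have "\<dots> \<le> ennreal (1 / ?w) * emeasure lborel (ball c r)"
    using le by (rule mult_left_mono) simp
  finally show ?thesis .
qed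

text \<open>Where \<open>2 u \<le> l\<close>, the function \<open>l/u\<close> is at least two, while
  its mean over a ball at which the harmonic mean exceeds \<open>l\<close> is at most one. Hence
  twice the indicator of \<open>2 u > l\<close> has mean at least one on such a ball, and
  \<open>ball_covering\<close> applies with it as density. The constant collects the covering
  factor, this two, and \<open>2^s\<close> from \<open>2 u\<close>.\<close>

lemma harmonic_average_ntmax:
  fixes u :: "real^'n \<Rightarrow> ennreal"
  assumes [measurable]: "u \<in> borel_measurable borel" and a: "1 \<le> a" and s: "0 < s"
  shows "(\<integral>\<^sup>+x. epow (ntmax a (\<lambda>z. inverse (ball_avg (\<lambda>x. inverse (u x)) z)) x) s \<partial>lborel)
    \<le> ennreal ((5 * a) ^ CARD('n) * 2 * 2 powr s) * (\<integral>\<^sup>+x. epow (u x) s \<partial>lborel)"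
proof -
  let ?K = "\<lambda>z. inverse (ball_avg (\<lambda>x. inverse (u x)) z)"
  have "(\<integral>\<^sup>+x. epow (ntmax a ?K x) s * 1 \<partial>lborel)
      \<le> ennreal ((5 * a) ^ CARD('n) * 2) * (\<integral>\<^sup>+x. epow (2 * u x) s \<partial>lborel)"
  proof (rule layer_comparison)
    fix t :: real assume t: "0 < t"
    define l where "l = t powr (1 / s)"
    have l: "0 < l" using t by (simp add: l_def)
    let ?E = "{x. ennreal l < 2 * u x}"
    let ?\<rho> = "\<lambda>x. 2 * indicator ?E x :: ennreal"
    have sw: "(ennreal t < epow v s) = (ennreal l < v)" for v
      using t s by (simp add: epow_less_swap epow_ennreal l_def)
    have "(\<integral>\<^sup>+x\<in>{x. ennreal t < epow (ntmax a ?K x) s}. 1 \<partial>lborel) = emeasure lborel {x. ennreal l < ntmax a ?K x}"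
      by (simp add: sw)
    also have "{x. ennreal l < ntmax a ?K x} = (\<Union>z\<in>{z. 0 < snd z \<and> ennreal l < ?K z}. ball (fst z) (a * snd z))"
      by (rule ntmax_superlevel)
    also have "emeasure lborel \<dots> \<le> ennreal ((5 * a) ^ CARD('n)) * (\<integral>\<^sup>+x. ?\<rho> x \<partial>lborel)"
    proof (rule ball_covering)
      fix y :: "real^'n" and r assume "(y, r) \<in> {z. 0 < snd z \<and> ennreal l < ?K z}"
      then have r: "0 < r" and K: "ennreal l < inverse (ball_avg (\<lambda>x. inverse (u x)) (y, r))" by auto
      let ?B = "emeasure lborel (ball y r)" and ?I = "\<integral>\<^sup>+x\<in>ball y r. inverse (u x) \<partial>lborel"
      have avg: "ball_avg (\<lambda>x. inverse (u x)) (y, r) = ?I / ?B" by (simp add: ball_avg_def)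
      have I: "?I = (?I / ?B) * ?B"
        using r emeasure_ball_bounds[of r y] by (simp add: ennreal_divide_times)
      have "ennreal l * (?I / ?B) \<le> inverse (?I / ?B) * (?I / ?B)"
        using K by (intro mult_right_mono) (auto simp: avg)
      also have "\<dots> \<le> 1"
        by (cases "?I / ?B = 0 \<or> ?I / ?B = top")
          (auto simp: less_top mult.commute[of "inverse _"] simp flip: divide_ennreal_def)
      finally have "ennreal l * (?I / ?B) * ?B \<le> 1 * ?B" by (rule mult_right_mono) simp
      then have lI: "ennreal l * ?I \<le> ?B" by (subst I) (simp add: mult.assoc)
      have "2 * ?B = (\<integral>\<^sup>+x. 2 * indicator (ball y r) x \<partial>lborel)"
        by (simp add: nn_integral_cmult)
      also have "\<dots> \<le> (\<integral>\<^sup>+x. ?\<rho> x * indicator (ball y r) x + ennreal l * (inverse (u x) * indicator (ball y r) x) \<partial>lborel)"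
      proof (rule nn_integral_mono)
        fix x
        have "2 \<le> ennreal l * inverse (u x)" if "\<not> ennreal l < 2 * u x"
        proof (cases "u x = 0 \<or> u x = top")
          case True
          then show ?thesis using l that by (auto simp: ennreal_mult_top)
        next
          case False
          have "2 * u x * inverse (u x) \<le> ennreal l * inverse (u x)"
            using that by (intro mult_right_mono) auto
          moreover have "u x * inverse (u x) = 1"
            using False by (simp add: less_top flip: divide_ennreal_def)
          ultimately show ?thesis by (simp add: mult.assoc)
        qed
        then show "2 * indicator (ball y r) x \<le> ?\<rho> x * indicator (ball y r) x + ennreal l * (inverse (u x) * indicator (ball y r) x)"
          by (auto simp: indicator_def)
      qed
      also have "\<dots> = (\<integral>\<^sup>+x\<in>ball y r. ?\<rho> x \<partial>lborel) + ennreal l * ?I"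
        by (simp add: nn_integral_add nn_integral_cmult)
      also have "\<dots> \<le> (\<integral>\<^sup>+x\<in>ball y r. ?\<rho> x \<partial>lborel) + ?B" using lI by (rule add_left_mono)
      finally have "?B + ?B \<le> ?B + (\<integral>\<^sup>+x\<in>ball y r. ?\<rho> x \<partial>lborel)"
        unfolding mult_2 by (subst (2) add.commute)
      then show "0 < r \<and> ?B \<le> (\<integral>\<^sup>+x\<in>ball y r. ?\<rho> x \<partial>lborel)"
        using r emeasure_ball_bounds[of r y] by (simp add: ennreal_add_left_cancel_le)
    qed (use a in auto)
    also have "(\<integral>\<^sup>+x. ?\<rho> x \<partial>lborel) = 2 * emeasure lborel {x. ennreal t < epow (2 * u x) s}"
      by (simp add: nn_integral_cmult sw)
    finally show "(\<integral>\<^sup>+x\<in>{x. ennreal t < epow (ntmax a ?K x) s}. 1 \<partial>lborel)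
       \<le> ennreal ((5 * a) ^ CARD('n) * 2) * emeasure lborel {x. ennreal t < epow (2 * u x) s}"
      using a by (simp add: ennreal_mult mult.assoc)
  qed measurable
  also have "(\<integral>\<^sup>+x. epow (2 * u x) s \<partial>lborel) = ennreal (2 powr s) * (\<integral>\<^sup>+x. epow (u x) s \<partial>lborel)"
    using epow_ennreal[of 2 s] by (simp add: epow_mult nn_integral_cmult)
  finally show ?thesis using a by (simp add: ennreal_mult mult.assoc)
qed

text \<open>Equality may fail on a null set, where the average of \<open>1/u\<close> is infinite and the product is
  \<open>0 * top = 0\<close>.\<close>

lemma area_factorization:
  fixes G :: "(real^'n) \<times> real \<Rightarrow> ennreal"
  assumes [measurable]: "G \<in> borel_measurable borel" and s: "0 < s"
    and fin: "(\<integral>\<^sup>+x. epow (area G x) s \<partial>lborel) < top"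
  shows "AE z in lborel. 0 < snd z \<longrightarrow>
    G z \<le> inverse (ball_avg (\<lambda>x. inverse (area G x)) z) * (G z * ball_avg (\<lambda>x. inverse (area G x)) z)"
proof -
  let ?J = "ball_avg (\<lambda>x. inverse (area G x))"
  \<comment> \<open>Tents over balls of integer radius exhaust the half-space, and on each of them
    the Carleson bound is finite; hence the integrand is finite almost everywhere.\<close>
  have "AE z in lborel. G z * ?J z / ennreal (snd z) * indicator (tent_hat 0 (real N)) z \<noteq> top" for N
  proof (rule nn_integral_noteq_infinite[unfolded infinity_ennreal_def])
    have "(\<integral>\<^sup>+z\<in>tent_hat 0 (real N). G z * ?J z / ennreal (snd z) \<partial>lborel)
      \<le> ennreal (1 / unit_ball_vol (real CARD('n))) * emeasure lborel (ball (0::real^'n) (real N))"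
      by (rule harmonic_average_Carleson) simp
    also have "\<dots> < top" by (simp add: ennreal_mult_less_top emeasure_ball_vec)
    finally show "(\<integral>\<^sup>+z\<in>tent_hat 0 (real N). G z * ?J z / ennreal (snd z) \<partial>lborel) \<noteq> top" by simp
  qed measurable
  then have "AE z in lborel. \<forall>N. G z * ?J z / ennreal (snd z) * indicator (tent_hat 0 (real N)) z \<noteq> top"
    by (simp add: AE_all_countable)
  then show ?thesis
  proof eventually_elim
    case (elim z)
    show ?case
    proof (intro impI)
      assume t: "0 < snd z"
      obtain N :: nat where "z \<in> tent_hat 0 (real N)" using tent_hat_exhausts[OF t] by blast
      with elim[rule_format, of N] have GJ: "G z * ?J z / ennreal (snd z) \<noteq> top" by simp
      have "?J z \<noteq> top" if "G z \<noteq> 0"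
        using that t GJ by (auto simp: ennreal_divide_eq_top_iff ennreal_mult_top)
      \<comment> \<open>A zero average of \<open>1/u\<close> would force \<open>u = top\<close>
        almost everywhere on a ball, which the finite integral of \<open>u^s\<close>
        excludes.\<close>
      moreover have "?J z \<noteq> 0"
      proof
        assume "?J z = 0"
        then have "(\<integral>\<^sup>+x\<in>ball (fst z) (snd z). inverse (area G x) \<partial>lborel) = 0"
          using emeasure_ball_bounds[OF t, of "fst z"] by (auto simp: ball_avg_def)
        then have 1: "AE x in lborel. inverse (area G x) * indicator (ball (fst z) (snd z)) x = 0"
          by (subst (asm) nn_integral_0_iff_AE) auto
        have "AE x in lborel. epow (area G x) s \<noteq> top"
          by (rule nn_integral_noteq_infinite[unfolded infinity_ennreal_def]) (use fin in auto)
        with 1 have "AE x in lborel. x \<notin> ball (fst z) (snd z)"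
          by eventually_elim (auto simp: indicator_def split: if_splits)
        then have "emeasure lborel (ball (fst z) (snd z)) = 0"
          by (subst (asm) AE_iff_measurable[OF _ refl]) (auto simp: ball_def)
        with emeasure_ball_bounds(1)[OF t, of "fst z"] show False by simp
      qed
      ultimately show "G z \<le> inverse (?J z) * (G z * ?J z)"
      proof (cases "G z = 0")
        case False
        assume "G z \<noteq> 0 \<Longrightarrow> ?J z \<noteq> top" "?J z \<noteq> 0"
        with False have "?J z * inverse (?J z) = 1" by (simp add: less_top flip: divide_ennreal_def)
        then have "inverse (?J z) * (G z * ?J z) = G z" by (simp add: mult_ac)
        then show ?thesis by simp
      qed simp
    qed
  qed
qed

section \<open>Tent norms as products\<close>

text \<open>The norm of \<open>T^p_\<infinity>\<close> with aperture \<open>a\<close>. For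
  \<open>p = top\<close> it is a true supremum, since the factor is used as a pointwise
  bound.\<close>

definition nt_norm :: "ennreal \<Rightarrow> real \<Rightarrow> ((real^'n) \<times> real \<Rightarrow> ennreal) \<Rightarrow> ennreal" where
  "nt_norm p a k = (if p = top then SUP z\<in>{z. 0 < snd z}. k z
     else epow (\<integral>\<^sup>+x. epow (ntmax a k x) (enn2real p) \<partial>lborel) (1 / enn2real p))"

text \<open>The statement that the norm in \<open>T^\<infinity>_q\<close> is at most
  \<open>A\<close>, kept as an inequality so that products and powers of densities act directly on
  the constant. For \<open>q = top\<close> it is a pointwise bound, stronger than an essential one,
  because nontangential suprema see every point.\<close>

definition Carleson_le :: "ennreal \<Rightarrow> ((real^'n) \<times> real \<Rightarrow> ennreal) \<Rightarrow> ennreal \<Rightarrow> bool" where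
  "Carleson_le q m A \<longleftrightarrow> (if q = top then \<forall>z. 0 < snd z \<longrightarrow> m z \<le> A
     else \<forall>c r. 0 < r \<longrightarrow> (\<integral>\<^sup>+z\<in>tent_hat c r. epow (m z) (enn2real q) / ennreal (snd z) \<partial>lborel)
        \<le> epow A (enn2real q) * emeasure lborel (ball c r))"

lemma enn2real_pos: "0 < p \<Longrightarrow> p \<noteq> top \<Longrightarrow> 0 < enn2real p"
  by (simp add: enn2real_positive_iff less_top)

lemma tent_norm_area:
  fixes g :: "(real^'n) \<times> real \<Rightarrow> ennreal"
  assumes "p \<noteq> top" "q \<noteq> top"
  shows "tent_norm p q g = epow (\<integral>\<^sup>+x. epow (area (\<lambda>z. epow (g z) (enn2real q)) x) (enn2real p / enn2real q) \<partial>lborel) (1 / enn2real p)"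
proof -
  have lt: "p < \<infinity>" "q < \<infinity>" using assms by (auto simp: less_top)
  show ?thesis using lt
    by (simp add: tent_norm_def nn_integral_completion area_def epow_epow)
qed

lemma tent_norm_nontangential:
  fixes g :: "(real^'n) \<times> real \<Rightarrow> ennreal"
  assumes "p \<noteq> top"
  shows "tent_norm p top g = nt_norm p 1 g"
proof -
  have lt: "p < \<infinity>" using assms by (auto simp: less_top)
  then show ?thesis using assms
    by (simp add: tent_norm_def nn_integral_completion nt_norm_def ntmax_1)
qed

text \<open>The supremum over points and balls containing them collapses to one over balls, since
  every ball contains its centre.\<close>

lemma tent_norm_Carleson:
  fixes m :: "(real^'n) \<times> real \<Rightarrow> ennreal"
  assumes "0 < q" "q \<noteq> top"
  shows "tent_norm top q m \<le> A \<longleftrightarrow> Carleson_le q m A"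
proof -
  have lt: "q < \<infinity>" using assms by (auto simp: less_top)
  let ?q = "enn2real q"
  have q: "0 < ?q" using assms by (rule enn2real_pos)
  let ?I = "\<lambda>c r. \<integral>\<^sup>+z\<in>tent_hat c r. epow (m z) ?q / ennreal (snd z) \<partial>lborel"
  have eq: "epow (1 / emeasure lborel (ball c r)) (1 / ?q) * epow (?I c r) (1 / ?q) \<le> A
      \<longleftrightarrow> ?I c r \<le> epow A ?q * emeasure lborel (ball c r)" if r: "0 < r" for c :: "real^'n" and r
  proof -
    let ?B = "emeasure lborel (ball c r)"
    note B = emeasure_ball_bounds[OF r, of c]
    have "epow (1 / ?B) (1 / ?q) * epow (?I c r) (1 / ?q) \<le> A \<longleftrightarrow> 1 / ?B * ?I c r \<le> epow A ?q"
      using q by (simp only: epow_le_swap' flip: epow_mult)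
    also have "\<dots> \<longleftrightarrow> ?B * (1 / ?B * ?I c r) \<le> ?B * epow A ?q"
      using B by (intro ennreal_mult_le_mult_iff[symmetric]) auto
    also have "?B * (1 / ?B * ?I c r) = ?I c r"
    proof -
      have "?B * (1 / ?B) = 1" using B by (simp add: ennreal_times_divide)
      then show ?thesis by (simp flip: mult.assoc)
    qed
    finally show ?thesis by (simp add: mult.commute)
  qed
  have "tent_norm top q m \<le> A \<longleftrightarrow> (\<forall>x c r. 0 < r \<longrightarrow> x \<in> ball c r \<longrightarrow>
      epow (1 / emeasure lborel (ball c r)) (1 / ?q) * epow (?I c r) (1 / ?q) \<le> A)"
    using lt by (auto simp: tent_norm_def nn_integral_completion SUP_le_iff)
  also have "\<dots> \<longleftrightarrow> (\<forall>c r. 0 < r \<longrightarrow> epow (1 / emeasure lborel (ball c r)) (1 / ?q) * epow (?I c r) (1 / ?q) \<le> A)"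
    by (meson centre_in_ball)
  also have "\<dots> \<longleftrightarrow> Carleson_le q m A"
    using assms by (simp add: Carleson_le_def eq)
  finally show ?thesis .
qed

lemma tent_norm_ess_sup:
  fixes g :: "(real^'n) \<times> real \<Rightarrow> ennreal"
  assumes "AE z in lborel. 0 < snd z \<longrightarrow> g z \<le> A"
  shows "tent_norm top top g \<le> A"
  using assms by (auto simp: tent_norm_def ess_sup_on_def AE_completion_iff intro!: Inf_lower AE_completion)

text \<open>The infimum is that of a sequence of admissible constants, and countably many null sets
  may be united.\<close>

lemma ess_sup_on_attained:
  fixes g :: "'a::euclidean_space \<Rightarrow> ennreal"
  shows "AE z in lebesgue. z \<in> S \<longrightarrow> g z \<le> ess_sup_on S g"
proof -
  let ?X = "{c. AE z in lebesgue. z \<in> S \<longrightarrow> g z \<le> c}"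
  have "?X \<noteq> {}" by (auto intro!: exI[of _ top])
  then obtain c :: "nat \<Rightarrow> ennreal" where c: "range c \<subseteq> ?X" "Inf ?X = (INF i. c i)"
    using ennreal_Inf_countable_INF[of ?X] by auto
  then have "AE z in lebesgue. \<forall>i. z \<in> S \<longrightarrow> g z \<le> c i"
    by (subst AE_all_countable) auto
  then show ?thesis unfolding ess_sup_on_def c(2)
    by eventually_elim (auto intro: INF_greatest)
qed

lemma tent_norm_ess_sup_attained:
  fixes g :: "(real^'n) \<times> real \<Rightarrow> ennreal"
  shows "AE z in lebesgue. 0 < snd z \<longrightarrow> g z \<le> tent_norm top top g"
  using ess_sup_on_attained[of "{z. 0 < snd z}" g] by (simp add: tent_norm_def)

lemma tent_norm_mono:
  fixes f g :: "(real^'n) \<times> real \<Rightarrow> ennreal"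
  assumes p: "0 < p" and q: "0 < q" and ae: "AE z in lborel. 0 < snd z \<longrightarrow> f z \<le> g z"
    and pt: "q = top \<Longrightarrow> (\<And>z. 0 < snd z \<Longrightarrow> f z \<le> g z)"
  shows "tent_norm p q f \<le> tent_norm p q g"
proof -
  consider "p \<noteq> top" "q \<noteq> top" | "p = top" "q \<noteq> top" | "p \<noteq> top" "q = top" | "p = top" "q = top" by blast
  then show ?thesis
  proof cases
    case 1
    note pos = enn2real_pos[OF p 1(1)] enn2real_pos[OF q 1(2)]
    have "area (\<lambda>z. epow (f z) (enn2real q)) x \<le> area (\<lambda>z. epow (g z) (enn2real q)) x" for x
      unfolding area_def
      by (rule nn_integral_mono_AE, use ae in eventually_elim)
         (auto simp: indicator_def intro!: divide_right_mono_ennreal epow_mono)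
    then show ?thesis using pos
      by (simp add: tent_norm_area 1) (intro nn_integral_mono epow_mono, auto)
  next
    case 2
    note pos = enn2real_pos[OF q 2(2)]
    have "Carleson_le q g (tent_norm top q g)"
      using tent_norm_Carleson[OF q 2(2), of g "tent_norm top q g"] by simp
    moreover have "(\<integral>\<^sup>+z\<in>tent_hat c r. epow (f z) (enn2real q) / ennreal (snd z) \<partial>lborel)
        \<le> (\<integral>\<^sup>+z\<in>tent_hat c r. epow (g z) (enn2real q) / ennreal (snd z) \<partial>lborel)" for c r
      by (rule nn_integral_mono_AE, use ae in eventually_elim)
         (auto simp: indicator_def tent_hat_def intro!: divide_right_mono_ennreal epow_mono)
    ultimately have "Carleson_le q f (tent_norm top q g)"
      unfolding Carleson_le_def using 2 by (simp, meson order_trans)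
    then show ?thesis using tent_norm_Carleson[OF q 2(2), of f] 2 by simp
  next
    case 3
    note pos = enn2real_pos[OF p 3(1)]
    have "ntmax 1 f x \<le> ntmax 1 g x" for x
      unfolding ntmax_def by (rule SUP_subset_mono) (use pt 3 in auto)
    then show ?thesis using pos
      by (simp add: tent_norm_nontangential 3 nt_norm_def) (intro nn_integral_mono epow_mono, auto)
  next
    case 4
    have "AE z in lborel. 0 < snd z \<longrightarrow> g z \<le> tent_norm top top g"
      using tent_norm_ess_sup_attained[of g] unfolding AE_completion_iff .
    then have "AE z in lborel. 0 < snd z \<longrightarrow> f z \<le> tent_norm top top g"
    proof eventually_elim
      case (elim z)
      then show ?case using pt[OF 4(2), of z] by (auto intro: order_trans)
    qed
    then show ?thesis using 4 by (simp add: tent_norm_ess_sup)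
  qed
qed

section \<open>Products of nontangential functions and Carleson densities\<close>

lemma ntmax_mult_const_le:
  "(\<And>z. 0 < snd z \<Longrightarrow> m z \<le> A) \<Longrightarrow> ntmax a (\<lambda>z. k z * m z) x \<le> ntmax a k x * A"
  unfolding ntmax_def[of a "\<lambda>z. k z * m z"]
  by (intro SUP_least mult_mono ntmax_upper) auto

lemma Carleson_le_bounded_mult:
  fixes k m :: "(real^'n) \<times> real \<Rightarrow> ennreal"
  assumes q: "0 < q" and [measurable]: "m \<in> borel_measurable borel"
    and k: "\<And>z. 0 < snd z \<Longrightarrow> k z \<le> S" and m: "Carleson_le q m A"
  shows "Carleson_le q (\<lambda>z. k z * m z) (S * A)"
proof (cases "q = top")
  case True
  have "k z * m z \<le> S * A" if "0 < snd z" for z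
    using that k[of z] m True by (cases z, intro mult_mono) (auto simp: Carleson_le_def)
  then show ?thesis using True by (simp add: Carleson_le_def)
next
  case False
  let ?q = "enn2real q"
  note pos = enn2real_pos[OF q False]
  have "(\<integral>\<^sup>+z\<in>tent_hat c r. epow (k z * m z) ?q / ennreal (snd z) \<partial>lborel)
      \<le> epow (S * A) ?q * emeasure lborel (ball c r)" if r: "0 < r" for c :: "real^'n" and r
  proof -
    have "(\<integral>\<^sup>+z\<in>tent_hat c r. epow (k z * m z) ?q / ennreal (snd z) \<partial>lborel)
      \<le> (\<integral>\<^sup>+z. epow S ?q * (epow (m z) ?q / ennreal (snd z) * indicator (tent_hat c r) z) \<partial>lborel)"
    proof (rule nn_integral_mono)
      fix z :: "(real^'n) \<times> real"
      have "epow (k z) ?q * (epow (m z) ?q / ennreal (snd z)) \<le> epow S ?q * (epow (m z) ?q / ennreal (snd z))" if "z \<in> tent_hat c r"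
        using that k[of z] pos by (intro mult_right_mono) (auto simp: tent_hat_def)
      then show "epow (k z * m z) ?q / ennreal (snd z) * indicator (tent_hat c r) z
        \<le> epow S ?q * (epow (m z) ?q / ennreal (snd z) * indicator (tent_hat c r) z)"
        by (auto simp: indicator_def epow_mult ennreal_times_divide)
    qed
    also have "\<dots> = epow S ?q * (\<integral>\<^sup>+z\<in>tent_hat c r. epow (m z) ?q / ennreal (snd z) \<partial>lborel)"
      by (rule nn_integral_cmult) measurable
    also have "\<dots> \<le> epow S ?q * (epow A ?q * emeasure lborel (ball c r))"
      using m False r by (intro mult_left_mono) (auto simp: Carleson_le_def)
    finally show ?thesis by (simp add: epow_mult mult.assoc)
  qed
  then show ?thesis using False by (simp add: Carleson_le_def)
qed

lemma nt_norm_bounded_mult: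
  assumes p: "0 < p" and m: "\<And>z. 0 < snd z \<Longrightarrow> m z \<le> A"
  shows "nt_norm p a (\<lambda>z. k z * m z) \<le> nt_norm p a k * A"
proof (cases "p = top")
  case True
  then show ?thesis using m by (auto simp: nt_norm_def intro!: SUP_least mult_mono SUP_upper)
next
  case False
  let ?p = "enn2real p"
  note pos = enn2real_pos[OF p False]
  have "nt_norm p a (\<lambda>z. k z * m z) \<le> epow (\<integral>\<^sup>+x. epow (ntmax a k x) ?p * epow A ?p \<partial>lborel) (1 / ?p)"
    using False pos m by (auto simp: nt_norm_def simp flip: epow_mult intro!: nn_integral_mono ntmax_mult_const_le)
  also have "\<dots> = nt_norm p a k * A"
    using False pos by (simp add: nn_integral_multc epow_mult nt_norm_def)
  finally show ?thesis .
qed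

text \<open>For finite exponents this is the area estimate applied to \<open>q\<close>-th powers
  with exponent \<open>p/q\<close>. If an exponent is infinite, one factor is bounded pointwise and
  comes out of the norm. \<open>A \<noteq> 0\<close> stems from open sets of infinite measure in
  \<open>tent_over_open\<close>.\<close>

lemma tent_norm_mult_le:
  assumes p: "0 < p" and q: "0 < q"
  obtains C where "0 \<le> C" "\<And>k m A. k \<in> borel_measurable borel \<Longrightarrow> (m :: (real^'n) \<times> real \<Rightarrow> ennreal) \<in> borel_measurable borel \<Longrightarrow>
    A \<noteq> 0 \<Longrightarrow> Carleson_le q m A \<Longrightarrow> tent_norm p q (\<lambda>z. k z * m z) \<le> ennreal C * (nt_norm p 1 k * A)"
proof -
  consider "p \<noteq> top" "q \<noteq> top" | "p = top" "q \<noteq> top" | "p \<noteq> top" "q = top" | "p = top" "q = top" by blast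
  then show ?thesis
  proof cases
    case 1
    note pos = enn2real_pos[OF p 1(1)] enn2real_pos[OF q 1(2)]
    let ?p = "enn2real p" and ?q = "enn2real q"
    have "0 < ?p / ?q" using pos by simp
    then obtain C where C: "0 \<le> C" and *: "\<And>(k :: (real^'n) \<times> real \<Rightarrow> ennreal) m A. k \<in> borel_measurable borel \<Longrightarrow> m \<in> borel_measurable borel \<Longrightarrow>
        A \<noteq> 0 \<Longrightarrow> Carleson_density (\<lambda>z. m z / ennreal (snd z)) A \<Longrightarrow> (\<integral>\<^sup>+x. epow (area (\<lambda>z. k z * m z) x) (?p / ?q) \<partial>lborel)
        \<le> epow (ennreal C * A) (?p / ?q) * (\<integral>\<^sup>+x. epow (ntmax 1 k x) (?p / ?q) \<partial>lborel)"
      using area_mult_le by blast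
    show ?thesis
    proof (rule that[of "C powr (1 / ?q)"])
      fix k m :: "(real^'n) \<times> real \<Rightarrow> ennreal" and A :: ennreal
      assume [measurable]: "k \<in> borel_measurable borel" "m \<in> borel_measurable borel"
        and A: "A \<noteq> 0" "Carleson_le q m A"
      have "tent_norm p q (\<lambda>z. k z * m z)
        = epow (\<integral>\<^sup>+x. epow (area (\<lambda>z. epow (k z) ?q * epow (m z) ?q) x) (?p / ?q) \<partial>lborel) (1 / ?p)"
        by (simp add: tent_norm_area 1 epow_mult)
      also have "\<dots> \<le> epow (epow (ennreal C * epow A ?q) (?p / ?q) * (\<integral>\<^sup>+x. epow (ntmax 1 (\<lambda>z. epow (k z) ?q) x) (?p / ?q) \<partial>lborel)) (1 / ?p)"
        using A pos 1 by (intro epow_mono *) (auto simp: Carleson_le_def Carleson_density_def)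
      also have "\<dots> = ennreal (C powr (1 / ?q)) * (nt_norm p 1 k * A)"
        using pos C 1 by (simp add: epow_mult epow_epow epow_ntmax nt_norm_def epow_ennreal powr_powr mult_ac)
      finally show "tent_norm p q (\<lambda>z. k z * m z) \<le> ennreal (C powr (1 / ?q)) * (nt_norm p 1 k * A)" .
    qed simp
  next
    case 2
    show ?thesis
    proof (rule that[of 1])
      fix k m :: "(real^'n) \<times> real \<Rightarrow> ennreal" and A :: ennreal
      assume m: "m \<in> borel_measurable borel" "Carleson_le q m A"
      have "k z \<le> nt_norm p 1 k" if "0 < snd z" for z
        using 2 that by (auto simp: nt_norm_def intro: SUP_upper)
      with q m have "Carleson_le q (\<lambda>z. k z * m z) (nt_norm p 1 k * A)" by (intro Carleson_le_bounded_mult)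
      then show "tent_norm p q (\<lambda>z. k z * m z) \<le> ennreal 1 * (nt_norm p 1 k * A)"
        using tent_norm_Carleson[OF q 2(2), of "\<lambda>z. k z * m z"] 2 by simp
    qed simp
  next
    case 3
    show ?thesis
    proof (rule that[of 1])
      fix k m :: "(real^'n) \<times> real \<Rightarrow> ennreal" and A :: ennreal
      assume "Carleson_le q m A"
      then have "m z \<le> A" if "0 < snd z" for z using 3 that by (cases z) (auto simp: Carleson_le_def)
      then show "tent_norm p q (\<lambda>z. k z * m z) \<le> ennreal 1 * (nt_norm p 1 k * A)"
        using nt_norm_bounded_mult[OF p, of m A 1 k] 3 by (simp add: tent_norm_nontangential)
    qed simp
  next
    case 4
    show ?thesis
    proof (rule that[of 1])
      fix k m :: "(real^'n) \<times> real \<Rightarrow> ennreal" and A :: ennreal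
      assume A: "Carleson_le q m A"
      have "k z * m z \<le> nt_norm p 1 k * A" if "0 < snd z" for z
        using A 4 that by (cases z, intro mult_mono) (auto simp: Carleson_le_def nt_norm_def intro: SUP_upper)
      then show "tent_norm p q (\<lambda>z. k z * m z) \<le> ennreal 1 * (nt_norm p 1 k * A)"
        using 4 by (auto intro!: tent_norm_ess_sup)
    qed simp
  qed
qed

text \<open>The case distinction behind the Hoelder type estimates below. In the last case the
  ratios \<open>p0/p1\<close> and \<open>p0/p2\<close> themselves are the exponents for
  \<open>nn_integral_Hoelder\<close>, also when \<open>p0 < 1\<close>; in the other cases at least
  one factor is merely bounded.\<close>

lemma conjugate_exponents_cases:
  fixes p0 p1 p2 :: ennreal
  assumes "inverse p0 = inverse p1 + inverse p2" "0 < p0" "0 < p1" "0 < p2"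
  obtains "p0 = top" "p1 = top" "p2 = top"
  | "p1 = top" "p2 = p0" "p0 \<noteq> top"
  | "p2 = top" "p1 = p0" "p0 \<noteq> top"
  | "p0 \<noteq> top" "p1 \<noteq> top" "p2 \<noteq> top" "enn2real p0 / enn2real p1 + enn2real p0 / enn2real p2 = 1"
proof -
  have inj: "inverse x = inverse y \<Longrightarrow> x = y" for x y :: ennreal
    by (metis divide_ennreal_def mult_1 one_divide_one_divide_ennreal)
  consider "p1 = top" "p2 = top" | "p1 = top" "p2 \<noteq> top" | "p1 \<noteq> top" "p2 = top" | "p1 \<noteq> top" "p2 \<noteq> top" by blast
  then show ?thesis
  proof cases
    case 1
    then show ?thesis using assms by (intro that(1)) auto
  next
    case 2
    then show ?thesis using assms inj[of p0 p2] by (intro that(2)) auto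
  next
    case 3
    then show ?thesis using assms inj[of p0 p1] by (intro that(3)) auto
  next
    case 4
    then obtain x1 x2 where x: "p1 = ennreal x1" "0 < x1" "p2 = ennreal x2" "0 < x2"
      using assms by (cases p1; cases p2) auto
    have "p0 \<noteq> top"
    proof
      assume "p0 = top"
      then have "inverse p1 + inverse p2 = 0" using assms(1) by simp
      then show False using 4 by simp
    qed
    then obtain x0 where x0: "p0 = ennreal x0" "0 < x0" using assms by (cases p0) auto
    have "inverse x0 = inverse x1 + inverse x2"
      using assms(1) x x0 by (simp add: inverse_ennreal flip: ennreal_plus)
    then have "x0 * (inverse x1 + inverse x2) = 1" using x0 by (simp flip: \<open>inverse x0 = _\<close>)
    then have "enn2real p0 / enn2real p1 + enn2real p0 / enn2real p2 = 1"
      using x x0 by (simp add: divide_inverse distrib_left)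
    then show ?thesis using 4 \<open>p0 \<noteq> top\<close> that(4) by blast
  qed
qed

lemma Carleson_le_mono:
  assumes "Carleson_le q m A" "A \<le> B"
  shows "Carleson_le q m B"
  using assms unfolding Carleson_le_def
  by (auto split: if_splits intro: order_trans mult_right_mono epow_mono)
     (meson order_trans mult_right_mono epow_mono enn2real_nonneg zero_le)

text \<open>If \<open>k z > l\<close>, the whole ball of \<open>z\<close> lies in the set
  \<open>E\<close> where the maximal function of aperture one exceeds \<open>l\<close>. So
  \<open>ball_covering\<close> with the indicator of \<open>E\<close> as density controls the
  dilated balls, whose union is the superlevel set for aperture \<open>a\<close>.\<close>

lemma nt_norm_aperture:
  fixes k :: "(real^'n) \<times> real \<Rightarrow> ennreal"
  assumes a: "1 \<le> a" and p: "0 < p" "p \<noteq> top"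
  shows "nt_norm p a k \<le> ennreal (((5 * a) ^ CARD('n)) powr (1 / enn2real p)) * nt_norm p 1 k"
proof -
  let ?p = "enn2real p"
  note pos = enn2real_pos[OF p]
  have "(\<integral>\<^sup>+x. epow (ntmax a k x) ?p * 1 \<partial>lborel) \<le> ennreal ((5 * a) ^ CARD('n)) * (\<integral>\<^sup>+x. epow (ntmax 1 k x) ?p \<partial>lborel)"
  proof (rule layer_comparison)
    fix t :: real assume t: "0 < t"
    define l where "l = t powr (1 / ?p)"
    have sw: "(ennreal t < epow v ?p) = (ennreal l < v)" for v
      using t pos by (simp add: epow_less_swap epow_ennreal l_def)
    let ?E = "{x. ennreal l < ntmax 1 k x}"
    have "(\<integral>\<^sup>+x\<in>{x. ennreal t < epow (ntmax a k x) ?p}. 1 \<partial>lborel) = emeasure lborel {x. ennreal l < ntmax a k x}"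
      by (simp add: sw)
    also have "{x. ennreal l < ntmax a k x} = (\<Union>z\<in>{z. 0 < snd z \<and> ennreal l < k z}. ball (fst z) (a * snd z))"
      by (rule ntmax_superlevel)
    also have "emeasure lborel \<dots> \<le> ennreal ((5 * a) ^ CARD('n)) * (\<integral>\<^sup>+x. indicator ?E x \<partial>lborel)"
    proof (rule ball_covering)
      fix y :: "real^'n" and r assume yr: "(y, r) \<in> {z. 0 < snd z \<and> ennreal l < k z}"
      have "ball y r \<subseteq> ?E" using yr unfolding ntmax_superlevel by force
      then have "indicator (ball y r) x \<le> indicator ?E x * (indicator (ball y r) x :: ennreal)" for x
        by (auto simp: indicator_def)
      then have "(\<integral>\<^sup>+x. indicator (ball y r) x \<partial>lborel) \<le> (\<integral>\<^sup>+x\<in>ball y r. indicator ?E x \<partial>lborel)"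
        by (rule nn_integral_mono)
      then show "0 < r \<and> emeasure lborel (ball y r) \<le> (\<integral>\<^sup>+x\<in>ball y r. indicator ?E x \<partial>lborel)"
        using yr by simp
    qed (use a in auto)
    finally show "(\<integral>\<^sup>+x\<in>{x. ennreal t < epow (ntmax a k x) ?p}. 1 \<partial>lborel)
       \<le> ennreal ((5 * a) ^ CARD('n)) * emeasure lborel {x. ennreal t < epow (ntmax 1 k x) ?p}"
      by (simp add: sw)
  qed measurable
  then have "nt_norm p a k \<le> epow (ennreal ((5 * a) ^ CARD('n)) * (\<integral>\<^sup>+x. epow (ntmax 1 k x) ?p \<partial>lborel)) (1 / ?p)"
    using p pos by (simp add: nt_norm_def)
  also have "\<dots> = ennreal (((5 * a) ^ CARD('n)) powr (1 / ?p)) * nt_norm p 1 k"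
    using p a by (simp add: nt_norm_def epow_mult epow_ennreal)
  finally show ?thesis .
qed

lemma nt_norm_mult:
  fixes k1 k2 :: "(real^'n) \<times> real \<Rightarrow> ennreal"
  assumes inv: "inverse p0 = inverse p1 + inverse p2" and pos: "0 < p0" "0 < p1" "0 < p2"
  shows "nt_norm p0 a (\<lambda>z. k1 z * k2 z) \<le> nt_norm p1 a k1 * nt_norm p2 a k2"
  using inv pos
proof (cases rule: conjugate_exponents_cases)
  case 1
  then show ?thesis by (auto simp: nt_norm_def intro!: SUP_least mult_mono SUP_upper)
next
  case 2
  have "k1 z \<le> nt_norm p1 a k1" if "0 < snd z" for z
    using 2 that by (auto simp: nt_norm_def intro: SUP_upper)
  then show ?thesis using nt_norm_bounded_mult[OF pos(1), of k1 _ a k2] 2 by (simp add: mult.commute)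
next
  case 3
  have "k2 z \<le> nt_norm p2 a k2" if "0 < snd z" for z
    using 3 that by (auto simp: nt_norm_def intro: SUP_upper)
  then show ?thesis using nt_norm_bounded_mult[OF pos(1), of k2 _ a k1] 3 by simp
next
  case 4
  note p = enn2real_pos[OF pos(1) 4(1)] enn2real_pos[OF pos(2) 4(2)] enn2real_pos[OF pos(3) 4(3)]
  let ?p0 = "enn2real p0" and ?p1 = "enn2real p1" and ?p2 = "enn2real p2"
  have "(\<integral>\<^sup>+x. epow (ntmax a (\<lambda>z. k1 z * k2 z) x) ?p0 \<partial>lborel)
    \<le> (\<integral>\<^sup>+x. epow (epow (ntmax a k1 x) ?p1) (?p0 / ?p1) * epow (epow (ntmax a k2 x) ?p2) (?p0 / ?p2) \<partial>lborel)"
  proof (rule nn_integral_mono)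
    fix x
    have "ntmax a (\<lambda>z. k1 z * k2 z) x \<le> ntmax a k1 x * ntmax a k2 x"
      unfolding ntmax_def[of a "\<lambda>z. k1 z * k2 z"] by (intro SUP_least mult_mono ntmax_upper) auto
    then show "epow (ntmax a (\<lambda>z. k1 z * k2 z) x) ?p0
      \<le> epow (epow (ntmax a k1 x) ?p1) (?p0 / ?p1) * epow (epow (ntmax a k2 x) ?p2) (?p0 / ?p2)"
      using p by (simp add: epow_epow flip: epow_mult)
  qed
  also have "\<dots> \<le> epow (\<integral>\<^sup>+x. epow (ntmax a k1 x) ?p1 \<partial>lborel) (?p0 / ?p1) * epow (\<integral>\<^sup>+x. epow (ntmax a k2 x) ?p2 \<partial>lborel) (?p0 / ?p2)"
    using p 4 by (intro nn_integral_Hoelder) auto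
  finally have "nt_norm p0 a (\<lambda>z. k1 z * k2 z) \<le> epow (epow (\<integral>\<^sup>+x. epow (ntmax a k1 x) ?p1 \<partial>lborel) (?p0 / ?p1) * epow (\<integral>\<^sup>+x. epow (ntmax a k2 x) ?p2 \<partial>lborel) (?p0 / ?p2)) (1 / ?p0)"
    using 4 p by (simp add: nt_norm_def)
  also have "\<dots> = nt_norm p1 a k1 * nt_norm p2 a k2"
    using 4 p by (simp add: nt_norm_def epow_mult epow_epow)
  finally show ?thesis .
qed

lemma Carleson_le_mult:
  fixes m1 m2 :: "(real^'n) \<times> real \<Rightarrow> ennreal"
  assumes inv: "inverse q0 = inverse q1 + inverse q2" and pos: "0 < q0" "0 < q1" "0 < q2"
    and [measurable]: "m1 \<in> borel_measurable borel" "m2 \<in> borel_measurable borel"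
    and m: "Carleson_le q1 m1 A1" "Carleson_le q2 m2 A2"
  shows "Carleson_le q0 (\<lambda>z. m1 z * m2 z) (A1 * A2)"
  using inv pos
proof (cases rule: conjugate_exponents_cases)
  case 1
  then show ?thesis using m by (auto simp: Carleson_le_def intro!: mult_mono)
next
  case 2
  have "m1 z \<le> A1" if "0 < snd z" for z using m(1) 2 that by (cases z) (simp add: Carleson_le_def)
  then show ?thesis using 2 pos m(2) by (intro Carleson_le_bounded_mult) auto
next
  case 3
  have "m2 z \<le> A2" if "0 < snd z" for z using m(2) 3 that by (cases z) (simp add: Carleson_le_def)
  then have "Carleson_le q0 (\<lambda>z. m2 z * m1 z) (A2 * A1)" using 3 pos m(1) by (intro Carleson_le_bounded_mult) auto
  then show ?thesis by (simp add: mult.commute)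
next
  case 4
  note p = enn2real_pos[OF pos(1) 4(1)] enn2real_pos[OF pos(2) 4(2)] enn2real_pos[OF pos(3) 4(3)]
  let ?q0 = "enn2real q0" and ?q1 = "enn2real q1" and ?q2 = "enn2real q2"
  show ?thesis unfolding Carleson_le_def using 4
  proof (simp, intro allI impI)
    fix c :: "real^'n" and r :: real assume r: "0 < r"
    let ?B = "emeasure lborel (ball c r)"
    \<comment> \<open>The density of the measure on the tent is split into powers whose exponents
      sum to one, so that each factor in Hoelder's inequality carries the full measure.\<close>
    let ?d = "\<lambda>z. inverse (ennreal (snd z)) * indicator (tent_hat c r) z"
    have split1: "x = epow x (?q0 / ?q1) * epow x (?q0 / ?q2)" for x
      unfolding epow_add[symmetric] 4 by simp
    have "(\<integral>\<^sup>+z\<in>tent_hat c r. epow (m1 z * m2 z) ?q0 / ennreal (snd z) \<partial>lborel)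
      = (\<integral>\<^sup>+z. epow (epow (m1 z) ?q1 * ?d z) (?q0 / ?q1) * epow (epow (m2 z) ?q2 * ?d z) (?q0 / ?q2) \<partial>lborel)"
    proof (rule nn_integral_cong)
      fix z :: "(real^'n) \<times> real"
      have "epow (m1 z * m2 z) ?q0 / ennreal (snd z) * indicator (tent_hat c r) z
          = epow (m1 z) ?q0 * epow (m2 z) ?q0 * ?d z"
        by (simp add: epow_mult divide_ennreal_def mult_ac)
      also have "\<dots> = epow (m1 z) ?q0 * epow (m2 z) ?q0 * (epow (?d z) (?q0 / ?q1) * epow (?d z) (?q0 / ?q2))"
        using split1[of "?d z"] by simp
      also have "\<dots> = epow (epow (m1 z) ?q1 * ?d z) (?q0 / ?q1) * epow (epow (m2 z) ?q2 * ?d z) (?q0 / ?q2)"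
        using p by (simp add: epow_mult epow_epow mult_ac)
      finally show "epow (m1 z * m2 z) ?q0 / ennreal (snd z) * indicator (tent_hat c r) z
        = epow (epow (m1 z) ?q1 * ?d z) (?q0 / ?q1) * epow (epow (m2 z) ?q2 * ?d z) (?q0 / ?q2)" .
    qed
    also have "\<dots> \<le> epow (\<integral>\<^sup>+z. epow (m1 z) ?q1 * ?d z \<partial>lborel) (?q0 / ?q1) * epow (\<integral>\<^sup>+z. epow (m2 z) ?q2 * ?d z \<partial>lborel) (?q0 / ?q2)"
      using p 4 by (intro nn_integral_Hoelder) auto
    also have "\<dots> \<le> epow (epow A1 ?q1 * ?B) (?q0 / ?q1) * epow (epow A2 ?q2 * ?B) (?q0 / ?q2)"
      using m 4 r by (intro mult_mono epow_mono) (auto simp: Carleson_le_def divide_ennreal_def mult_ac)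
    also have "\<dots> = epow A1 ?q0 * epow A2 ?q0 * (epow ?B (?q0 / ?q1) * epow ?B (?q0 / ?q2))"
      using p by (simp add: epow_mult epow_epow mult_ac)
    also have "\<dots> = epow (A1 * A2) ?q0 * ?B" using split1[of ?B] by (simp add: epow_mult)
    finally show "(\<integral>\<^sup>+z\<in>tent_hat c r. epow (m1 z * m2 z) ?q0 / ennreal (snd z) \<partial>lborel) \<le> epow (A1 * A2) ?q0 * ?B" .
  qed
qed

text \<open>For \<open>q = top\<close> and \<open>p < top\<close> the tent norm is a genuine supremum and sees null sets, hence the last conjunct.\<close>

definition tent_factors :: "ennreal \<Rightarrow> ennreal \<Rightarrow> real \<Rightarrow> real \<Rightarrow> real \<Rightarrow> ((real^'n) \<times> real \<Rightarrow> ennreal) \<Rightarrow> bool" where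
  "tent_factors p q a C N w \<longleftrightarrow> (\<exists>k m. k \<in> borel_measurable borel \<and> m \<in> borel_measurable borel \<and>
     nt_norm p a k \<le> ennreal (C * N) \<and> Carleson_le q m (ennreal C) \<and>
     (AE z in lborel. 0 < snd z \<longrightarrow> w z \<le> k z * m z) \<and> (q = top \<longrightarrow> (\<forall>z. 0 < snd z \<longrightarrow> w z \<le> k z * m z)))"

text \<open>Harmonic means are called for only if both exponents are finite: for
  \<open>p = top\<close> the factor \<open>k\<close> is the constant \<open>N\<close>, and for
  \<open>q = top\<close> the factor \<open>m\<close> is a constant one. All of the size of
  \<open>w\<close> is put into \<open>k\<close>, so the Carleson constant of \<open>m\<close> does
  not depend on \<open>w\<close>. Wide apertures are included because \<open>k\<close> is later
  enlarged to suprema over Whitney boxes.\<close>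

lemma tent_norm_factorization:
  assumes p: "0 < p" and q: "0 < q" and a: "1 \<le> a"
  obtains C :: real where "1 \<le> C" "\<And>(w :: (real^'n) \<times> real \<Rightarrow> ennreal) N. w \<in> borel_measurable borel \<Longrightarrow> 0 < N \<Longrightarrow>
    tent_norm p q w \<le> ennreal N \<Longrightarrow> (p = top \<longrightarrow> q = top \<longrightarrow> (\<forall>z. 0 < snd z \<longrightarrow> w z \<le> ennreal N)) \<Longrightarrow>
    tent_factors p q a C N w"
proof -
  consider "p \<noteq> top" "q \<noteq> top" | "p = top" "q \<noteq> top" | "p \<noteq> top" "q = top" | "p = top" "q = top" by blast
  then show ?thesis
  proof cases
    case 1
    let ?p = "enn2real p" and ?q = "enn2real q" and ?w = "unit_ball_vol (real CARD('n))"
    note pos = enn2real_pos[OF p 1(1)] enn2real_pos[OF q 1(2)]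
    define s where "s = ?p / ?q"
    have s: "0 < s" using pos by (simp add: s_def)
    define C1 where "C1 = (5 * a) ^ CARD('n) * 2 * 2 powr s"
    have C1: "0 \<le> C1" using a by (simp add: C1_def)
    \<comment> \<open>One constant serves both the maximal norm of \<open>k\<close> and the Carleson
      bound of \<open>m\<close>; the roots undo the powers \<open>p\<close> and
      \<open>q\<close>.\<close>
    define C where "C = max 1 (max (C1 powr (1 / ?p)) ((1 / ?w) powr (1 / ?q)))"
    show ?thesis
    proof (rule that[of C])
      fix w :: "(real^'n) \<times> real \<Rightarrow> ennreal" and N :: real
      assume [measurable]: "w \<in> borel_measurable borel" and N: "0 < N" "tent_norm p q w \<le> ennreal N"
      define G where "G z = epow (w z) ?q" for z
      have [measurable]: "G \<in> borel_measurable borel" unfolding G_def by measurable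
      define J where "J = ball_avg (\<lambda>x. inverse (area G x))"
      have [measurable]: "J \<in> borel_measurable borel" unfolding J_def by measurable
      define k m where "k z = epow (inverse (J z)) (1 / ?q)" and "m z = epow (G z * J z) (1 / ?q)" for z
      have [measurable]: "k \<in> borel_measurable borel" "m \<in> borel_measurable borel"
        unfolding k_def m_def by measurable
      have tn: "epow (\<integral>\<^sup>+x. epow (area G x) s \<partial>lborel) (1 / ?p) \<le> ennreal N"
        using N 1 by (simp add: tent_norm_area G_def[abs_def] s_def)
      have fin: "(\<integral>\<^sup>+x. epow (area G x) s \<partial>lborel) < top"
        using le_less_trans[OF tn ennreal_less_top] by simp
      have "nt_norm p a k = epow (\<integral>\<^sup>+x. epow (ntmax a (\<lambda>z. inverse (J z)) x) s \<partial>lborel) (1 / ?p)"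
        using 1 pos unfolding nt_norm_def k_def[abs_def] s_def by (simp add: epow_ntmax epow_epow)
      also have "\<dots> \<le> epow (ennreal C1 * (\<integral>\<^sup>+x. epow (area G x) s \<partial>lborel)) (1 / ?p)"
        unfolding J_def C1_def using a s pos by (intro epow_mono harmonic_average_ntmax) auto
      also have "\<dots> = ennreal (C1 powr (1 / ?p)) * epow (\<integral>\<^sup>+x. epow (area G x) s \<partial>lborel) (1 / ?p)"
        using C1 by (simp add: epow_mult epow_ennreal)
      also have "\<dots> \<le> ennreal C * ennreal N"
        by (intro mult_mono tn) (auto simp: C_def intro!: ennreal_leI)
      also have "\<dots> = ennreal (C * N)" using N by (simp add: C_def ennreal_mult)
      finally have k: "nt_norm p a k \<le> ennreal (C * N)" .
      have "Carleson_le q m (ennreal ((1 / ?w) powr (1 / ?q)))"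
        unfolding Carleson_le_def using 1
      proof (simp, intro allI impI)
        fix c :: "real^'n" and r :: real
        have "epow (m z) ?q = G z * J z" for z unfolding m_def using pos by simp
        moreover have "epow (ennreal ((1 / ?w) powr (1 / ?q))) ?q = ennreal (1 / ?w)"
          using pos by (simp add: epow_ennreal powr_powr less_imp_le)
        ultimately show "(\<integral>\<^sup>+z\<in>tent_hat c r. epow (m z) ?q / ennreal (snd z) \<partial>lborel)
          \<le> epow (ennreal ((1 / ?w) powr (1 / ?q))) ?q * emeasure lborel (ball c r)"
          using harmonic_average_Carleson[of G c r] by (simp add: J_def)
      qed
      then have m: "Carleson_le q m (ennreal C)"
        by (rule Carleson_le_mono) (auto simp: C_def intro!: ennreal_leI)
      have "AE z in lborel. 0 < snd z \<longrightarrow> G z \<le> inverse (J z) * (G z * J z)"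
        unfolding J_def using s fin by (intro area_factorization) auto
      then have "AE z in lborel. 0 < snd z \<longrightarrow> w z \<le> k z * m z"
      proof eventually_elim
        case (elim z)
        show ?case
        proof
          assume "0 < snd z"
          then have "G z \<le> inverse (J z) * (G z * J z)" using elim by simp
          then have "epow (G z) (1 / ?q) \<le> epow (inverse (J z) * (G z * J z)) (1 / ?q)"
            using pos by (intro epow_mono) auto
          then show "w z \<le> k z * m z" using pos by (simp add: k_def m_def epow_mult G_def)
        qed
      qed
      with k m 1 show "tent_factors p q a C N w"
        unfolding tent_factors_def by (intro exI[of _ k] exI[of _ m]) auto
    qed (simp add: C_def)
  next
    case 2
    let ?q = "enn2real q"
    note pos = enn2real_pos[OF q 2(2)]
    show ?thesis
    proof (rule that[of 1])
      fix w :: "(real^'n) \<times> real \<Rightarrow> ennreal" and N :: real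
      assume [measurable]: "w \<in> borel_measurable borel" and N: "0 < N" "tent_norm p q w \<le> ennreal N"
      have w: "Carleson_le q w (ennreal N)" using N 2 tent_norm_Carleson[OF q 2(2), of w] by simp
      have "Carleson_le q (\<lambda>z. ennreal (1 / N) * w z) (ennreal (1 / N) * ennreal N)"
        using w q 2 by (intro Carleson_le_mult[of q top q]) (auto simp: Carleson_le_def)
      then have m: "Carleson_le q (\<lambda>z. ennreal (1 / N) * w z) (ennreal 1)"
        using N by (simp flip: ennreal_mult)
      have k: "nt_norm p a (\<lambda>z :: (real^'n) \<times> real. ennreal N) \<le> ennreal (1 * N)"
        using 2 by (auto simp: nt_norm_def intro: SUP_least)
      have "ennreal N * (ennreal (1 / N) * w z) = w z" for z
        using N by (simp flip: mult.assoc ennreal_mult)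
      then show "tent_factors p q a 1 N w"
        unfolding tent_factors_def using k m by (intro exI[of _ "\<lambda>z. ennreal N"] exI[of _ "\<lambda>z. ennreal (1 / N) * w z"]) auto
    qed simp
  next
    case 3
    let ?p = "enn2real p"
    define C where "C = max 1 (((5 * a) ^ CARD('n)) powr (1 / ?p))"
    show ?thesis
    proof (rule that[of C])
      fix w :: "(real^'n) \<times> real \<Rightarrow> ennreal" and N :: real
      assume [measurable]: "w \<in> borel_measurable borel" and N: "0 < N" "tent_norm p q w \<le> ennreal N"
      have "nt_norm p a w \<le> ennreal (((5 * a) ^ CARD('n)) powr (1 / ?p)) * nt_norm p 1 w"
        using a p 3 by (intro nt_norm_aperture) auto
      also have "\<dots> \<le> ennreal C * ennreal N"
        using N 3 by (intro mult_mono) (auto simp: C_def tent_norm_nontangential intro!: ennreal_leI)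
      also have "\<dots> = ennreal (C * N)" using N by (simp add: C_def ennreal_mult)
      finally have k: "nt_norm p a w \<le> ennreal (C * N)" .
      have "Carleson_le q (\<lambda>z :: (real^'n) \<times> real. 1) (ennreal C)"
        using 3 by (simp add: Carleson_le_def C_def)
      then show "tent_factors p q a C N w"
        unfolding tent_factors_def using k by (intro exI[of _ w] exI[of _ "\<lambda>z. 1"]) auto
    qed (simp add: C_def)
  next
    case 4
    show ?thesis
    proof (rule that[of 1])
      fix w :: "(real^'n) \<times> real \<Rightarrow> ennreal" and N :: real
      assume N: "0 < N" "p = top \<longrightarrow> q = top \<longrightarrow> (\<forall>z. 0 < snd z \<longrightarrow> w z \<le> ennreal N)"
      have "nt_norm p a (\<lambda>z :: (real^'n) \<times> real. ennreal N) \<le> ennreal (1 * N)"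
        using 4 by (auto simp: nt_norm_def intro: SUP_least)
      moreover have "Carleson_le q (\<lambda>z :: (real^'n) \<times> real. 1) (ennreal 1)"
        using 4 by (simp add: Carleson_le_def)
      moreover have "w z \<le> ennreal N" if "0 < snd z" for z using N 4 that by (cases z) auto
      ultimately show "tent_factors p q a 1 N w"
        unfolding tent_factors_def by (intro exI[of _ "\<lambda>z. ennreal N"] exI[of _ "\<lambda>z. 1"]) auto
    qed simp
  qed
qed

section \<open>Whitney averages\<close>

definition avg_on :: "ennreal \<Rightarrow> ('a::euclidean_space) set \<Rightarrow> ('a \<Rightarrow> ennreal) \<Rightarrow> ennreal" where
  "avg_on r S F = (if r = top then ess_sup_on S F
     else epow ((\<integral>\<^sup>+w\<in>S. epow (F w) (enn2real r) \<partial>lborel) / emeasure lborel S) (1 / enn2real r))"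

definition wav :: "real \<Rightarrow> real \<Rightarrow> ennreal \<Rightarrow> ((real^'n) \<times> real \<Rightarrow> ennreal) \<Rightarrow> (real^'n) \<times> real \<Rightarrow> ennreal" where
  "wav a b r F z = avg_on r (whitney a b (fst z) (snd z)) F"

lemma ennreal_mult_divide_cancel:
  fixes a b :: ennreal
  assumes "a \<noteq> 0" "a \<noteq> top"
  shows "a * (b / a) = b"
proof -
  have "a * (b / a) = b * (a / a)" unfolding divide_ennreal_def by (rule mult.left_commute)
  also have "a / a = 1" using assms by (simp add: less_top)
  finally show ?thesis by simp
qed

lemma mem_whitney [simp]: "w \<in> whitney a b y t \<longleftrightarrow> dist (fst w) y < a * t \<and> t / b < snd w \<and> snd w < b * t"
  by (cases w) (simp add: whitney_def)

lemma pred_whitney [measurable]: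
  assumes [measurable]: "f \<in> borel_measurable M" "g \<in> borel_measurable M" "h \<in> borel_measurable M"
  shows "Measurable.pred M (\<lambda>x. f x \<in> whitney a b (g x) (h x))"
  by simp

lemma whitney_pos:
  assumes w: "w \<in> whitney a b y t" and "0 < a" "0 < b"
  shows "0 < t" "0 < snd w"
proof -
  have "dist (fst w) y < a * t" using w by simp
  then have "0 < a * t" by (rule le_less_trans[OF zero_le_dist])
  then show t: "0 < t" using assms by (simp add: zero_less_mult_iff)
  then have "0 < t / b" using assms by simp
  then show "0 < snd w" using w by simp
qed

lemma emeasure_whitney:
  assumes "0 < a" "1 < b" "0 < t"
  shows "emeasure lborel (whitney a b (y::real^'n) t) = ennreal (unit_ball_vol (real CARD('n)) * a ^ CARD('n) * (b - 1 / b) * t ^ (CARD('n) + 1))"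
proof -
  have "whitney a b y t = ball y (a * t) \<times> {t / b<..<b * t}"
    by (auto simp: whitney_def dist_commute)
  then have "emeasure lborel (whitney a b y t) = emeasure lborel (ball y (a * t)) * emeasure lborel {t / b<..<b * t}"
    by (simp add: lborel.emeasure_pair_measure_Times flip: lborel_prod)
  also have "emeasure lborel {t / b<..<b * t} = ennreal ((b - 1 / b) * t)"
  proof -
    have "t / b \<le> b * t"
    proof -
      have "t / b \<le> t" "t \<le> b * t" using assms by (auto simp: field_simps)
      then show ?thesis by simp
    qed
    then show ?thesis by (simp add: algebra_simps)
  qed
  also have "emeasure lborel (ball y (a * t)) = ennreal (unit_ball_vol (real CARD('n)) * (a * t) ^ CARD('n))"
    using assms by (intro emeasure_ball_vec) simp
  finally have "emeasure lborel (whitney a b y t)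
    = ennreal (unit_ball_vol (real CARD('n)) * (a * t) ^ CARD('n)) * ennreal ((b - 1 / b) * t)" .
  also have "\<dots> = ennreal (unit_ball_vol (real CARD('n)) * (a * t) ^ CARD('n) * ((b - 1 / b) * t))"
    using assms by (intro ennreal_mult'[symmetric]) (simp add: less_imp_le)
  finally show ?thesis by (simp add: power_mult_distrib mult_ac)
qed

lemma emeasure_whitney_bounds:
  assumes "0 < a" "1 < b" "0 < t"
  shows "emeasure lborel (whitney a b (y::real^'n) t) \<noteq> 0" "emeasure lborel (whitney a b y t) \<noteq> top"
proof -
  have "1 / b < 1" using assms by simp
  then have "1 / b < b" using assms by linarith
  then have "0 < unit_ball_vol (real CARD('n)) * a ^ CARD('n) * (b - 1 / b) * t ^ (CARD('n) + 1)"
    using assms by simp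
  then show "emeasure lborel (whitney a b (y::real^'n) t) \<noteq> 0" "emeasure lborel (whitney a b y t) \<noteq> top"
    using assms \<open>1 / b < b\<close> by (simp_all add: emeasure_whitney ennreal_eq_0_iff not_le)
qed

lemma ess_sup_on_le_iff:
  "ess_sup_on S g \<le> c \<longleftrightarrow> (AE z in lborel. z \<in> S \<longrightarrow> g z \<le> c)" for g :: "'a::euclidean_space \<Rightarrow> ennreal"
proof
  assume "ess_sup_on S g \<le> c"
  with ess_sup_on_attained[of S g] show "AE z in lborel. z \<in> S \<longrightarrow> g z \<le> c"
    unfolding AE_completion_iff by (auto elim!: eventually_mono)
next
  assume "AE z in lborel. z \<in> S \<longrightarrow> g z \<le> c"
  then show "ess_sup_on S g \<le> c" unfolding ess_sup_on_def by (intro Inf_lower) (simp add: AE_completion)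
qed

text \<open>Rewrites a bound on an essential supremum as the vanishing of an integral; measurability
  and semicontinuity under moving boxes then follow as for finite exponents.\<close>

lemma ess_sup_on_le_iff_integral:
  fixes g :: "'a::euclidean_space \<Rightarrow> ennreal"
  assumes [measurable]: "g \<in> borel_measurable borel" "S \<in> sets borel"
  shows "ess_sup_on S g \<le> c \<longleftrightarrow> (\<integral>\<^sup>+z\<in>S. indicator {z. c < g z} z \<partial>lborel) = 0"
  unfolding ess_sup_on_le_iff
  by (subst nn_integral_0_iff_AE) (auto simp: indicator_def not_less intro!: AE_cong)

lemma whitney_sets [measurable]: "whitney a b (y::real^'n) t \<in> sets borel"
proof -
  have "{w \<in> space borel. w \<in> whitney a b y t} \<in> sets borel" by measurable
  then show ?thesis by (simp del: mem_whitney)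
qed

lemma avg_on_mono_AE:
  assumes "AE w in lborel. w \<in> S \<longrightarrow> F w \<le> G w"
  shows "avg_on r S F \<le> avg_on r S G"
proof (cases "r = top")
  case True
  have "AE w in lborel. w \<in> S \<longrightarrow> G w \<le> ess_sup_on S G"
    using ess_sup_on_le_iff[of S G "ess_sup_on S G"] by simp
  with assms have "AE w in lborel. w \<in> S \<longrightarrow> F w \<le> ess_sup_on S G"
    by eventually_elim (auto intro: order_trans)
  then show ?thesis using True by (simp add: avg_on_def ess_sup_on_le_iff)
next
  case False
  have "(\<integral>\<^sup>+w\<in>S. epow (F w) (enn2real r) \<partial>lborel) \<le> (\<integral>\<^sup>+w\<in>S. epow (G w) (enn2real r) \<partial>lborel)"
    by (rule nn_integral_mono_AE, use assms in eventually_elim) (auto simp: indicator_def intro: epow_mono)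
  then show ?thesis using False by (simp add: avg_on_def epow_mono divide_right_mono_ennreal)
qed

lemma avg_on_le_iff:
  assumes r: "0 < r" "r \<noteq> top" and S: "emeasure lborel S \<noteq> 0" "emeasure lborel S \<noteq> top"
  shows "avg_on r S F \<le> c \<longleftrightarrow> (\<integral>\<^sup>+w\<in>S. epow (F w) (enn2real r) \<partial>lborel) \<le> epow c (enn2real r) * emeasure lborel S"
proof -
  let ?I = "\<integral>\<^sup>+w\<in>S. epow (F w) (enn2real r) \<partial>lborel" and ?e = "emeasure lborel S"
  have "avg_on r S F \<le> c \<longleftrightarrow> ?I / ?e \<le> epow c (enn2real r)"
    using r enn2real_pos[OF r] by (simp add: avg_on_def epow_le_swap')
  also have "\<dots> \<longleftrightarrow> ?e * (?I / ?e) \<le> ?e * epow c (enn2real r)"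
    using S by (intro ennreal_mult_le_mult_iff[symmetric]) auto
  also have "?e * (?I / ?e) = ?I" using S by (rule ennreal_mult_divide_cancel)
  finally show ?thesis by (simp add: mult.commute)
qed

lemma avg_on_cmult_le:
  assumes r: "0 < r" and [measurable]: "F \<in> borel_measurable borel" "S \<in> sets borel"
  shows "avg_on r S (\<lambda>w. M * F w) \<le> M * avg_on r S F"
proof (cases "r = top")
  case True
  have "AE w in lborel. w \<in> S \<longrightarrow> F w \<le> ess_sup_on S F"
    using ess_sup_on_le_iff[of S F "ess_sup_on S F"] by simp
  then have "AE w in lborel. w \<in> S \<longrightarrow> M * F w \<le> M * ess_sup_on S F"
    by eventually_elim (auto intro: mult_left_mono)
  then show ?thesis using True by (simp add: avg_on_def ess_sup_on_le_iff)
next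
  case False
  let ?r = "enn2real r"
  note pos = enn2real_pos[OF r False]
  have "(\<integral>\<^sup>+w\<in>S. epow (M * F w) ?r \<partial>lborel) = (\<integral>\<^sup>+w. epow M ?r * (epow (F w) ?r * indicator S w) \<partial>lborel)"
    by (simp add: epow_mult mult.assoc)
  also have "\<dots> = epow M ?r * (\<integral>\<^sup>+w\<in>S. epow (F w) ?r \<partial>lborel)"
    by (rule nn_integral_cmult) measurable
  finally show ?thesis using False pos by (simp add: avg_on_def epow_mult flip: ennreal_times_divide)
qed

lemma borel_measurable_wav [measurable]:
  fixes F :: "(real^'n) \<times> real \<Rightarrow> ennreal"
  assumes [measurable]: "F \<in> borel_measurable borel"
  shows "wav a b r F \<in> borel_measurable borel"
proof (cases "r = top")
  case True
  show ?thesis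
  proof (rule borel_measurableI_le)
    fix c
    have "{z. wav a b r F z \<le> c} = {z. (\<integral>\<^sup>+w\<in>whitney a b (fst z) (snd z). indicator {w. c < F w} w \<partial>lborel) = 0}"
      using True by (simp add: wav_def avg_on_def ess_sup_on_le_iff_integral)
    also have "\<dots> \<in> sets borel" by measurable
    finally show "{z \<in> space borel. wav a b r F z \<le> c} \<in> sets borel" by simp
  qed
next
  case False
  have "emeasure lborel (whitney a b (fst z) (snd z)) = (\<integral>\<^sup>+w. indicator (whitney a b (fst z) (snd z)) w \<partial>lborel)" for z :: "(real^'n) \<times> real"
    by simp
  moreover have "(\<lambda>z. epow ((\<integral>\<^sup>+w\<in>whitney a b (fst z) (snd z). epow (F w) (enn2real r) \<partial>lborel)
     / (\<integral>\<^sup>+w. indicator (whitney a b (fst z) (snd z)) w \<partial>lborel)) (1 / enn2real r)) \<in> borel_measurable borel"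
    by measurable
  ultimately show ?thesis using False unfolding wav_def[abs_def] by (simp add: avg_on_def)
qed

text \<open>Boxes are open and vary continuously, so a point of the limiting box belongs to all late
  boxes. The indicators are thus lower semicontinuous in the base point, and Fatou's lemma passes
  this to the integrals.\<close>

lemma whitney_integral_lsc:
  fixes H :: "(real^'n) \<times> real \<Rightarrow> ennreal"
  assumes [measurable]: "H \<in> borel_measurable borel" and lim: "x \<longlonglongrightarrow> z"
  shows "(\<integral>\<^sup>+w\<in>whitney a b (fst z) (snd z). H w \<partial>lborel)
    \<le> liminf (\<lambda>i. \<integral>\<^sup>+w\<in>whitney a b (fst (x i)) (snd (x i)). H w \<partial>lborel)"
proof -
  have "(\<integral>\<^sup>+w\<in>whitney a b (fst z) (snd z). H w \<partial>lborel)
    \<le> (\<integral>\<^sup>+w. liminf (\<lambda>i. H w * indicator (whitney a b (fst (x i)) (snd (x i))) w) \<partial>lborel)"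
  proof (rule nn_integral_mono)
    fix w :: "(real^'n) \<times> real"
    show "H w * indicator (whitney a b (fst z) (snd z)) w \<le> liminf (\<lambda>i. H w * indicator (whitney a b (fst (x i)) (snd (x i))) w)"
    proof (cases "w \<in> whitney a b (fst z) (snd z)")
      case True
      have f: "(\<lambda>i. dist (fst w) (fst (x i))) \<longlonglongrightarrow> dist (fst w) (fst z)" "(\<lambda>i. a * snd (x i)) \<longlonglongrightarrow> a * snd z"
        "(\<lambda>i. snd (x i) / b) \<longlonglongrightarrow> snd z / b" "(\<lambda>i. b * snd (x i)) \<longlonglongrightarrow> b * snd z"
        unfolding divide_inverse by (intro tendsto_intros lim)+
      have "eventually (\<lambda>i. a * snd (x i) - dist (fst w) (fst (x i)) > 0) sequentially"
        by (rule order_tendstoD[OF tendsto_diff[OF f(2,1)]]) (use True in simp)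
      moreover have "eventually (\<lambda>i. snd (x i) / b < snd w) sequentially"
        by (rule order_tendstoD[OF f(3)]) (use True in simp)
      moreover have "eventually (\<lambda>i. b * snd (x i) > snd w) sequentially"
        by (rule order_tendstoD[OF f(4)]) (use True in simp)
      ultimately have "eventually (\<lambda>i. H w * indicator (whitney a b (fst z) (snd z)) w \<le> H w * indicator (whitney a b (fst (x i)) (snd (x i))) w) sequentially"
        by eventually_elim (use True in simp)
      then show ?thesis by (rule Liminf_bounded)
    qed simp
  qed
  also have "\<dots> \<le> liminf (\<lambda>i. \<integral>\<^sup>+w\<in>whitney a b (fst (x i)) (snd (x i)). H w \<partial>lborel)"
    by (rule nn_integral_liminf) measurable
  finally show ?thesis .
qed

text \<open>If \<open>P\<close> failed throughout a neighbourhood of \<open>z\<close>, a nonempty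
  open set would be null.\<close>

lemma AE_half_space_dense:
  fixes z :: "(real^'n) \<times> real"
  assumes ae: "AE z in lborel. 0 < snd z \<longrightarrow> P (z :: (real^'n) \<times> real)" and z: "0 < snd z"
  obtains x where "x \<longlonglongrightarrow> z" "\<And>i. 0 < snd (x i)" "\<And>i. P (x i)"
proof -
  have "\<exists>w. dist w z < inverse (real (Suc i)) \<and> 0 < snd w \<and> P w" for i
  proof (rule ccontr)
    let ?S = "ball z (inverse (real (Suc i))) \<inter> {w. 0 < snd w}"
    assume no: "\<not> (\<exists>w. dist w z < inverse (real (Suc i)) \<and> 0 < snd w \<and> P w)"
    have "AE w in lborel. w \<notin> ?S"
      using ae by eventually_elim (use no in \<open>auto simp: dist_commute\<close>)
    moreover have op: "open ?S" by (intro open_Int open_ball open_Collect_less continuous_intros)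
    ultimately have "?S \<in> null_sets lborel" by (subst AE_iff_null_sets) auto
    then have "negligible ?S" by (simp add: negligible_iff_null_sets null_sets_completionI)
    moreover have "z \<in> ?S" using z by simp
    ultimately show False using open_not_negligible[OF op] by blast
  qed
  then obtain x where x: "\<And>i. dist (x i) z < inverse (real (Suc i))" "\<And>i. 0 < snd (x i)" "\<And>i. P (x i)" by metis
  have "x \<longlonglongrightarrow> z"
  proof (rule metric_tendsto_imp_tendsto[OF LIMSEQ_inverse_real_of_nat])
    show "eventually (\<lambda>i. dist (x i) z \<le> dist (inverse (real (Suc i))) 0) sequentially"
      using x(1) by (intro always_eventually allI) (simp add: less_imp_le)
  qed
  with x(2,3) that show ?thesis by blast
qed

text \<open>Whitney averages are lower semicontinuous, so their essential suprema are suprema.\<close>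

lemma wav_AE_le:
  fixes F :: "(real^'n) \<times> real \<Rightarrow> ennreal"
  assumes [measurable]: "F \<in> borel_measurable borel" and ab: "0 < a" "1 < b" and r: "0 < r"
    and ae: "AE z in lborel. 0 < snd z \<longrightarrow> wav a b r F z \<le> c" and z: "0 < snd z"
  shows "wav a b r F z \<le> c"
proof -
  obtain x where x: "x \<longlonglongrightarrow> z" "\<And>i. 0 < snd (x i)" "\<And>i. wav a b r F (x i) \<le> c"
    using AE_half_space_dense[OF ae z] by blast
  show ?thesis
  proof (cases "r = top")
    case True
    have eq: "wav a b r F z \<le> c \<longleftrightarrow> (\<integral>\<^sup>+w\<in>whitney a b (fst z) (snd z). indicator {w. c < F w} w \<partial>lborel) = 0" for z
      using True by (simp add: wav_def avg_on_def ess_sup_on_le_iff_integral)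
    have "(\<integral>\<^sup>+w\<in>whitney a b (fst z) (snd z). indicator {w. c < F w} w \<partial>lborel)
      \<le> liminf (\<lambda>i. \<integral>\<^sup>+w\<in>whitney a b (fst (x i)) (snd (x i)). indicator {w. c < F w} w \<partial>lborel)"
      using x(1) by (intro whitney_integral_lsc) auto
    also have "\<dots> = 0" using x(3) by (simp add: eq Liminf_const)
    finally show ?thesis by (simp add: eq)
  next
    case False
    note pos = enn2real_pos[OF r False]
    let ?r = "enn2real r" and ?e = "\<lambda>z :: (real^'n) \<times> real. emeasure lborel (whitney a b (fst z) (snd z))"
    let ?I = "\<lambda>z. \<integral>\<^sup>+w\<in>whitney a b (fst z) (snd z). epow (F w) ?r \<partial>lborel"
    have eq: "wav a b r F z \<le> c \<longleftrightarrow> ?I z \<le> epow c ?r * ?e z" if t: "0 < snd z" for z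
      unfolding wav_def by (rule avg_on_le_iff[OF r False emeasure_whitney_bounds[OF ab t]])
    have "?I z \<le> epow c ?r * ?e z"
    proof (cases "c = top")
      case True
      then show ?thesis using emeasure_whitney_bounds[OF ab z, of "fst z"] by (simp add: ennreal_top_mult)
    next
      \<comment> \<open>The volume of a box is a fixed multiple of \<open>t^(n+1)\<close> and
        converges along the sequence; \<open>c\<close> has to be finite for the product to converge
        with it.\<close>
      case c: False
      define K where "K = unit_ball_vol (real CARD('n)) * a ^ CARD('n) * (b - 1 / b)"
      have e: "?e z = ennreal (K * snd z ^ (CARD('n) + 1))" if "0 < snd z" for z
        using emeasure_whitney[OF ab that, of "fst z"] by (simp add: K_def)
      have "?I z \<le> liminf (\<lambda>i. ?I (x i))" using x(1) by (intro whitney_integral_lsc) auto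
      also have "\<dots> \<le> liminf (\<lambda>i. epow c ?r * ennreal (K * snd (x i) ^ (CARD('n) + 1)))"
        using x(2,3) eq e by (intro Liminf_mono always_eventually allI) simp
      also have "\<dots> = epow c ?r * ennreal (K * snd z ^ (CARD('n) + 1))"
      proof (rule lim_imp_Liminf)
        show "(\<lambda>i. epow c ?r * ennreal (K * snd (x i) ^ (CARD('n) + 1))) \<longlonglongrightarrow> epow c ?r * ennreal (K * snd z ^ (CARD('n) + 1))"
          using c by (intro ennreal_tendsto_cmult tendsto_ennrealI tendsto_intros x(1)) (simp add: less_top)
      qed simp
      finally show ?thesis using e[OF z] by simp
    qed
    then show ?thesis using eq[OF z] by simp
  qed
qed

section \<open>Hoelder's inequality on Whitney boxes and Borel representatives\<close>

lemma wav_cong_AE: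
  assumes "AE w in lborel. w \<in> whitney a b (fst z) (snd z) \<longrightarrow> F w = G w"
  shows "wav a b r F z = wav a b r G z"
  unfolding wav_def
proof (rule antisym)
  show "avg_on r (whitney a b (fst z) (snd z)) F \<le> avg_on r (whitney a b (fst z) (snd z)) G"
    by (rule avg_on_mono_AE, use assms in eventually_elim) simp
  show "avg_on r (whitney a b (fst z) (snd z)) G \<le> avg_on r (whitney a b (fst z) (snd z)) F"
    by (rule avg_on_mono_AE, use assms in eventually_elim) simp
qed

lemma wav_mult_bounded:
  fixes F G :: "(real^'n) \<times> real \<Rightarrow> ennreal"
  assumes G: "G \<in> borel_measurable borel" and r: "0 < r"
    and ae: "AE w in lborel. w \<in> whitney a b (fst z) (snd z) \<longrightarrow> F w \<le> M"
  shows "wav a b r (\<lambda>w. F w * G w) z \<le> M * wav a b r G z"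
proof -
  have "wav a b r (\<lambda>w. F w * G w) z \<le> avg_on r (whitney a b (fst z) (snd z)) (\<lambda>w. M * G w)"
    unfolding wav_def by (rule avg_on_mono_AE, use ae in eventually_elim) (auto intro: mult_right_mono)
  also have "\<dots> \<le> M * wav a b r G z" unfolding wav_def by (rule avg_on_cmult_le[OF r G]) simp
  finally show ?thesis .
qed

lemma wav_top_bound:
  "AE w in lborel. w \<in> whitney a b (fst z) (snd z) \<longrightarrow> F w \<le> wav a b top F z"
  using ess_sup_on_le_iff[of "whitney a b (fst z) (snd z)" F "wav a b top F z"] by (simp add: wav_def avg_on_def)

text \<open>Hoelder's inequality for the normalized measure on the box; thanks to the normalization
  the volume drops out and no constant appears.\<close>

lemma wav_mult:
  fixes F G :: "(real^'n) \<times> real \<Rightarrow> ennreal"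
  assumes [measurable]: "F \<in> borel_measurable borel" "G \<in> borel_measurable borel"
    and inv: "inverse r0 = inverse r1 + inverse r2" and pos: "0 < r0" "0 < r1" "0 < r2"
    and ab: "0 < a" "1 < b" and z: "0 < snd z"
  shows "wav a b r0 (\<lambda>w. F w * G w) z \<le> wav a b r1 F z * wav a b r2 G z"
  using inv pos
proof (cases rule: conjugate_exponents_cases)
  case 1
  have "AE w in lborel. w \<in> whitney a b (fst z) (snd z) \<longrightarrow> F w * G w \<le> wav a b top F z * wav a b top G z"
    using wav_top_bound[of a b z F] wav_top_bound[of a b z G] by eventually_elim (auto intro: mult_mono)
  then show ?thesis
    using 1 ess_sup_on_le_iff[of "whitney a b (fst z) (snd z)" "\<lambda>w. F w * G w"] by (simp add: wav_def avg_on_def)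
next
  case 2
  then show ?thesis using wav_mult_bounded[of G r0 a b z F "wav a b r1 F z"] pos wav_top_bound[of a b z F] by simp
next
  case 3
  then show ?thesis using wav_mult_bounded[of F r0 a b z G "wav a b r2 G z"] pos wav_top_bound[of a b z G]
    by (simp add: mult.commute)
next
  case 4
  note p = enn2real_pos[OF pos(1) 4(1)] enn2real_pos[OF pos(2) 4(2)] enn2real_pos[OF pos(3) 4(3)]
  let ?q0 = "enn2real r0" and ?q1 = "enn2real r1" and ?q2 = "enn2real r2" and ?W = "whitney a b (fst z) (snd z)"
  let ?d = "\<lambda>w. indicator ?W w / emeasure lborel ?W"
  have split1: "x = epow x (?q0 / ?q1) * epow x (?q0 / ?q2)" for x
    unfolding epow_add[symmetric] 4 by simp
  have avg: "(\<integral>\<^sup>+w\<in>?W. H w \<partial>lborel) / emeasure lborel ?W = (\<integral>\<^sup>+w. H w * ?d w \<partial>lborel)"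
    if [measurable]: "H \<in> borel_measurable borel" for H
    by (subst nn_integral_divide[symmetric]) (auto intro!: nn_integral_cong simp: ennreal_times_divide)
  have "(\<integral>\<^sup>+w. epow (F w * G w) ?q0 * ?d w \<partial>lborel)
    = (\<integral>\<^sup>+w. epow (epow (F w) ?q1 * ?d w) (?q0 / ?q1) * epow (epow (G w) ?q2 * ?d w) (?q0 / ?q2) \<partial>lborel)"
  proof (rule nn_integral_cong)
    fix w :: "(real^'n) \<times> real"
    have "epow (F w * G w) ?q0 * ?d w = epow (F w) ?q0 * epow (G w) ?q0 * (epow (?d w) (?q0 / ?q1) * epow (?d w) (?q0 / ?q2))"
      using split1[of "?d w"] by (simp add: epow_mult)
    then show "epow (F w * G w) ?q0 * ?d w = epow (epow (F w) ?q1 * ?d w) (?q0 / ?q1) * epow (epow (G w) ?q2 * ?d w) (?q0 / ?q2)"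
      using p by (simp add: epow_mult epow_epow mult_ac)
  qed
  also have "\<dots> \<le> epow (\<integral>\<^sup>+w. epow (F w) ?q1 * ?d w \<partial>lborel) (?q0 / ?q1) * epow (\<integral>\<^sup>+w. epow (G w) ?q2 * ?d w \<partial>lborel) (?q0 / ?q2)"
    using p 4 by (intro nn_integral_Hoelder) auto
  finally have "wav a b r0 (\<lambda>w. F w * G w) z \<le>
    epow (epow (\<integral>\<^sup>+w. epow (F w) ?q1 * ?d w \<partial>lborel) (?q0 / ?q1) * epow (\<integral>\<^sup>+w. epow (G w) ?q2 * ?d w \<partial>lborel) (?q0 / ?q2)) (1 / ?q0)"
    using 4 p by (simp add: wav_def avg_on_def avg)
  also have "\<dots> = wav a b r1 F z * wav a b r2 G z"
    using 4 p by (simp add: wav_def avg_on_def avg epow_mult epow_epow)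
  finally show ?thesis .
qed

lemma whitney_avg_eq_wav:
  assumes r: "0 < r"
  shows "whitney_avg a b r f z = wav a b r (\<lambda>w. ennreal (cmod (f w))) z"
  by (simp add: whitney_avg_def wav_def avg_on_def Let_def nn_integral_completion epow_ennreal)

text \<open>Whitney averages ignore null sets, so a Borel function that equals the weighted modulus
  almost everywhere has the same average at every point, which is what nontangential suprema
  require. Boxes contain only points of the open half-space, so the values of \<open>f\<close>
  elsewhere have no influence.\<close>

lemma T_norm_eq_tent_norm:
  assumes ab: "0 < a" "1 < b" and pos: "0 < p" "0 < q" "0 < r"
    and ae: "AE z in lborel. 0 < snd z \<longrightarrow> F z = ennreal (cmod (f z) * snd z powr (- \<beta>))"
  shows "T_norm a b p q r \<beta> f = tent_norm p q (wav a b r F)"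
proof -
  have "whitney_avg a b r (\<lambda>(z, s). f (z, s) * complex_of_real (s powr (- \<beta>))) = wav a b r F"
  proof
    fix z
    have "AE w in lborel. w \<in> whitney a b (fst z) (snd z) \<longrightarrow>
        ennreal (cmod (f (fst w, snd w) * complex_of_real (snd w powr (- \<beta>)))) = F w"
      using ae
    proof eventually_elim
      case (elim w)
      then show ?case using whitney_pos(2)[of w a b "fst z" "snd z"] ab by (auto simp: norm_mult)
    qed
    then show "whitney_avg a b r (\<lambda>(z, s). f (z, s) * complex_of_real (s powr (- \<beta>))) z = wav a b r F z"
      unfolding whitney_avg_eq_wav[OF pos(3)] case_prod_beta' by (rule wav_cong_AE)
  qed
  then show ?thesis by (simp add: T_norm_def)
qed

text \<open>Lebesgue measurable functions are exchanged for Borel ones before any use of Tonelli's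
  theorem; the norms see only the modulus. The absolute value in the proof makes the representative
  nonnegative also on the exceptional null set.\<close>

lemma borel_modulus:
  fixes f :: "(real^'n) \<times> real \<Rightarrow> complex"
  assumes [measurable]: "f \<in> borel_measurable lebesgue"
  obtains F :: "(real^'n) \<times> real \<Rightarrow> real" where "F \<in> borel_measurable borel" "\<And>z. 0 \<le> F z"
    "AE z in lborel. 0 < snd z \<longrightarrow> F z = cmod (f z) * snd z powr (- \<beta>)"
proof -
  have [measurable]: "snd \<in> borel_measurable (lebesgue :: ((real^'n) \<times> real) measure)"
    by (intro measurable_completion) simp
  have "(\<lambda>z. cmod (f z) * snd z powr (- \<beta>)) \<in> borel_measurable (completion lborel)"
    by measurable
  then obtain F where F: "F \<in> borel_measurable lborel" "AE z in lborel. cmod (f z) * snd z powr (- \<beta>) = F z"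
    using completion_ex_borel_measurable_real by blast
  show ?thesis
  proof (rule that[of "\<lambda>z. \<bar>F z\<bar>"])
    show "AE z in lborel. 0 < snd z \<longrightarrow> \<bar>F z\<bar> = cmod (f z) * snd z powr (- \<beta>)"
      using F(2) by eventually_elim (auto simp: abs_mult dest: sym)
  qed (use F(1) in auto)
qed

section \<open>Multiplication\<close>

text \<open>The factorization of a tent norm asks for a bound \<open>N > 0\<close>, while the norms
  themselves may vanish. They are enlarged by \<open>e\<close>, which then tends to zero.\<close>

lemma ennreal_le_mult_limit:
  fixes t t1 t2 :: ennreal
  assumes "t1 < top" "t2 < top" and le: "\<And>e. 0 < e \<Longrightarrow> t \<le> ennreal (K * ((enn2real t1 + e) * (enn2real t2 + e)))"
    and K: "0 \<le> K"
  shows "t \<le> ennreal K * t1 * t2"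
proof -
  have "t \<le> ennreal (K * ((enn2real t1 + 0) * (enn2real t2 + 0)))"
  proof (rule tendsto_lowerbound)
    show "((\<lambda>e. ennreal (K * ((enn2real t1 + e) * (enn2real t2 + e)))) \<longlongrightarrow> ennreal (K * ((enn2real t1 + 0) * (enn2real t2 + 0)))) (at_right 0)"
      by (intro tendsto_intros)
    show "\<forall>\<^sub>F e in at_right 0. t \<le> ennreal (K * ((enn2real t1 + e) * (enn2real t2 + e)))"
      using le by (auto simp: eventually_at_filter)
  qed simp
  also have "\<dots> = ennreal K * t1 * t2" using assms by (simp add: ennreal_mult mult.assoc)
  finally show ?thesis .
qed

text \<open>Supplies the pointwise bound demanded by \<open>tent_norm_factorization\<close> when
  \<open>p = q = top\<close>: the tent norm is then an essential supremum, upgraded by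
  semicontinuity.\<close>

lemma wav_le_tent_norm_top:
  fixes F :: "(real^'n) \<times> real \<Rightarrow> ennreal"
  assumes F: "F \<in> borel_measurable borel" and ab: "0 < a" "1 < b" and r: "0 < r"
    and N: "tent_norm top top (wav a b r F) \<le> N" and z: "0 < snd z"
  shows "wav a b r F z \<le> N"
proof (rule wav_AE_le[OF F ab r _ z])
  have "AE z in lborel. 0 < snd z \<longrightarrow> wav a b r F z \<le> tent_norm top top (wav a b r F)"
    using tent_norm_ess_sup_attained[of "wav a b r F"] unfolding AE_completion_iff .
  then show "AE z in lborel. 0 < snd z \<longrightarrow> wav a b r F z \<le> N"
    by eventually_elim (use N in \<open>auto intro: order_trans\<close>)
qed

text \<open>Hoelder's inequality on each box gives \<open>w0 \<le> w1 * w2\<close>. With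
  \<open>w1 \<le> k1 * m1\<close> and \<open>w2 \<le> k2 * m2\<close>, regrouping as
  \<open>(k1 * k2) * (m1 * m2)\<close> separates the exponents: the \<open>p\<close> concern only
  the first product, the \<open>q\<close> only the second.\<close>

lemma multiplication:
  assumes ab: "0 < a1" "1 < a2"
    and p: "inverse p0 = inverse p1 + inverse p2" "0 < p0" "0 < p1" "0 < p2"
    and q: "inverse q0 = inverse q1 + inverse q2" "0 < q0" "0 < q1" "0 < q2"
    and r: "inverse r0 = inverse r1 + inverse r2" "0 < r0" "0 < r1" "0 < r2"
  obtains C where "0 \<le> C" "\<And>f1 f2 :: (real^'n) \<times> real \<Rightarrow> complex.
    in_T a1 a2 p1 q1 r1 \<beta>1 f1 \<Longrightarrow> in_T a1 a2 p2 q2 r2 \<beta>2 f2 \<Longrightarrow>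
    T_norm a1 a2 p0 q0 r0 (\<beta>1 + \<beta>2) (\<lambda>z. f1 z * f2 z) \<le> ennreal C * T_norm a1 a2 p1 q1 r1 \<beta>1 f1 * T_norm a1 a2 p2 q2 r2 \<beta>2 f2"
proof -
  obtain C0 where C0: "0 \<le> C0" "\<And>k m A. k \<in> borel_measurable borel \<Longrightarrow> (m :: (real^'n) \<times> real \<Rightarrow> ennreal) \<in> borel_measurable borel \<Longrightarrow>
    A \<noteq> 0 \<Longrightarrow> Carleson_le q0 m A \<Longrightarrow> tent_norm p0 q0 (\<lambda>z. k z * m z) \<le> ennreal C0 * (nt_norm p0 1 k * A)"
    using tent_norm_mult_le[OF p(2) q(2)] by blast
  obtain C1 where C1: "1 \<le> C1" "\<And>(w :: (real^'n) \<times> real \<Rightarrow> ennreal) N. w \<in> borel_measurable borel \<Longrightarrow> 0 < N \<Longrightarrow>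
    tent_norm p1 q1 w \<le> ennreal N \<Longrightarrow> (p1 = top \<longrightarrow> q1 = top \<longrightarrow> (\<forall>z. 0 < snd z \<longrightarrow> w z \<le> ennreal N)) \<Longrightarrow>
    tent_factors p1 q1 1 C1 N w"
    using tent_norm_factorization[OF p(3) q(3) order_refl] by blast
  obtain C2 where C2: "1 \<le> C2" "\<And>(w :: (real^'n) \<times> real \<Rightarrow> ennreal) N. w \<in> borel_measurable borel \<Longrightarrow> 0 < N \<Longrightarrow>
    tent_norm p2 q2 w \<le> ennreal N \<Longrightarrow> (p2 = top \<longrightarrow> q2 = top \<longrightarrow> (\<forall>z. 0 < snd z \<longrightarrow> w z \<le> ennreal N)) \<Longrightarrow>
    tent_factors p2 q2 1 C2 N w"
    using tent_norm_factorization[OF p(4) q(4) order_refl] by blast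
  \<comment> \<open>\<open>C1\<close> and \<open>C2\<close> enter twice each, through a maximal norm
    and through a Carleson constant.\<close>
  define C where "C = C0 * (C1 * C1) * (C2 * C2)"
  have C: "0 \<le> C" using C0 C1 C2 by (simp add: C_def)
  show ?thesis
  proof (rule that[OF C])
    fix f1 f2 :: "(real^'n) \<times> real \<Rightarrow> complex"
    assume f: "in_T a1 a2 p1 q1 r1 \<beta>1 f1" "in_T a1 a2 p2 q2 r2 \<beta>2 f2"
    obtain F1 where F1 [measurable]: "F1 \<in> borel_measurable borel" and F1': "\<And>z. 0 \<le> F1 z"
      "AE z in lborel. 0 < snd z \<longrightarrow> F1 z = cmod (f1 z) * snd z powr (- \<beta>1)"
      using f(1) borel_modulus[of f1 \<beta>1] unfolding in_T_def by blast
    obtain F2 where F2 [measurable]: "F2 \<in> borel_measurable borel" and F2': "\<And>z. 0 \<le> F2 z"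
      "AE z in lborel. 0 < snd z \<longrightarrow> F2 z = cmod (f2 z) * snd z powr (- \<beta>2)"
      using f(2) borel_modulus[of f2 \<beta>2] unfolding in_T_def by blast
    define w1 w2 w0 where "w1 = wav a1 a2 r1 (\<lambda>z. ennreal (F1 z))" and "w2 = wav a1 a2 r2 (\<lambda>z. ennreal (F2 z))"
      and "w0 = wav a1 a2 r0 (\<lambda>z. ennreal (F1 z) * ennreal (F2 z))"
    have [measurable]: "w1 \<in> borel_measurable borel" "w2 \<in> borel_measurable borel"
      unfolding w1_def w2_def by measurable
    have T1: "T_norm a1 a2 p1 q1 r1 \<beta>1 f1 = tent_norm p1 q1 w1"
      unfolding w1_def using ab p q r F1'(2) by (intro T_norm_eq_tent_norm) (auto elim!: eventually_mono)
    have T2: "T_norm a1 a2 p2 q2 r2 \<beta>2 f2 = tent_norm p2 q2 w2"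
      unfolding w2_def using ab p q r F2'(2) by (intro T_norm_eq_tent_norm) (auto elim!: eventually_mono)
    have "AE z in lborel. 0 < snd z \<longrightarrow> ennreal (F1 z) * ennreal (F2 z) = ennreal (cmod (f1 z * f2 z) * snd z powr (- (\<beta>1 + \<beta>2)))"
      using F1'(2) F2'(2)
    proof eventually_elim
      case (elim z)
      show ?case
      proof
        assume "0 < snd z"
        then have "F1 z * F2 z = cmod (f1 z * f2 z) * snd z powr (- (\<beta>1 + \<beta>2))"
          using elim powr_add[of "snd z" "- \<beta>1" "- \<beta>2"] by (simp add: norm_mult mult_ac)
        then show "ennreal (F1 z) * ennreal (F2 z) = ennreal (cmod (f1 z * f2 z) * snd z powr (- (\<beta>1 + \<beta>2)))"
          using F1'(1) F2'(1) by (simp flip: ennreal_mult)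
      qed
    qed
    then have T0: "T_norm a1 a2 p0 q0 r0 (\<beta>1 + \<beta>2) (\<lambda>z. f1 z * f2 z) = tent_norm p0 q0 w0"
      unfolding w0_def using ab p q r by (intro T_norm_eq_tent_norm) auto
    have w0: "w0 z \<le> w1 z * w2 z" if "0 < snd z" for z
      unfolding w0_def w1_def w2_def using that ab r by (intro wav_mult) auto
    have fin: "tent_norm p1 q1 w1 < top" "tent_norm p2 q2 w2 < top"
      using f T1 T2 by (auto simp: in_T_def)
    show "T_norm a1 a2 p0 q0 r0 (\<beta>1 + \<beta>2) (\<lambda>z. f1 z * f2 z) \<le> ennreal C * T_norm a1 a2 p1 q1 r1 \<beta>1 f1 * T_norm a1 a2 p2 q2 r2 \<beta>2 f2"
      unfolding T0 T1 T2
    proof (rule ennreal_le_mult_limit[OF fin _ C])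
      fix e :: real assume e: "0 < e"
      define N1 N2 where "N1 = enn2real (tent_norm p1 q1 w1) + e" and "N2 = enn2real (tent_norm p2 q2 w2) + e"
      have N: "0 < N1" "0 < N2" using e by (auto simp: N1_def N2_def add_nonneg_pos)
      have tN: "tent_norm p1 q1 w1 \<le> ennreal N1" "tent_norm p2 q2 w2 \<le> ennreal N2"
        using fin e by (auto simp: N1_def N2_def less_top_ennreal ennreal_leI)
      have pt: "w1 z \<le> ennreal N1" if "p1 = top" "q1 = top" "0 < snd z" for z
        unfolding w1_def using tN(1) that ab r by (intro wav_le_tent_norm_top) (auto simp: w1_def)
      have pt2: "w2 z \<le> ennreal N2" if "p2 = top" "q2 = top" "0 < snd z" for z
        unfolding w2_def using tN(2) that ab r by (intro wav_le_tent_norm_top) (auto simp: w2_def)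
      obtain k1 m1 where k1 [measurable]: "k1 \<in> borel_measurable borel" "m1 \<in> borel_measurable borel"
        and km1: "nt_norm p1 1 k1 \<le> ennreal (C1 * N1)" "Carleson_le q1 m1 (ennreal C1)"
          "AE z in lborel. 0 < snd z \<longrightarrow> w1 z \<le> k1 z * m1 z" "q1 = top \<longrightarrow> (\<forall>z. 0 < snd z \<longrightarrow> w1 z \<le> k1 z * m1 z)"
        using C1(2)[of w1 N1] N tN pt unfolding tent_factors_def by auto
      obtain k2 m2 where k2 [measurable]: "k2 \<in> borel_measurable borel" "m2 \<in> borel_measurable borel"
        and km2: "nt_norm p2 1 k2 \<le> ennreal (C2 * N2)" "Carleson_le q2 m2 (ennreal C2)"
          "AE z in lborel. 0 < snd z \<longrightarrow> w2 z \<le> k2 z * m2 z" "q2 = top \<longrightarrow> (\<forall>z. 0 < snd z \<longrightarrow> w2 z \<le> k2 z * m2 z)"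
        using C2(2)[of w2 N2] N tN pt2 unfolding tent_factors_def by auto
      have combine: "w0 z \<le> (k1 z * k2 z) * (m1 z * m2 z)" if "0 < snd z" "w1 z \<le> k1 z * m1 z" "w2 z \<le> k2 z * m2 z" for z
      proof -
        have "w0 z \<le> w1 z * w2 z" using that by (intro w0)
        also have "\<dots> \<le> (k1 z * m1 z) * (k2 z * m2 z)" using that by (intro mult_mono) auto
        finally show ?thesis by (simp add: mult_ac)
      qed
      have "tent_norm p0 q0 w0 \<le> tent_norm p0 q0 (\<lambda>z. (k1 z * k2 z) * (m1 z * m2 z))"
      proof (rule tent_norm_mono[OF p(2) q(2)])
        show "AE z in lborel. 0 < snd z \<longrightarrow> w0 z \<le> k1 z * k2 z * (m1 z * m2 z)"
          using km1(3) km2(3) by eventually_elim (auto intro!: combine)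
        fix z :: "(real^'n) \<times> real"
        assume "q0 = top" and z: "0 < snd z"
        \<comment> \<open>An infinite \<open>q0\<close> forces both summands of \<open>1/q0\<close>
          to vanish, so both majorizations hold at every point, as the supremum norm
          requires.\<close>
        then have "q1 = top" "q2 = top" using q(1) by auto
        then show "w0 z \<le> k1 z * k2 z * (m1 z * m2 z)" using km1(4) km2(4) z by (cases z) (auto intro!: combine)
      qed
      also have "\<dots> \<le> ennreal C0 * (nt_norm p0 1 (\<lambda>z. k1 z * k2 z) * (ennreal C1 * ennreal C2))"
        using C1(1) C2(1) q km1(2) km2(2) by (intro C0(2) Carleson_le_mult[of q0 q1 q2]) auto
      also have "\<dots> \<le> ennreal C0 * ((nt_norm p1 1 k1 * nt_norm p2 1 k2) * (ennreal C1 * ennreal C2))"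
        using p by (intro mult_left_mono mult_right_mono nt_norm_mult) auto
      also have "\<dots> \<le> ennreal C0 * ((ennreal (C1 * N1) * ennreal (C2 * N2)) * (ennreal C1 * ennreal C2))"
        using km1(1) km2(1) by (intro mult_left_mono mult_right_mono mult_mono) auto
      also have "\<dots> = ennreal (C * (N1 * N2))"
        using C0(1) C1(1) C2(1) N by (simp add: C_def mult_ac flip: ennreal_mult)
      finally show "tent_norm p0 q0 w0 \<le> ennreal (C * ((enn2real (tent_norm p1 q1 w1) + e) * (enn2real (tent_norm p2 q2 w2) + e)))"
        by (simp add: N1_def N2_def)
    qed
  qed
qed

section \<open>Averages over comparable sets\<close>

lemma avg_on_const_ge:
  assumes r: "0 < r" and [measurable]: "S \<in> sets borel" and S: "emeasure lborel S \<noteq> 0" "emeasure lborel S \<noteq> top"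
  shows "c \<le> avg_on r S (\<lambda>_. c)"
proof (cases "r = top")
  case True
  show ?thesis
  proof (rule ccontr)
    assume "\<not> c \<le> avg_on r S (\<lambda>_. c)"
    moreover have "AE w in lborel. w \<in> S \<longrightarrow> c \<le> avg_on r S (\<lambda>_. c)"
      by (rule iffD1[OF ess_sup_on_le_iff]) (simp add: avg_on_def True)
    ultimately have "AE w in lborel. w \<notin> S" by simp
    then have "emeasure lborel S = 0" by (subst (asm) AE_iff_measurable[OF _ refl]) auto
    with S show False by simp
  qed
next
  case False
  have "epow c (enn2real r) * emeasure lborel S = (\<integral>\<^sup>+w\<in>S. epow c (enn2real r) \<partial>lborel)"
    by (simp add: nn_integral_cmult_indicator)
  also have "\<dots> \<le> epow (avg_on r S (\<lambda>_. c)) (enn2real r) * emeasure lborel S"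
    using avg_on_le_iff[OF r False S, of "\<lambda>_. c" "avg_on r S (\<lambda>_. c)"] by simp
  finally have "emeasure lborel S * epow c (enn2real r) \<le> emeasure lborel S * epow (avg_on r S (\<lambda>_. c)) (enn2real r)"
    by (simp add: mult.commute)
  then show ?thesis
    using S enn2real_pos[OF r False] by (subst (asm) ennreal_mult_le_mult_iff) auto
qed

lemma avg_on_subset:
  assumes r: "0 < r" and ST: "S \<subseteq> T" and S: "emeasure lborel S \<noteq> 0" "emeasure lborel S \<noteq> top"
    and T: "emeasure lborel T \<noteq> 0" "emeasure lborel T \<noteq> top" and K: "1 \<le> K" "emeasure lborel T \<le> ennreal K * emeasure lborel S"
  shows "avg_on r S F \<le> ennreal (K powr (1 / enn2real r)) * avg_on r T F"
proof (cases "r = top")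
  case True
  have "AE w in lborel. w \<in> T \<longrightarrow> F w \<le> ess_sup_on T F"
    using ess_sup_on_le_iff[of T F "ess_sup_on T F"] by simp
  then have "ess_sup_on S F \<le> ess_sup_on T F"
    unfolding ess_sup_on_le_iff by eventually_elim (use ST in auto)
  \<comment> \<open>\<open>enn2real top = 0\<close> and division by zero is zero, so the constant is
    \<open>K powr 0 = 1\<close>, as it should be for essential suprema.\<close>
  then show ?thesis using True K by (simp add: avg_on_def)
next
  case False
  let ?r = "enn2real r"
  note pos = enn2real_pos[OF r False]
  have "(\<integral>\<^sup>+w\<in>S. epow (F w) ?r \<partial>lborel) \<le> (\<integral>\<^sup>+w\<in>T. epow (F w) ?r \<partial>lborel)"
    using ST by (intro nn_integral_mono) (auto simp: indicator_def)
  also have "\<dots> \<le> epow (avg_on r T F) ?r * emeasure lborel T"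
    using avg_on_le_iff[OF r False T, of F "avg_on r T F"] by simp
  also have "\<dots> \<le> epow (avg_on r T F) ?r * (ennreal K * emeasure lborel S)"
    using K by (intro mult_left_mono) auto
  also have "\<dots> = epow (ennreal (K powr (1 / ?r)) * avg_on r T F) ?r * emeasure lborel S"
    using K pos by (simp add: epow_mult epow_ennreal powr_powr mult_ac)
  finally show ?thesis using avg_on_le_iff[OF r False S] by simp
qed

section \<open>Splitting exponents\<close>

text \<open>Unlike \<open>epow\<close>, the exponent zero always gives one: \<open>epow 0 0 = 0\<close> and \<open>epow top 0 = top\<close>.\<close>

definition cpow :: "ennreal \<Rightarrow> real \<Rightarrow> ennreal" where
  "cpow x a = (if a = 0 then 1 else epow x a)"

lemma borel_measurable_cpow [measurable (raw)]:
  assumes [measurable]: "f \<in> borel_measurable M"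
  shows "(\<lambda>x. cpow (f x) a) \<in> borel_measurable M"
  unfolding cpow_def by measurable

text \<open>Only an inequality, because \<open>0 powr 0 = 0\<close> in the reals while
  \<open>cpow 0 0 = 1\<close>.\<close>

lemma powr_le_cpow: "0 \<le> x \<Longrightarrow> ennreal (x powr a) \<le> cpow (ennreal x) a"
  by (auto simp: cpow_def epow_ennreal)

lemma cpow_mono: "0 \<le> a \<Longrightarrow> x \<le> y \<Longrightarrow> cpow x a \<le> cpow y a"
  by (simp add: cpow_def epow_mono)

text \<open>The exponent \<open>p0/p1\<close> of the first factor; if \<open>p0 = top\<close>, one of the two factors takes everything.\<close>

definition split_exponent :: "ennreal \<Rightarrow> ennreal \<Rightarrow> real \<Rightarrow> bool" where
  "split_exponent p0 p1 \<theta> \<longleftrightarrow> (p0 = top \<and> p1 = top \<and> \<theta> = 1) \<or> (p1 = top \<and> \<theta> = 0)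
     \<or> (p0 \<noteq> top \<and> p1 \<noteq> top \<and> 0 < \<theta> \<and> \<theta> = enn2real p0 / enn2real p1)"

lemma split_exponent_nonneg: "split_exponent p0 p1 \<theta> \<Longrightarrow> 0 \<le> \<theta>"
  by (auto simp: split_exponent_def)

text \<open>The exponents sum to one, so that the two powers of a cell constant multiply back to it.
  For \<open>p0 = top\<close> the ratio \<open>p0/p1\<close> has no meaning, and the split into one
  and zero is taken.\<close>

lemma split_exponents_exist:
  assumes "inverse p0 = inverse p1 + inverse p2" "0 < p0" "0 < p1" "0 < p2"
  obtains \<theta>1 \<theta>2 where "split_exponent p0 p1 \<theta>1" "split_exponent p0 p2 \<theta>2" "\<theta>1 + \<theta>2 = 1"
  using assms
proof (cases rule: conjugate_exponents_cases)
  case 1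
  then show ?thesis by (intro that[of 1 0]) (auto simp: split_exponent_def)
next
  case 2
  then show ?thesis using enn2real_pos[of p0] assms by (intro that[of 0 1]) (auto simp: split_exponent_def)
next
  case 3
  then show ?thesis using enn2real_pos[of p0] assms by (intro that[of 1 0]) (auto simp: split_exponent_def)
next
  case 4
  then show ?thesis using enn2real_pos[of p0] enn2real_pos[of p1] enn2real_pos[of p2] assms
    by (intro that[of "enn2real p0 / enn2real p1" "enn2real p0 / enn2real p2"]) (auto simp: split_exponent_def)
qed

section \<open>Suprema and averages of the factors over enlarged boxes\<close>

definition whsup :: "real \<Rightarrow> ((real^'n) \<times> real \<Rightarrow> ennreal) \<Rightarrow> (real^'n) \<times> real \<Rightarrow> ennreal" where
  "whsup D k z = (SUP w\<in>whitney D D (fst z) (snd z). k w)"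

lemma open_whitney_dual: "open {z. w \<in> whitney a b (fst z) (snd z)}" for w :: "(real^'n) \<times> real"
  unfolding mem_whitney divide_inverse
  by (intro open_Collect_conj open_Collect_less continuous_intros)

text \<open>Each superlevel set is a union of open sets of base points, hence open for any
  \<open>k\<close>.\<close>

lemma borel_measurable_whsup [measurable]: "whsup D k \<in> borel_measurable borel"
proof (rule borel_measurableI_greater)
  fix c
  have "{z. c < whsup D k z} = (\<Union>w\<in>{w. c < k w}. {z. w \<in> whitney D D (fst z) (snd z)})"
    unfolding whsup_def less_SUP_iff by blast
  also have "open \<dots>" by (intro open_UN ballI open_whitney_dual)
  finally show "{z \<in> space borel. c < whsup D k z} \<in> sets borel" by (simp add: borel_open)
qed

text \<open>For \<open>z\<close> in the cone of \<open>x\<close> and \<open>w\<close> in the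
  enlarged box of \<open>z\<close>, the distance of \<open>fst w\<close> to \<open>x\<close> is
  below \<open>(D + 1) * snd z\<close>, and \<open>snd z < D * snd w\<close>; hence the
  aperture.\<close>

lemma ntmax_whsup_le:
  assumes D: "1 \<le> D"
  shows "ntmax 1 (whsup D k) x \<le> ntmax ((D + 1) * D) k x"
proof -
  have "k w \<le> ntmax ((D + 1) * D) k x" if z: "0 < snd z" "dist (fst z) x < 1 * snd z" and w: "w \<in> whitney D D (fst z) (snd z)" for z w
  proof (rule ntmax_upper)
    show s: "0 < snd w" using whitney_pos(2)[OF w] D by simp
    have "dist (fst w) (fst z) < D * snd z" using w by simp
    moreover have "snd z < D * snd w" using w D by (simp add: field_simps)
    then have "(D + 1) * snd z \<le> (D + 1) * (D * snd w)" using D by (intro mult_left_mono) auto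
    moreover have "dist (fst w) x \<le> dist (fst w) (fst z) + dist (fst z) x" by (rule dist_triangle)
    ultimately show "dist (fst w) x < (D + 1) * D * snd w" using z by (simp add: algebra_simps)
  qed
  then show ?thesis unfolding ntmax_def[of 1] whsup_def by (intro SUP_least) auto
qed

text \<open>The identity \<open>\<theta> * p1 = p0\<close> turns the \<open>p1\<close> norm of the
  power into the \<open>p0\<close> norm of \<open>k\<close>. The next two lemmas use the same
  identity for Carleson bounds and for averages.\<close>

lemma nt_norm_cpow_whsup:
  assumes D: "1 \<le> D" and p: "0 < p0" "0 < p1" and sp: "split_exponent p0 p1 \<theta>"
    and M: "0 < M" "nt_norm p0 ((D + 1) * D) k \<le> ennreal M"
  shows "nt_norm p1 1 (\<lambda>z. cpow (whsup D k z) \<theta>) \<le> ennreal (M powr \<theta>)"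
proof -
  consider "p0 = top" "p1 = top" "\<theta> = 1" | "p1 = top" "\<theta> = 0" | "p0 \<noteq> top" "p1 \<noteq> top" "0 < \<theta>" "\<theta> = enn2real p0 / enn2real p1"
    using sp by (auto simp: split_exponent_def)
  then show ?thesis
  proof cases
    case 1
    have k: "k w \<le> ennreal M" if "0 < snd w" for w
    proof -
      have "k w \<le> nt_norm p0 ((D + 1) * D) k" using 1 that by (auto simp: nt_norm_def intro: SUP_upper)
      then show ?thesis using M(2) by (rule order_trans)
    qed
    have "whsup D k z \<le> ennreal M" for z
      unfolding whsup_def using D by (intro SUP_least k whitney_pos(2)) auto
    then show ?thesis using 1 M by (auto simp: nt_norm_def cpow_def intro!: SUP_least)
  next
    case 2
    then show ?thesis using M by (auto simp: nt_norm_def cpow_def intro!: SUP_least)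
  next
    case 3
    note pos = enn2real_pos[OF p(1) 3(1)] enn2real_pos[OF p(2) 3(2)]
    let ?p0 = "enn2real p0" and ?p1 = "enn2real p1"
    have th: "\<theta> * ?p1 = ?p0" using pos 3 by simp
    have "nt_norm p1 1 (\<lambda>z. cpow (whsup D k z) \<theta>) = epow (\<integral>\<^sup>+x. epow (ntmax 1 (whsup D k) x) ?p0 \<partial>lborel) (1 / ?p1)"
      using 3(1-3) by (simp add: nt_norm_def cpow_def epow_ntmax epow_epow th del: times_divide_eq_left)
    also have "\<dots> \<le> epow (\<integral>\<^sup>+x. epow (ntmax ((D + 1) * D) k x) ?p0 \<partial>lborel) (1 / ?p1)"
      by (intro epow_mono nn_integral_mono ntmax_whsup_le D) auto
    also have "\<dots> = epow (nt_norm p0 ((D + 1) * D) k) \<theta>"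
      using 3 pos by (simp add: nt_norm_def epow_epow)
    also have "\<dots> \<le> epow (ennreal M) \<theta>" using 3 M by (intro epow_mono) auto
    finally show ?thesis using M by (simp add: epow_ennreal)
  qed
qed

lemma Carleson_le_cpow:
  fixes m :: "(real^'n) \<times> real \<Rightarrow> ennreal"
  assumes q: "0 < q0" "0 < q1" and sp: "split_exponent q0 q1 \<phi>"
    and M: "0 < M" "Carleson_le q0 m (ennreal M)"
  shows "Carleson_le q1 (\<lambda>z. cpow (m z) \<phi>) (ennreal (M powr \<phi>))"
proof -
  consider "q0 = top" "q1 = top" "\<phi> = 1" | "q1 = top" "\<phi> = 0" | "q0 \<noteq> top" "q1 \<noteq> top" "0 < \<phi>" "\<phi> = enn2real q0 / enn2real q1"
    using sp by (auto simp: split_exponent_def)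
  then show ?thesis
  proof cases
    case 1
    then show ?thesis using M by (simp add: Carleson_le_def cpow_def)
  next
    case 2
    then show ?thesis using M by (simp add: Carleson_le_def cpow_def)
  next
    case 3
    note pos = enn2real_pos[OF q(1) 3(1)] enn2real_pos[OF q(2) 3(2)]
    have th: "\<phi> * enn2real q1 = enn2real q0" using pos 3 by simp
    show ?thesis using M 3(1-3)
      by (simp add: Carleson_le_def cpow_def epow_epow epow_ennreal powr_powr th)
  qed
qed

lemma wav_cpow:
  assumes r: "0 < r0" "0 < r1" and sp: "split_exponent r0 r1 \<rho>"
    and M: "0 < M" "wav a b r0 H z \<le> ennreal M"
  shows "wav a b r1 (\<lambda>w. cpow (H w) \<rho>) z \<le> ennreal (M powr \<rho>)"
proof -
  consider "r0 = top" "r1 = top" "\<rho> = 1" | "r1 = top" "\<rho> = 0" | "r0 \<noteq> top" "r1 \<noteq> top" "0 < \<rho>" "\<rho> = enn2real r0 / enn2real r1"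
    using sp by (auto simp: split_exponent_def)
  then show ?thesis
  proof cases
    case 1
    then show ?thesis using M by (simp add: cpow_def)
  next
    case 2
    then show ?thesis using M by (simp add: cpow_def wav_def avg_on_def ess_sup_on_le_iff)
  next
    case 3
    note pos = enn2real_pos[OF r(1) 3(1)] enn2real_pos[OF r(2) 3(2)]
    have th: "\<rho> * enn2real r1 = enn2real r0" using pos 3 by simp
    have "wav a b r1 (\<lambda>w. cpow (H w) \<rho>) z = epow (wav a b r0 H z) \<rho>"
      using 3(1-3) pos 3(4) by (simp add: wav_def avg_on_def cpow_def epow_epow)
    also have "\<dots> \<le> epow (ennreal M) \<rho>" using 3 M by (intro epow_mono) auto
    finally show ?thesis using M by (simp add: epow_ennreal)
  qed
qed

text \<open>Every \<open>x\<close> within distance \<open>\<sigma>\<close> of \<open>fst w\<close>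
  has \<open>w\<close> in its cone, so the maximal function is at least \<open>k w\<close> on a ball
  of radius \<open>\<sigma>\<close>. This makes the cell constants of \<open>k\<close> finite, and
  small when the norm is small. For \<open>p = top\<close> the exponent is \<open>1 / 0 = 0\<close>
  and the factor is one.\<close>

lemma nt_norm_local_bound:
  fixes k :: "(real^'n) \<times> real \<Rightarrow> ennreal"
  assumes p: "0 < p" and a: "1 \<le> a" and w: "0 < \<sigma>" "\<sigma> \<le> snd w"
  shows "k w \<le> ennreal ((1 / (unit_ball_vol (real CARD('n)) * \<sigma> ^ CARD('n))) powr (1 / enn2real p)) * nt_norm p a k"
proof (cases "p = top")
  case True
  have "k w \<le> nt_norm p a k" using True w by (auto simp: nt_norm_def intro: SUP_upper)
  then show ?thesis using True w by simp
next
  case False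
  let ?p = "enn2real p" and ?w = "unit_ball_vol (real CARD('n))"
  note pos = enn2real_pos[OF p False]
  have t: "0 < snd w" using w by simp
  have "epow (k w) ?p * emeasure lborel (ball (fst w) \<sigma>) = (\<integral>\<^sup>+x\<in>ball (fst w) \<sigma>. epow (k w) ?p \<partial>lborel)"
    by (simp add: nn_integral_cmult_indicator)
  also have "\<dots> \<le> (\<integral>\<^sup>+x. epow (ntmax a k x) ?p \<partial>lborel)"
  proof (rule nn_integral_mono)
    fix x
    have "k w \<le> ntmax a k x" if "x \<in> ball (fst w) \<sigma>"
    proof (rule ntmax_upper[OF t])
      have "1 * snd w \<le> a * snd w" using a t by (intro mult_right_mono) auto
      moreover have "dist (fst w) x < \<sigma>" using that by simp
      ultimately show "dist (fst w) x < a * snd w" using w by linarith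
    qed
    then show "epow (k w) ?p * indicator (ball (fst w) \<sigma>) x \<le> epow (ntmax a k x) ?p"
      using pos by (auto simp: indicator_def simp del: mem_ball)
  qed
  also have "\<dots> = epow (nt_norm p a k) ?p" using False pos by (simp add: nt_norm_def)
  finally have le: "epow (k w) ?p * ennreal (?w * \<sigma> ^ CARD('n)) \<le> epow (nt_norm p a k) ?p"
    using w by (simp add: emeasure_ball_vec)
  define v where "v = ?w * \<sigma> ^ CARD('n)"
  have v: "0 < v" using w by (simp add: v_def)
  have "epow (k w) ?p = ennreal (1 / v) * (epow (k w) ?p * ennreal v)"
  proof -
    have "ennreal (1 / v) * ennreal v = 1" using v by (simp flip: ennreal_mult)
    then show ?thesis using mult.left_commute[of "ennreal (1 / v)" "epow (k w) ?p" "ennreal v"] by simp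
  qed
  also have "\<dots> \<le> ennreal (1 / v) * epow (nt_norm p a k) ?p"
    using le by (intro mult_left_mono) (auto simp: v_def)
  also have "\<dots> = epow (ennreal ((1 / v) powr (1 / ?p)) * nt_norm p a k) ?p"
    using v pos by (simp add: epow_mult epow_ennreal powr_powr)
  finally show ?thesis using pos by (simp add: v_def)
qed

text \<open>The base point moves by less than \<open>D * snd z\<close>, the new height is below
  \<open>D * snd z\<close>, and \<open>snd z \<le> r\<close>; this accounts for
  \<open>1 + 2 * D\<close>.\<close>

lemma whitney_subset_hat:
  assumes D: "1 < D" and z: "z \<in> tent_hat c r" and w: "w \<in> whitney D D (fst z) (snd z)"
  shows "w \<in> tent_hat c ((1 + 2 * D) * r)"
proof -
  have t: "0 < snd z" and hat: "dist (fst z) c + snd z \<le> r"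
    using z by (auto simp: tent_hat_def ball_subset_ball_iff)
  have s: "0 < snd w" using whitney_pos(2)[OF w] D by simp
  have "D * snd z \<le> D * r" using hat D by (intro mult_left_mono) (auto intro: order_trans[rotated])
  moreover have "dist (fst w) c \<le> dist (fst w) (fst z) + dist (fst z) c" by (rule dist_triangle)
  moreover have "dist (fst w) (fst z) < D * snd z" "snd w < D * snd z" using w by auto
  ultimately have "dist (fst w) c + snd w \<le> (1 + 2 * D) * r" using hat t by (simp add: algebra_simps)
  then show ?thesis using s by (simp add: tent_hat_def ball_subset_ball_iff case_prod_beta')
qed

text \<open>The \<open>q\<close>-th power of a \<open>q\<close>-average is linear in
  \<open>m^q\<close>, so Fubini moves the averaging onto the measure. The points \<open>z\<close>
  whose enlarged box contains \<open>w\<close> lie in a box about \<open>w\<close> of comparable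
  size, and the tent grows by a fixed factor. This is why the cell averages of \<open>m\<close> use
  the exponent of the Carleson condition.\<close>

lemma Carleson_wav:
  assumes D: "1 < D" and q: "0 < q"
  obtains K where "1 \<le> K" "\<And>(m :: (real^'n) \<times> real \<Rightarrow> ennreal) A. m \<in> borel_measurable borel \<Longrightarrow>
    Carleson_le q m A \<Longrightarrow> Carleson_le q (wav D D q m) (ennreal K * A)"
proof (cases "q = top")
  case True
  show ?thesis
  proof (rule that[of 1])
    fix m :: "(real^'n) \<times> real \<Rightarrow> ennreal" and A
    assume m: "Carleson_le q m A"
    have "wav D D q m z \<le> A" for z
    proof -
      have "m w \<le> A" if "w \<in> whitney D D (fst z) (snd z)" for w
        using m True whitney_pos(2)[OF that] D by (cases w) (simp add: Carleson_le_def)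
      then show ?thesis using True by (simp add: wav_def avg_on_def ess_sup_on_le_iff del: mem_whitney)
    qed
    then show "Carleson_le q (wav D D q m) (ennreal 1 * A)" using True by (simp add: Carleson_le_def)
  qed simp
next
  case False
  let ?q = "enn2real q" and ?n = "CARD('n)"
  note pos = enn2real_pos[OF q False]
  have "1 / D < D" using D by (smt (verit) divide_less_eq_1_pos)
  define cD where "cD = unit_ball_vol (real ?n) * D ^ ?n * (D - 1 / D)"
  define cE where "cE = unit_ball_vol (real ?n) * (D * D) ^ ?n * (D - 1 / D)"
  have c: "0 < cD" "0 < cE" using D \<open>1 / D < D\<close> by (auto simp: cD_def cE_def)
  \<comment> \<open>\<open>cD\<close> and \<open>cE\<close> are the volume factors of the averaging
    box and of the dual box of points \<open>z\<close>. The heights of \<open>z\<close> and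
    \<open>w\<close> differ by a factor below \<open>D\<close>, entering with power
    \<open>n + 1\<close> from the volume and one more from \<open>1/t\<close>.\<close>
  define L where "L = cE * D ^ (?n + 2) / cD"
  have L: "0 < L" using c D by (simp add: L_def)
  define K where "K = max 1 ((L * (1 + 2 * D) ^ ?n) powr (1 / ?q))"
  have "Carleson_le q (wav D D q m) (ennreal K * A)"
    if [measurable]: "m \<in> borel_measurable borel" and m: "Carleson_le q m A" for m :: "(real^'n) \<times> real \<Rightarrow> ennreal" and A
  proof -
    define g where "g w = epow (m w) ?q" for w
    have [measurable]: "g \<in> borel_measurable borel" unfolding g_def by measurable
    have "(\<integral>\<^sup>+z\<in>tent_hat c r. epow (wav D D q m z) ?q / ennreal (snd z) \<partial>lborel)
        \<le> epow (ennreal K * A) ?q * emeasure lborel (ball c r)" if r: "0 < r" for c :: "real^'n" and r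
    proof -
      let ?hat = "tent_hat c ((1 + 2 * D) * r)"
      let ?\<kappa> = "\<lambda>z w. indicator (tent_hat c r) z * (g w * indicator (whitney D D (fst z) (snd z)) w * ennreal (1 / (cD * snd z ^ (?n + 2))))"
      have "(\<integral>\<^sup>+z\<in>tent_hat c r. epow (wav D D q m z) ?q / ennreal (snd z) \<partial>lborel) = (\<integral>\<^sup>+z. (\<integral>\<^sup>+w. ?\<kappa> z w \<partial>lborel) \<partial>lborel)"
      proof (rule nn_integral_cong)
        fix z :: "(real^'n) \<times> real"
        show "epow (wav D D q m z) ?q / ennreal (snd z) * indicator (tent_hat c r) z = (\<integral>\<^sup>+w. ?\<kappa> z w \<partial>lborel)"
        proof (cases "z \<in> tent_hat c r")
          case True
          then have t: "0 < snd z" by (auto simp: tent_hat_def)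
          have e: "emeasure lborel (whitney D D (fst z) (snd z)) = ennreal (cD * snd z ^ (?n + 1))"
            using emeasure_whitney[of D D "snd z" "fst z"] D t by (simp add: cD_def)
          have "epow (wav D D q m z) ?q / ennreal (snd z)
            = (\<integral>\<^sup>+w\<in>whitney D D (fst z) (snd z). g w \<partial>lborel) * ennreal (1 / (cD * snd z ^ (?n + 2)))"
          proof -
            have "epow (wav D D q m z) ?q / ennreal (snd z)
              = (\<integral>\<^sup>+w\<in>whitney D D (fst z) (snd z). g w \<partial>lborel) * (inverse (ennreal (cD * snd z ^ (?n + 1))) * inverse (ennreal (snd z)))"
              using False pos by (simp add: wav_def avg_on_def e g_def divide_ennreal_def mult.assoc del: power_Suc)
            also have "inverse (ennreal (cD * snd z ^ (?n + 1))) * inverse (ennreal (snd z)) = ennreal (1 / (cD * snd z ^ (?n + 2)))"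
              using c t by (simp add: inverse_ennreal divide_inverse mult_ac flip: ennreal_mult)
            finally show ?thesis .
          qed
          then show ?thesis using True by (simp add: nn_integral_multc)
        qed simp
      qed
      also have "\<dots> = (\<integral>\<^sup>+w. (\<integral>\<^sup>+z. ?\<kappa> z w \<partial>lborel) \<partial>lborel)"
        by (rule lborel_pair.Fubini') measurable
      also have "\<dots> \<le> (\<integral>\<^sup>+w. ennreal L * (g w / ennreal (snd w) * indicator ?hat w) \<partial>lborel)"
      proof (rule nn_integral_mono)
        fix w :: "(real^'n) \<times> real"
        show "(\<integral>\<^sup>+z. ?\<kappa> z w \<partial>lborel) \<le> ennreal L * (g w / ennreal (snd w) * indicator ?hat w)"
        proof (cases "w \<in> ?hat")
          case True
          then have s: "0 < snd w" by (auto simp: tent_hat_def)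
          let ?V = "whitney (D * D) D (fst w) (snd w)"
          let ?b = "D ^ (?n + 2) / (cD * snd w ^ (?n + 2))"
          have "(\<integral>\<^sup>+z. ?\<kappa> z w \<partial>lborel) \<le> (\<integral>\<^sup>+z. (g w * ennreal ?b) * indicator ?V z \<partial>lborel)"
          proof (rule nn_integral_mono)
            fix z :: "(real^'n) \<times> real"
            have "z \<in> ?V \<and> 1 / (cD * snd z ^ (?n + 2)) \<le> ?b" if z: "z \<in> tent_hat c r" "w \<in> whitney D D (fst z) (snd z)"
            proof -
              have t: "0 < snd z" using z by (auto simp: tent_hat_def)
              have 1: "snd z < D * snd w" "snd w / D < snd z" using z(2) D by (auto simp: field_simps)
              have "dist (fst z) (fst w) < D * snd z" using z(2) by (simp add: dist_commute)
              also have "D * snd z \<le> D * (D * snd w)" using 1 D by (intro mult_left_mono) auto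
              finally have "z \<in> ?V" using 1 by (simp add: mult.assoc)
              moreover have "(snd w / D) ^ (?n + 2) \<le> snd z ^ (?n + 2)" using 1 s D by (intro power_mono) auto
              then have "1 / (cD * snd z ^ (?n + 2)) \<le> 1 / (cD * (snd w / D) ^ (?n + 2))"
                using c s D t by (intro divide_left_mono mult_left_mono mult_pos_pos) auto
              then have "1 / (cD * snd z ^ (?n + 2)) \<le> ?b" by (simp add: power_divide)
              ultimately show ?thesis by simp
            qed
            then have "z \<in> tent_hat c r \<Longrightarrow> w \<in> whitney D D (fst z) (snd z) \<Longrightarrow>
                z \<in> ?V \<and> g w * ennreal (1 / (cD * snd z ^ (?n + 2))) \<le> g w * ennreal ?b"
              by (auto intro!: mult_left_mono ennreal_leI simp del: mem_whitney)
            then show "?\<kappa> z w \<le> (g w * ennreal ?b) * indicator ?V z"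
              by (auto simp: indicator_def simp del: mem_whitney)
          qed
          also have "\<dots> = g w * ennreal ?b * emeasure lborel ?V"
            by (simp add: nn_integral_cmult_indicator)
          also have "emeasure lborel ?V = ennreal (cE * snd w ^ (?n + 1))"
            using emeasure_whitney[of "D * D" D "snd w" "fst w"] D s by (simp add: cE_def)
          also have "g w * ennreal ?b * ennreal (cE * snd w ^ (?n + 1)) = g w * ennreal (L * (1 / snd w))"
          proof -
            have "?b * (cE * snd w ^ (?n + 1)) = L * (1 / snd w)"
              using s c by (simp add: L_def field_simps)
            then show ?thesis using c s D by (simp add: mult.assoc flip: ennreal_mult)
          qed
          also have "\<dots> = ennreal L * (g w / ennreal (snd w))"
            using s L by (simp add: ennreal_mult divide_ennreal_def inverse_ennreal divide_inverse mult_ac less_imp_le)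
          finally show ?thesis using True by simp
        next
          case False
          have "?\<kappa> z w = 0" for z
            using False whitney_subset_hat[OF D, of z c r w] by (auto simp: indicator_def simp del: mem_whitney)
          then have "(\<integral>\<^sup>+z. ?\<kappa> z w \<partial>lborel) = (\<integral>\<^sup>+(z :: (real^'n) \<times> real). 0 \<partial>lborel)"
            by (intro nn_integral_cong)
          then show ?thesis by simp
        qed
      qed
      also have "\<dots> = ennreal L * (\<integral>\<^sup>+w\<in>?hat. g w / ennreal (snd w) \<partial>lborel)"
        by (rule nn_integral_cmult) measurable
      also have "\<dots> \<le> ennreal L * (epow A ?q * emeasure lborel (ball c ((1 + 2 * D) * r)))"
        using m False D r by (intro mult_left_mono) (auto simp: Carleson_le_def g_def)
      also have "emeasure lborel (ball c ((1 + 2 * D) * r)) = ennreal ((1 + 2 * D) ^ ?n) * emeasure lborel (ball c r)"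
        using D r by (intro emeasure_ball_scale) auto
      also have "ennreal L * (epow A ?q * (ennreal ((1 + 2 * D) ^ ?n) * emeasure lborel (ball c r)))
        = epow (ennreal ((L * (1 + 2 * D) ^ ?n) powr (1 / ?q)) * A) ?q * emeasure lborel (ball c r)"
        using L D pos by (simp add: epow_mult epow_ennreal powr_powr ennreal_mult mult_ac)
      also have "\<dots> \<le> epow (ennreal K * A) ?q * emeasure lborel (ball c r)"
        using pos by (intro mult_right_mono epow_mono mult_right_mono ennreal_leI) (auto simp: K_def)
      finally show ?thesis .
    qed
    then show ?thesis using False by (simp add: Carleson_le_def)
  qed
  then show ?thesis by (intro that[of K]) (auto simp: K_def)
qed

text \<open>An enlarged box lies in the tent over the ball of radius \<open>2 * D * snd z\<close>
  about its base point. With the weight \<open>1/s\<close> accounted for, the Carleson bound there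
  is comparable to the volume of the box. Used to see that cell averages of \<open>m\<close> are
  finite.\<close>

lemma wav_le_Carleson:
  assumes D: "1 < D" and q: "0 < q"
  obtains K where "1 \<le> K" "\<And>(m :: (real^'n) \<times> real \<Rightarrow> ennreal) A z. m \<in> borel_measurable borel \<Longrightarrow>
    Carleson_le q m A \<Longrightarrow> 0 < snd z \<Longrightarrow> wav D D q m z \<le> ennreal K * A"
proof (cases "q = top")
  case True
  show ?thesis
  proof (rule that[of 1])
    fix m :: "(real^'n) \<times> real \<Rightarrow> ennreal" and A z
    assume m: "Carleson_le q m A"
    have "m w \<le> A" if "w \<in> whitney D D (fst z) (snd z)" for w
      using m True whitney_pos(2)[OF that] D by (cases w) (simp add: Carleson_le_def)
    then show "wav D D q m z \<le> ennreal 1 * A"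
      using True by (simp add: wav_def avg_on_def ess_sup_on_le_iff del: mem_whitney)
  qed simp
next
  case False
  let ?q = "enn2real q" and ?n = "CARD('n)"
  note pos = enn2real_pos[OF q False]
  have "1 / D < D" using D by (smt (verit) divide_less_eq_1_pos)
  define cD where "cD = unit_ball_vol (real ?n) * D ^ ?n * (D - 1 / D)"
  define L where "L = D * unit_ball_vol (real ?n) * (2 * D) ^ ?n / cD"
  have c: "0 < cD" using D \<open>1 / D < D\<close> by (simp add: cD_def)
  have L: "0 < L" using c D by (simp add: L_def)
  define K where "K = max 1 (L powr (1 / ?q))"
  have "wav D D q m z \<le> ennreal K * A"
    if [measurable]: "m \<in> borel_measurable borel" and m: "Carleson_le q m A" and t: "0 < snd z" for m :: "(real^'n) \<times> real \<Rightarrow> ennreal" and A z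
  proof -
    let ?t = "snd z" and ?W = "whitney D D (fst z) (snd z)"
    let ?hat = "tent_hat (fst z) (2 * D * ?t)"
    have e: "emeasure lborel ?W = ennreal (cD * ?t ^ (?n + 1))"
      using emeasure_whitney[of D D ?t "fst z"] D t by (simp add: cD_def)
    have "(\<integral>\<^sup>+w\<in>?W. epow (m w) ?q \<partial>lborel) \<le> (\<integral>\<^sup>+w. ennreal (D * ?t) * (epow (m w) ?q / ennreal (snd w) * indicator ?hat w) \<partial>lborel)"
    proof (rule nn_integral_mono)
      fix w :: "(real^'n) \<times> real"
      show "epow (m w) ?q * indicator ?W w \<le> ennreal (D * ?t) * (epow (m w) ?q / ennreal (snd w) * indicator ?hat w)"
      proof (cases "w \<in> ?W")
        case True
        then have s: "0 < snd w" using whitney_pos(2)[of w D D "fst z" ?t] D by simp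
        have "dist (fst w) (fst z) + snd w \<le> 2 * D * ?t" using True by simp
        then have "w \<in> ?hat" using s by (simp add: tent_hat_def ball_subset_ball_iff case_prod_beta')
        moreover have "epow (m w) ?q * 1 \<le> epow (m w) ?q * ennreal (D * ?t / snd w)"
          using True s by (intro mult_left_mono) (auto simp: field_simps)
        then have "epow (m w) ?q \<le> ennreal (D * ?t) * (epow (m w) ?q / ennreal (snd w))"
          using s D t by (simp add: divide_ennreal_def inverse_ennreal divide_inverse ennreal_mult mult_ac)
        ultimately show ?thesis using True by simp
      qed simp
    qed
    also have "\<dots> = ennreal (D * ?t) * (\<integral>\<^sup>+w\<in>?hat. epow (m w) ?q / ennreal (snd w) \<partial>lborel)"
      by (rule nn_integral_cmult) measurable
    also have "\<dots> \<le> ennreal (D * ?t) * (epow A ?q * emeasure lborel (ball (fst z) (2 * D * ?t)))"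
      using m False D t by (intro mult_left_mono) (auto simp: Carleson_le_def)
    also have "\<dots> = epow A ?q * (ennreal (D * ?t) * ennreal (unit_ball_vol (real ?n) * (2 * D * ?t) ^ ?n))"
      using D t by (simp add: emeasure_ball_vec mult_ac)
    also have "ennreal (D * ?t) * ennreal (unit_ball_vol (real ?n) * (2 * D * ?t) ^ ?n) = ennreal (D * ?t * (unit_ball_vol (real ?n) * (2 * D * ?t) ^ ?n))"
      using D t by (intro ennreal_mult'[symmetric]) simp
    also have "D * ?t * (unit_ball_vol (real ?n) * (2 * D * ?t) ^ ?n) = L * (cD * ?t ^ (?n + 1))"
      using c by (simp add: L_def power_mult_distrib)
    also have "epow A ?q * ennreal (L * (cD * ?t ^ (?n + 1))) = epow (ennreal (L powr (1 / ?q)) * A) ?q * emeasure lborel ?W"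
      using L pos unfolding e by (simp add: epow_mult epow_ennreal powr_powr ennreal_mult' mult_ac)
    also have "\<dots> \<le> epow (ennreal K * A) ?q * emeasure lborel ?W"
      using pos by (intro mult_right_mono epow_mono mult_right_mono ennreal_leI) (auto simp: K_def)
    finally show ?thesis
      unfolding wav_def using D t by (subst avg_on_le_iff[OF q False emeasure_whitney_bounds]) auto
  qed
  then show ?thesis by (intro that[of K]) (auto simp: K_def)
qed

section \<open>Whitney cells\<close>

definition grid_scale :: "real \<Rightarrow> int \<Rightarrow> real" where
  "grid_scale b j = b powr real_of_int j"

text \<open>The layer \<open>b^j \<le> t < b^(j+1)\<close>, followed by a cube of side
  \<open>\<delta> * b^j\<close> in it. Integer indices form a countable type, so every function of
  the index is measurable in \<open>z\<close>.\<close>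

definition grid_cell :: "real \<Rightarrow> real \<Rightarrow> (real^'n) \<times> real \<Rightarrow> int \<times> (int^'n)" where
  "grid_cell \<delta> b z = (\<lfloor>log b (snd z)\<rfloor>, \<chi> k. \<lfloor>fst z $ k / (\<delta> * grid_scale b \<lfloor>log b (snd z)\<rfloor>)\<rfloor>)"

lemma floor_log_eq_iff:
  assumes "1 < b" "0 < s"
  shows "\<lfloor>log b s\<rfloor> = j \<longleftrightarrow> grid_scale b j \<le> s \<and> s < b * grid_scale b j"
proof -
  have "\<lfloor>log b s\<rfloor> = j \<longleftrightarrow> real_of_int j \<le> log b s \<and> log b s < real_of_int j + 1" by linarith
  also have "\<dots> \<longleftrightarrow> grid_scale b j \<le> s \<and> s < b powr (real_of_int j + 1)"
    using assms by (simp add: grid_scale_def le_log_iff log_less_iff)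
  also have "b powr (real_of_int j + 1) = b * grid_scale b j"
    using assms by (simp add: grid_scale_def powr_add)
  finally show ?thesis .
qed

lemma grid_cell_eq_iff:
  fixes z :: "(real^'n) \<times> real"
  assumes "1 < b" "0 < snd z"
  shows "grid_cell \<delta> b z = (j, e) \<longleftrightarrow> grid_scale b j \<le> snd z \<and> snd z < b * grid_scale b j
    \<and> (\<forall>k. \<lfloor>fst z $ k / (\<delta> * grid_scale b j)\<rfloor> = e $ k)"
proof -
  have "grid_cell \<delta> b z = (j, e) \<longleftrightarrow> \<lfloor>log b (snd z)\<rfloor> = j \<and> (\<forall>k. \<lfloor>fst z $ k / (\<delta> * grid_scale b j)\<rfloor> = e $ k)"
    by (auto simp: grid_cell_def vec_eq_iff)
  then show ?thesis using floor_log_eq_iff[OF assms] by simp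
qed

lemma measurable_grid_cell [measurable]:
  "(grid_cell \<delta> b :: (real^'n) \<times> real \<Rightarrow> _) \<in> borel \<rightarrow>\<^sub>M count_space UNIV"
proof (subst measurable_count_space_eq2_countable, intro conjI allI ballI)
  show "grid_cell \<delta> b \<in> space borel \<rightarrow> UNIV" by simp
  fix i :: "int \<times> (int^'n)"
  have "grid_cell \<delta> b -` {i} \<inter> space borel = {z \<in> space (borel :: ((real^'n) \<times> real) measure). \<lfloor>log b (snd z)\<rfloor> = fst i \<and>
      (\<forall>k. \<lfloor>fst z $ k / (\<delta> * grid_scale b (fst i))\<rfloor> = snd i $ k)}"
    by (cases i) (auto simp: grid_cell_def vec_eq_iff)
  also have "\<dots> \<in> sets borel"
  proof -
    have [measurable]: "(\<lambda>z :: (real^'n) \<times> real. fst z $ k) \<in> borel_measurable borel" for k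
      by (intro borel_measurable_continuous_onI continuous_intros)
    show ?thesis by measurable
  qed
  finally show "grid_cell \<delta> b -` {i} \<inter> space borel \<in> sets borel" .
qed

text \<open>Points of one cell share all floors, so each coordinate differs by at most the side
  length; bounding the norm by the sum of coordinates gives the factor
  \<open>CARD('n)\<close>.\<close>

lemma grid_cell_norm_diff:
  fixes z w :: "(real^'n) \<times> real"
  assumes b: "1 < b" and \<delta>: "0 < \<delta>" and zw: "0 < snd z" "0 < snd w" "grid_cell \<delta> b z = grid_cell \<delta> b w"
  shows "dist (fst z) (fst w) \<le> real CARD('n) * \<delta> * snd z" "snd w < b * snd z" "snd z < b * snd w"
proof -
  obtain j e where je: "grid_cell \<delta> b z = (j, e)" by fastforce
  define T where "T = grid_scale b j"
  have T: "0 < T" using b by (simp add: T_def grid_scale_def)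
  have z: "T \<le> snd z" "snd z < b * T" "\<And>k. \<lfloor>fst z $ k / (\<delta> * T)\<rfloor> = e $ k"
    using je grid_cell_eq_iff[OF b zw(1)] by (auto simp: T_def)
  have w: "T \<le> snd w" "snd w < b * T" "\<And>k. \<lfloor>fst w $ k / (\<delta> * T)\<rfloor> = e $ k"
    using je zw(3) grid_cell_eq_iff[OF b zw(2)] by (auto simp: T_def)
  have "b * T \<le> b * snd z" "b * T \<le> b * snd w" using z(1) w(1) b by (auto intro: mult_left_mono)
  then show "snd w < b * snd z" "snd z < b * snd w" using z w by linarith+
  have "norm (fst z - fst w) \<le> (\<Sum>k\<in>UNIV. \<bar>(fst z - fst w) $ k\<bar>)" by (rule norm_le_l1_cart)
  also have "\<dots> \<le> (\<Sum>k\<in>(UNIV :: 'n set). \<delta> * T)"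
  proof (rule sum_mono)
    fix k :: 'n
    have "\<bar>fst z $ k / (\<delta> * T) - fst w $ k / (\<delta> * T)\<bar> \<le> 1" using z(3)[of k] w(3)[of k] by linarith
    then have "\<bar>(fst z $ k - fst w $ k) / (\<delta> * T)\<bar> \<le> 1" by (simp add: diff_divide_distrib)
    then show "\<bar>(fst z - fst w) $ k\<bar> \<le> \<delta> * T" using \<delta> T by (simp add: abs_mult pos_divide_le_eq)
  qed
  also have "\<dots> = real CARD('n) * \<delta> * T" by simp
  also have "\<dots> \<le> real CARD('n) * \<delta> * snd z" using z(1) \<delta> by (intro mult_left_mono) auto
  finally show "dist (fst z) (fst w) \<le> real CARD('n) * \<delta> * snd z" by (simp add: dist_norm)
qed

text \<open>Each cell contains a ball about its centre \<open>x\<close>, of radius proportional to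
  its scale.\<close>

lemma emeasure_grid_cell_ge:
  assumes b: "1 < b" and \<delta>: "0 < \<delta>"
  obtains c where "0 < c" "\<And>w :: (real^'n) \<times> real. 0 < snd w \<Longrightarrow>
    ennreal (c * snd w ^ (CARD('n) + 1)) \<le> emeasure lborel {z. 0 < snd z \<and> grid_cell \<delta> b z = grid_cell \<delta> b w}"
proof -
  \<comment> \<open>Half the side of the cube and half the height \<open>b - 1\<close> of the layer,
    both in units of the scale \<open>T\<close>.\<close>
  define \<rho> where "\<rho> = min (\<delta> / 2) ((b - 1) / 2)"
  have \<rho>: "0 < \<rho>" "\<rho> \<le> \<delta> / 2" "\<rho> \<le> (b - 1) / 2"
    unfolding \<rho>_def using b \<delta> by (simp_all only: min.cobounded1 min.cobounded2) simp
  define v where "v = unit_ball_vol (real (CARD('n) + 1))"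
  have v: "0 < v" by (simp add: v_def)
  \<comment> \<open>The division by \<open>b\<close> is needed because the height of
    \<open>w\<close> may be close to \<open>b * T\<close>.\<close>
  define c where "c = v * (\<rho> / b) ^ (CARD('n) + 1)"
  have "ennreal (c * snd w ^ (CARD('n) + 1)) \<le> emeasure lborel {z. 0 < snd z \<and> grid_cell \<delta> b z = grid_cell \<delta> b w}"
    if w: "0 < snd w" for w :: "(real^'n) \<times> real"
  proof -
    obtain j e where je: "grid_cell \<delta> b w = (j, e)" by fastforce
    define T where "T = grid_scale b j"
    have T: "0 < T" using b by (simp add: T_def grid_scale_def)
    have sT: "snd w < b * T" using je grid_cell_eq_iff[OF b w] by (auto simp: T_def)
    define x :: "(real^'n) \<times> real" where "x = (\<chi> k. (real_of_int (e $ k) + 1 / 2) * (\<delta> * T), (1 + b) / 2 * T)"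
    have sub: "ball x (\<rho> * T) \<subseteq> {z. 0 < snd z \<and> grid_cell \<delta> b z = grid_cell \<delta> b w}"
    proof
      fix z assume "z \<in> ball x (\<rho> * T)"
      then have d: "dist x z < \<rho> * T" by simp
      have d1: "dist (fst x) (fst z) < \<rho> * T" using dist_fst_le[of x z] d by linarith
      have d2: "\<bar>(1 + b) / 2 * T - snd z\<bar> < \<rho> * T"
        using dist_snd_le[of x z] d by (simp add: x_def dist_real_def)
      have "\<rho> * T \<le> (b - 1) / 2 * T" using \<rho> T by (intro mult_right_mono) auto
      then have s: "T < snd z" "snd z < b * T" 
      proof -
        define X Y Z V where "X = (b - 1) / 2 * T" and "Y = \<rho> * T" and "Z = (1 + b) / 2 * T" and "V = b * T"
        have "Z = V - X" "Z = T + X" by (simp_all add: X_def Z_def V_def field_simps)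
        moreover have "\<bar>Z - snd z\<bar> < Y" "Y \<le> X"
          using d2 \<open>\<rho> * T \<le> (b - 1) / 2 * T\<close> by (simp_all only: X_def Y_def Z_def)
        ultimately have "T < snd z" "snd z < V" by linarith+
        then show "T < snd z" "snd z < b * T" by (simp_all only: V_def)
      qed
      have fl: "\<lfloor>fst z $ k / (\<delta> * T)\<rfloor> = e $ k" for k
      proof -
        have "\<bar>(fst x - fst z) $ k\<bar> \<le> norm (fst x - fst z)" by (rule component_le_norm_cart)
        then have "\<bar>(real_of_int (e $ k) + 1 / 2) * (\<delta> * T) - fst z $ k\<bar> < \<rho> * T"
          using d1 by (simp add: x_def dist_norm)
        also have "\<rho> * T \<le> \<delta> / 2 * T" using \<rho> T by (intro mult_right_mono) auto
        finally have "\<bar>real_of_int (e $ k) * (\<delta> * T) + \<delta> * T / 2 - fst z $ k\<bar> < \<delta> * T / 2"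
          by (simp only: distrib_right mult_1)
        moreover have "(real_of_int (e $ k) + 1) * (\<delta> * T) = real_of_int (e $ k) * (\<delta> * T) + \<delta> * T"
          by (simp only: distrib_right mult_1)
        ultimately have "real_of_int (e $ k) * (\<delta> * T) < fst z $ k" "fst z $ k < (real_of_int (e $ k) + 1) * (\<delta> * T)"
          by linarith+
        then have "real_of_int (e $ k) < fst z $ k / (\<delta> * T)" "fst z $ k / (\<delta> * T) < real_of_int (e $ k) + 1"
          using \<delta> T by (simp_all add: pos_less_divide_eq pos_divide_less_eq)
        then show ?thesis by linarith
      qed
      have "grid_cell \<delta> b z = (j, e)"
        using s fl T b by (subst grid_cell_eq_iff) (auto simp: T_def[symmetric])
      then show "z \<in> {z. 0 < snd z \<and> grid_cell \<delta> b z = grid_cell \<delta> b w}" using s T je by simp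
    qed
    have "c * snd w ^ (CARD('n) + 1) \<le> v * (\<rho> * T) ^ (CARD('n) + 1)"
    proof -
      have "(\<rho> / b * snd w) ^ (CARD('n) + 1) \<le> (\<rho> * T) ^ (CARD('n) + 1)"
        using \<rho> w sT b by (intro power_mono) (auto simp: pos_divide_le_eq mult_ac)
      then have "v * (\<rho> / b * snd w) ^ (CARD('n) + 1) \<le> v * (\<rho> * T) ^ (CARD('n) + 1)"
        using v by (intro mult_left_mono) auto
      then show ?thesis unfolding c_def by (simp only: power_mult_distrib mult.assoc)
    qed
    then have "ennreal (c * snd w ^ (CARD('n) + 1)) \<le> ennreal (v * (\<rho> * T) ^ (CARD('n) + 1))" by (rule ennreal_leI)
    also have "\<dots> = emeasure lborel (ball x (\<rho> * T))"
      using \<rho> T by (subst emeasure_ball) (auto simp: v_def)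
    also have "\<dots> \<le> emeasure lborel {z. 0 < snd z \<and> grid_cell \<delta> b z = grid_cell \<delta> b w}"
      using sub by (intro emeasure_mono) measurable
    finally show ?thesis .
  qed
  then show ?thesis using v \<rho> b by (intro that[of c]) (auto simp: c_def)
qed

lemma whitney_partition:
  assumes a: "0 < a" and b: "1 < b"
  obtains cell :: "(real^'n) \<times> real \<Rightarrow> int \<times> (int^'n)" and D K where
    "1 < D" "1 \<le> K" "cell \<in> borel \<rightarrow>\<^sub>M count_space UNIV"
    "\<And>z w. 0 < snd z \<Longrightarrow> 0 < snd w \<Longrightarrow> cell w = cell z \<Longrightarrow> w \<in> whitney a b (fst z) (snd z)"
    "\<And>z w w'. w \<in> whitney a b (fst z) (snd z) \<Longrightarrow> 0 < snd w' \<Longrightarrow> cell w' = cell w \<Longrightarrow> w' \<in> whitney D D (fst z) (snd z)"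
    "\<And>z w. w \<in> whitney a b (fst z) (snd z) \<Longrightarrow>
      emeasure lborel (whitney D D (fst z) (snd z)) \<le> ennreal K * emeasure lborel {w'. 0 < snd w' \<and> cell w' = cell w}"
    "\<And>z :: (real^'n) \<times> real. 0 < snd z \<Longrightarrow> emeasure lborel (whitney D D (fst z) (snd z)) \<le> ennreal K * emeasure lborel (whitney a b (fst z) (snd z))"
proof -
  let ?n = "CARD('n)"
  \<comment> \<open>The horizontal extent of a cell is then at most \<open>a/2\<close> times the
    height of any of its points, so the cell fits into the box of each of them.\<close>
  define \<delta> where "\<delta> = a / (2 * real ?n)"
  have \<delta>: "0 < \<delta>" using a by (simp add: \<delta>_def)
  have n\<delta>: "real ?n * \<delta> = a / 2" by (simp add: \<delta>_def)
  \<comment> \<open>\<open>b * b\<close> bounds the change of height when passing through a box and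
    then a cell, \<open>a * b + a\<close> the corresponding horizontal shift.\<close>
  define D where "D = b * b + a * b + a"
  have "1 * 1 < b * b" using b by (intro mult_strict_mono) auto
  moreover have "1 * b \<le> b * b" using b by (intro mult_right_mono) auto
  moreover have "0 < a * b" using a b by simp
  ultimately have D: "1 < D" "a \<le> D" "b \<le> D" "b * b \<le> D" "a * b + a \<le> D"
    unfolding D_def using a b by linarith+
  have "1 / D < D" using D by (smt (verit) divide_less_eq_1_pos)
  have "1 / b < b" using b by (smt (verit) divide_less_eq_1_pos)
  obtain c where c: "0 < c" and cell: "\<And>w :: (real^'n) \<times> real. 0 < snd w \<Longrightarrow>
    ennreal (c * snd w ^ (?n + 1)) \<le> emeasure lborel {z. 0 < snd z \<and> grid_cell \<delta> b z = grid_cell \<delta> b w}"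
    using emeasure_grid_cell_ge[OF b \<delta>] by blast
  define cD where "cD = unit_ball_vol (real ?n) * D ^ ?n * (D - 1 / D)"
  define ca where "ca = unit_ball_vol (real ?n) * a ^ ?n * (b - 1 / b)"
  have cpos: "0 < cD" "0 < ca" using D a \<open>1 / D < D\<close> \<open>1 / b < b\<close> by (auto simp: cD_def ca_def)
  \<comment> \<open>The first quotient compares an enlarged box with a cell, where
    \<open>b^(n+1)\<close> adjusts for the different heights; the second compares it with an
    ordinary box.\<close>
  define K where "K = max 1 (max (cD * b ^ (?n + 1) / c) (cD / ca))"
  have eD: "emeasure lborel (whitney D D (fst z) (snd z)) = ennreal (cD * snd z ^ (?n + 1))" if "0 < snd z" for z :: "(real^'n) \<times> real"
    unfolding cD_def using that D by (intro emeasure_whitney) auto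
  have ea: "emeasure lborel (whitney a b (fst z) (snd z)) = ennreal (ca * snd z ^ (?n + 1))" if "0 < snd z" for z :: "(real^'n) \<times> real"
    unfolding ca_def using that a b by (intro emeasure_whitney) auto
  show ?thesis
  proof (rule that[of D K "grid_cell \<delta> b"])
    show "1 < D" "1 \<le> K" using D by (auto simp: K_def)
    show "grid_cell \<delta> b \<in> borel \<rightarrow>\<^sub>M count_space UNIV" by measurable
    show "w \<in> whitney a b (fst z) (snd z)"
      if zw: "0 < snd z" "0 < snd w" "grid_cell \<delta> b w = grid_cell \<delta> b z" for z w :: "(real^'n) \<times> real"
    proof -
      note d = grid_cell_norm_diff[OF b \<delta> zw(1,2) zw(3)[symmetric]]
      have "a / 2 * snd z < a * snd z" using a zw by simp
      then have "dist (fst w) (fst z) < a * snd z" using d(1) n\<delta> by (simp add: dist_commute)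
      moreover have "snd z / b < snd w" using d b by (simp add: pos_divide_less_eq mult.commute)
      ultimately show ?thesis using d by simp
    qed
    show "w' \<in> whitney D D (fst z) (snd z)"
      if w: "w \<in> whitney a b (fst z) (snd z)" and w': "0 < snd w'" "grid_cell \<delta> b w' = grid_cell \<delta> b w" for z w w' :: "(real^'n) \<times> real"
    proof -
      have t: "0 < snd z" "0 < snd w" using whitney_pos[OF w] a b by auto
      note d = grid_cell_norm_diff[OF b \<delta> t(2) w'(1) w'(2)[symmetric]]
      have w1: "dist (fst w) (fst z) < a * snd z" "snd z < b * snd w" "snd w < b * snd z"
        using w b by (auto simp: pos_divide_less_eq mult.commute)
      have "dist (fst w') (fst z) \<le> dist (fst w') (fst w) + dist (fst w) (fst z)" by (rule dist_triangle)
      also have "dist (fst w') (fst w) \<le> a * snd w"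
        using d(1) n\<delta> mult_pos_pos[OF a t(2)] by (simp add: dist_commute)
      also have "a * snd w < a * (b * snd z)" using w1 a by (intro mult_strict_left_mono) auto
      also have "dist (fst w) (fst z) < a * snd z" by (rule w1)
      also have "a * (b * snd z) + a * snd z = (a * b + a) * snd z" by (simp add: algebra_simps)
      also have "\<dots> \<le> D * snd z" using D t by (intro mult_right_mono) auto
      finally have 1: "dist (fst w') (fst z) < D * snd z" by simp
      have "snd w' < b * (b * snd z)" using d(2) w1 b by (smt (verit) mult_less_cancel_left_pos)
      also have "\<dots> = (b * b) * snd z" by simp
      also have "\<dots> \<le> D * snd z" using D t by (intro mult_right_mono) auto
      finally have 2: "snd w' < D * snd z" .
      have "snd z < b * (b * snd w')" using d(3) w1 b by (smt (verit) mult_less_cancel_left_pos)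
      also have "\<dots> = (b * b) * snd w'" by simp
      also have "\<dots> \<le> D * snd w'" using D w' by (intro mult_right_mono) auto
      finally have "snd z / D < snd w'" using D by (simp add: pos_divide_less_eq mult.commute)
      then show ?thesis using 1 2 by simp
    qed
    show "emeasure lborel (whitney D D (fst z) (snd z)) \<le> ennreal K * emeasure lborel {w'. 0 < snd w' \<and> grid_cell \<delta> b w' = grid_cell \<delta> b w}"
      if w: "w \<in> whitney a b (fst z) (snd z)" for z w :: "(real^'n) \<times> real"
    proof -
      have t: "0 < snd z" "0 < snd w" using whitney_pos[OF w] a b by auto
      have "snd z < b * snd w" using w b by (auto simp: pos_divide_less_eq mult.commute)
      then have "snd z ^ (?n + 1) \<le> (b * snd w) ^ (?n + 1)" using t by (intro power_mono) auto
      then have "cD * snd z ^ (?n + 1) \<le> cD * (b * snd w) ^ (?n + 1)" using cpos by (intro mult_left_mono) auto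
      also have "\<dots> = (cD * b ^ (?n + 1) / c) * (c * snd w ^ (?n + 1))"
        using c by (simp add: power_mult_distrib)
      also have "\<dots> \<le> K * (c * snd w ^ (?n + 1))"
        using c t by (intro mult_right_mono) (auto simp: K_def)
      finally have "emeasure lborel (whitney D D (fst z) (snd z)) \<le> ennreal (K * (c * snd w ^ (?n + 1)))"
        using eD[OF t(1)] by (simp add: ennreal_leI)
      also have "\<dots> = ennreal K * ennreal (c * snd w ^ (?n + 1))" by (intro ennreal_mult') (simp add: K_def)
      also have "\<dots> \<le> ennreal K * emeasure lborel {w'. 0 < snd w' \<and> grid_cell \<delta> b w' = grid_cell \<delta> b w}"
        using cell[OF t(2)] by (rule mult_left_mono) simp
      finally show ?thesis .
    qed
    show "emeasure lborel (whitney D D (fst z) (snd z)) \<le> ennreal K * emeasure lborel (whitney a b (fst z) (snd z))"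
      if t: "0 < snd z" for z :: "(real^'n) \<times> real"
    proof -
      have "cD * snd z ^ (?n + 1) = (cD / ca) * (ca * snd z ^ (?n + 1))" using cpos by simp
      also have "\<dots> \<le> K * (ca * snd z ^ (?n + 1))"
        using cpos t by (intro mult_right_mono) (auto simp: K_def)
      finally have "emeasure lborel (whitney D D (fst z) (snd z)) \<le> ennreal (K * (ca * snd z ^ (?n + 1)))"
        using eD[OF t] by (simp add: ennreal_leI)
      also have "\<dots> = ennreal K * ennreal (ca * snd z ^ (?n + 1))" by (intro ennreal_mult') (simp add: K_def)
      finally show ?thesis using ea[OF t] by simp
    qed
  qed
qed

text \<open>The enlarged boxes \<open>whitney D D\<close> contain every cell that meets the original box, and all these sets have
  measures comparable up to \<open>K\<close>.\<close>

locale whitney_grid =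
  fixes a b D K :: real and cell :: "(real^'n) \<times> real \<Rightarrow> int \<times> (int^'n)"
  assumes a: "0 < a" and b: "1 < b" and D: "1 < D" and K: "1 \<le> K"
    and cell_measurable [measurable]: "cell \<in> borel \<rightarrow>\<^sub>M count_space UNIV"
    and cell_whitney: "\<And>z w. 0 < snd z \<Longrightarrow> 0 < snd w \<Longrightarrow> cell w = cell z \<Longrightarrow> w \<in> whitney a b (fst z) (snd z)"
    and cell_whitney_D: "\<And>z w w'. w \<in> whitney a b (fst z) (snd z) \<Longrightarrow> 0 < snd w' \<Longrightarrow> cell w' = cell w \<Longrightarrow> w' \<in> whitney D D (fst z) (snd z)"
    and whitney_D_le_cell: "\<And>z w. w \<in> whitney a b (fst z) (snd z) \<Longrightarrow>
      emeasure lborel (whitney D D (fst z) (snd z)) \<le> ennreal K * emeasure lborel {w'. 0 < snd w' \<and> cell w' = cell w}"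
    and whitney_D_le_whitney: "\<And>z :: (real^'n) \<times> real. 0 < snd z \<Longrightarrow>
      emeasure lborel (whitney D D (fst z) (snd z)) \<le> ennreal K * emeasure lborel (whitney a b (fst z) (snd z))"
begin

section \<open>Averages over cells\<close>

definition Q :: "int \<times> (int^'n) \<Rightarrow> ((real^'n) \<times> real) set" where
  "Q i = {w. 0 < snd w \<and> cell w = i}"

lemma Q_sets [measurable]: "Q i \<in> sets borel"
proof -
  have "{w \<in> space borel. 0 < snd w \<and> cell w = i} \<in> sets borel" by measurable
  then show ?thesis by (simp add: Q_def)
qed

lemma mem_Q: "w \<in> Q i \<longleftrightarrow> 0 < snd w \<and> cell w = i"
  by (simp add: Q_def)

lemma Q_subset_whitney: "0 < snd z \<Longrightarrow> Q (cell z) \<subseteq> whitney a b (fst z) (snd z)"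
  unfolding Q_def by (intro subsetI, elim CollectE conjE) (rule cell_whitney)

lemma Q_subset_whitney_D: "w \<in> whitney a b (fst z) (snd z) \<Longrightarrow> Q (cell w) \<subseteq> whitney D D (fst z) (snd z)"
  unfolding Q_def by (intro subsetI, elim CollectE conjE) (rule cell_whitney_D)

lemma self_whitney: "0 < snd z \<Longrightarrow> z \<in> whitney a b (fst z) (snd z)" for z :: "(real^'n) \<times> real"
  by (rule cell_whitney) auto

lemma whitney_subset_D: "whitney a b (fst z) (snd z) \<subseteq> whitney D D (fst z) (snd z)" for z :: "(real^'n) \<times> real"
proof
  fix w assume w: "w \<in> whitney a b (fst z) (snd z)"
  have "0 < snd w" using whitney_pos(2)[OF w] a b by simp
  then show "w \<in> whitney D D (fst z) (snd z)" using cell_whitney_D[OF w] by simp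
qed

lemma emeasure_Q:
  assumes "0 < snd z"
  shows "emeasure lborel (Q (cell z)) \<noteq> 0" "emeasure lborel (Q (cell z)) \<noteq> top"
proof -
  show "emeasure lborel (Q (cell z)) \<noteq> 0"
  proof
    assume "emeasure lborel (Q (cell z)) = 0"
    then have "emeasure lborel (whitney D D (fst z) (snd z)) = 0"
      using whitney_D_le_cell[OF self_whitney[OF assms]] by (simp add: Q_def)
    then show False using emeasure_whitney_bounds(1)[of D D "snd z" "fst z"] D assms by simp
  qed
  have "emeasure lborel (Q (cell z)) \<le> emeasure lborel (whitney a b (fst z) (snd z))"
    using Q_subset_whitney[OF assms] by (intro emeasure_mono) auto
  then show "emeasure lborel (Q (cell z)) \<noteq> top"
    using emeasure_whitney_bounds(2)[OF a b assms, of "fst z"] by (auto simp: top_unique)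
qed

text \<open>The cell of \<open>z\<close> lies in the box of \<open>z\<close> and has comparable
  measure.\<close>

lemma avg_cell_le_wav:
  assumes r: "0 < r" and z: "0 < snd z"
  shows "avg_on r (Q (cell z)) F \<le> ennreal (K powr (1 / enn2real r)) * wav a b r F z"
  unfolding wav_def
proof (rule avg_on_subset[OF r Q_subset_whitney[OF z] emeasure_Q[OF z] emeasure_whitney_bounds[OF a b z] K])
  have "emeasure lborel (whitney a b (fst z) (snd z)) \<le> emeasure lborel (whitney D D (fst z) (snd z))"
    using whitney_subset_D by (intro emeasure_mono) auto
  also have "\<dots> \<le> ennreal K * emeasure lborel (Q (cell z))"
    using whitney_D_le_cell[OF self_whitney[OF z]] by (simp add: Q_def)
  finally show "emeasure lborel (whitney a b (fst z) (snd z)) \<le> ennreal K * emeasure lborel (Q (cell z))" .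
qed

text \<open>The cell of \<open>w\<close> may stick out of the box of \<open>z\<close>, hence the
  enlarged box on the right.\<close>

lemma avg_cell_le_wav_D:
  assumes r: "0 < r" and w: "w \<in> whitney a b (fst z) (snd z)"
  shows "avg_on r (Q (cell w)) F \<le> ennreal (K powr (1 / enn2real r)) * wav D D r F z"
proof -
  have t: "0 < snd z" "0 < snd w" using whitney_pos[OF w] a b by auto
  have "0 < D" using D by simp
  show ?thesis unfolding wav_def
    by (rule avg_on_subset[OF r Q_subset_whitney_D[OF w] emeasure_Q[OF t(2)] emeasure_whitney_bounds[OF \<open>0 < D\<close> D t(1)] K])
       (use whitney_D_le_cell[OF w] in \<open>simp add: Q_def\<close>)
qed

text \<open>There are only countably many cells, so exceptional null sets may be treated cell by
  cell.\<close>

lemma cells_AE: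
  assumes "\<And>z. 0 < snd z \<Longrightarrow> AE w in lborel. w \<in> Q (cell z) \<longrightarrow> P w"
  shows "AE w in lborel. 0 < snd w \<longrightarrow> P w"
proof -
  have "AE w in lborel. w \<in> Q i \<longrightarrow> P w" for i
  proof (cases "Q i = {}")
    case False
    then obtain z where "0 < snd z" "cell z = i" by (auto simp: Q_def)
    then show ?thesis using assms by blast
  qed simp
  then have "AE w in lborel. \<forall>i. w \<in> Q i \<longrightarrow> P w"
    unfolding AE_all_countable by blast
  then show ?thesis by eventually_elim (use mem_Q in blast)
qed

text \<open>The box is covered by the cells that meet it. They are disjoint and stay in the enlarged
  box, so their volumes add up to at most \<open>K\<close> times that of the box.\<close>

lemma wav_le_of_cells:
  assumes r: "0 < r" and [measurable]: "H \<in> borel_measurable borel"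
    and cells: "\<And>z. 0 < snd z \<Longrightarrow> avg_on r (Q (cell z)) H \<le> M" and z: "0 < snd z"
  shows "wav a b r H z \<le> ennreal (K powr (1 / enn2real r)) * M"
proof (cases "r = top")
  case True
  have "AE w in lborel. 0 < snd w \<longrightarrow> H w \<le> M"
  proof (rule cells_AE)
    fix z :: "(real^'n) \<times> real" assume "0 < snd z"
    from cells[OF this] True show "AE w in lborel. w \<in> Q (cell z) \<longrightarrow> H w \<le> M"
      by (simp add: avg_on_def ess_sup_on_le_iff)
  qed
  then have "AE w in lborel. w \<in> whitney a b (fst z) (snd z) \<longrightarrow> H w \<le> M"
  proof eventually_elim
    case (elim w)
    then show ?case using whitney_pos(2)[of w a b] a b by (auto simp del: mem_whitney)
  qed
  then show ?thesis using True K by (simp add: wav_def avg_on_def ess_sup_on_le_iff del: mem_whitney)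
next
  case False
  let ?r = "enn2real r" and ?W = "whitney a b (fst z) (snd z)" and ?V = "whitney D D (fst z) (snd z)"
  note pos = enn2real_pos[OF r False]
  define J where "J = cell ` ?W"
  have J: "countable J" by simp
  have disj: "Q i \<inter> Q j = {}" if "i \<noteq> j" for i j using that by (auto simp: Q_def)
  have "(\<integral>\<^sup>+w\<in>?W. epow (H w) ?r \<partial>lborel) \<le> (\<integral>\<^sup>+w. (\<integral>\<^sup>+i. epow (H w) ?r * indicator (Q i) w \<partial>count_space J) \<partial>lborel)"
  proof (rule nn_integral_mono)
    fix w
    show "epow (H w) ?r * indicator ?W w \<le> (\<integral>\<^sup>+i. epow (H w) ?r * indicator (Q i) w \<partial>count_space J)"
    proof (cases "w \<in> ?W")
      case True
      then have "cell w \<in> J" "w \<in> Q (cell w)" using whitney_pos(2)[OF True a] b by (auto simp: J_def mem_Q)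
      from indicator_le_count_space[of "cell w" J w Q, OF this]
      have "epow (H w) ?r * 1 \<le> epow (H w) ?r * (\<integral>\<^sup>+i. indicator (Q i) w \<partial>count_space J)"
        by (rule mult_left_mono) simp
      then show ?thesis using True by (simp add: nn_integral_cmult)
    qed simp
  qed
  also have "\<dots> = (\<integral>\<^sup>+i. (\<integral>\<^sup>+w\<in>Q i. epow (H w) ?r \<partial>lborel) \<partial>count_space J)"
    using J by (intro nn_integral_count_space_nn_integral) auto
  also have "\<dots> \<le> (\<integral>\<^sup>+i. epow M ?r * (\<integral>\<^sup>+w. indicator (Q i) w \<partial>lborel) \<partial>count_space J)"
  proof (rule nn_integral_mono)
    fix i assume "i \<in> space (count_space J)"
    then obtain w where w: "w \<in> ?W" "i = cell w" by (auto simp: J_def)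
    then have s: "0 < snd w" using whitney_pos(2)[OF w(1) a] b by simp
    show "(\<integral>\<^sup>+w\<in>Q i. epow (H w) ?r \<partial>lborel) \<le> epow M ?r * (\<integral>\<^sup>+w. indicator (Q i) w \<partial>lborel)"
      using cells[OF s] avg_on_le_iff[OF r False emeasure_Q[OF s], of H M] w by simp
  qed
  also have "\<dots> = epow M ?r * (\<integral>\<^sup>+i. (\<integral>\<^sup>+w. indicator (Q i) w \<partial>lborel) \<partial>count_space J)"
    by (rule nn_integral_cmult) simp
  also have "(\<integral>\<^sup>+i. (\<integral>\<^sup>+w. indicator (Q i) w \<partial>lborel) \<partial>count_space J) = (\<integral>\<^sup>+w. (\<integral>\<^sup>+i. indicator (Q i) w \<partial>count_space J) \<partial>lborel)"
    using J by (intro nn_integral_count_space_nn_integral[symmetric]) auto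
  also have "\<dots> \<le> (\<integral>\<^sup>+w. indicator ?V w \<partial>lborel)"
  proof (rule nn_integral_mono)
    fix w
    show "(\<integral>\<^sup>+i. indicator (Q i) w \<partial>count_space J) \<le> (indicator ?V w :: ennreal)"
    proof (cases "w \<in> ?V")
      case True
      then show ?thesis using nn_integral_count_space_disjoint[of J Q w] disj by simp
    next
      case F: False
      have "(\<integral>\<^sup>+i. indicator (Q i) w \<partial>count_space J) = (\<integral>\<^sup>+i. 0 \<partial>count_space J :: ennreal)"
      proof (rule nn_integral_cong)
        fix i assume "i \<in> space (count_space J)"
        then obtain w' where "w' \<in> ?W" "i = cell w'" by (auto simp: J_def)
        then show "indicator (Q i) w = (0 :: ennreal)" using Q_subset_whitney_D[of w' z] F by (auto simp: indicator_def simp del: mem_whitney)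
      qed
      then show ?thesis by simp
    qed
  qed
  also have "\<dots> = emeasure lborel ?V" by simp
  also have "\<dots> \<le> ennreal K * emeasure lborel ?W" by (rule whitney_D_le_whitney[OF z])
  finally have "(\<integral>\<^sup>+w\<in>?W. epow (H w) ?r \<partial>lborel) \<le> epow M ?r * (ennreal K * emeasure lborel ?W)"
    by (simp add: mult_left_mono)
  also have "\<dots> = epow (ennreal (K powr (1 / ?r)) * M) ?r * emeasure lborel ?W"
    using K pos by (simp add: epow_mult epow_ennreal powr_powr mult_ac)
  finally show ?thesis
    unfolding wav_def avg_on_le_iff[OF r False emeasure_whitney_bounds[OF a b z]] .
qed

text \<open>Up to a constant, the average of \<open>F\<close> over the cell is at most the Whitney
  average at each point \<open>w\<close> of the cell, hence at most \<open>k w * m w\<close> for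
  almost every such \<open>w\<close>. Bounding \<open>k\<close> by its supremum and averaging in
  \<open>w\<close> with exponent \<open>q\<close> keeps the constant left side and produces the
  \<open>q\<close>-average of \<open>m\<close>.\<close>

lemma avg_cell_majorant:
  assumes r: "0 < r" and q: "0 < q" and [measurable]: "m \<in> borel_measurable borel" "F \<in> borel_measurable borel"
    and km: "AE w in lborel. 0 < snd w \<longrightarrow> wav a b r F w \<le> k w * m w" and z: "0 < snd z"
  shows "avg_on r (Q (cell z)) F \<le> ennreal (K powr (1 / enn2real r)) * ((SUP w\<in>Q (cell z). k w) * avg_on q (Q (cell z)) m)"
proof -
  let ?S = "Q (cell z)" and ?c = "ennreal (K powr (1 / enn2real r))"
  let ?k = "SUP w\<in>?S. k w" and ?A = "avg_on r ?S F"
  have "?A \<le> avg_on q ?S (\<lambda>_. ?A)"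
    using q emeasure_Q[OF z] by (intro avg_on_const_ge) auto
  also have "\<dots> \<le> avg_on q ?S (\<lambda>w. (?c * ?k) * m w)"
  proof (rule avg_on_mono_AE, use km in eventually_elim)
    case (elim w)
    show ?case
    proof
      assume w: "w \<in> ?S"
      then have "?A \<le> ?c * wav a b r F w" using avg_cell_le_wav[OF r, of w F] by (simp add: mem_Q)
      also have "\<dots> \<le> ?c * (k w * m w)" using elim w by (intro mult_left_mono) (auto simp: mem_Q)
      also have "\<dots> \<le> ?c * (?k * m w)" using w by (intro mult_left_mono mult_right_mono SUP_upper) auto
      finally show "?A \<le> (?c * ?k) * m w" by (simp add: mult.assoc)
    qed
  qed
  also have "\<dots> \<le> (?c * ?k) * avg_on q ?S m" using q by (intro avg_on_cmult_le) auto
  finally show ?thesis by (simp add: mult.assoc)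
qed

lemma SUP_cell_le_whsup:
  assumes "w \<in> whitney a b (fst z) (snd z)"
  shows "(SUP w'\<in>Q (cell w). k w') \<le> whsup D k z"
  unfolding whsup_def using Q_subset_whitney_D[OF assms] by (rule SUP_subset_mono) simp

text \<open>On the box of \<open>z\<close> the cell constants are dominated by
  \<open>whsup D k z\<close> and by the enlarged average of \<open>m\<close>. These depend on
  \<open>z\<close> only and leave the Whitney average, so what remains inside is a power of
  \<open>h\<close> with bounded averages. The tent norm is then that of a product to which
  \<open>C\<close> applies. Cell constants are only bounded above, since they arise through
  \<open>enn2real\<close>, which maps infinity to zero.\<close>

lemma tent_norm_factor_le:
  fixes kr mr :: "int \<times> (int^'n) \<Rightarrow> real"
  assumes p: "0 < p0" "0 < p1" and q: "0 < q0" "0 < q1" and r: "0 < r0" "0 < r1"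
    and sp: "split_exponent p0 p1 \<theta>" "split_exponent q0 q1 \<phi>" "split_exponent r0 r1 \<rho>"
    and [measurable]: "m \<in> borel_measurable borel" "h \<in> borel_measurable borel"
    and k: "0 < M" "nt_norm p0 ((D + 1) * D) k \<le> ennreal M"
    and m: "0 < A" "Carleson_le q0 (\<lambda>z. ennreal (K powr (1 / enn2real q0)) * wav D D q0 m z) (ennreal A)"
    and h: "0 < L" "\<And>z. 0 \<le> h z" "\<And>z. 0 < snd z \<Longrightarrow> wav a b r0 (\<lambda>w. ennreal (h w)) z \<le> ennreal L"
    and kr: "\<And>i. 0 \<le> kr i" "\<And>i. ennreal (kr i) \<le> (SUP w\<in>Q i. k w)"
    and mr: "\<And>i. 0 \<le> mr i" "\<And>i. ennreal (mr i) \<le> avg_on q0 (Q i) m"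
    and C: "0 \<le> C" "\<And>k m A. k \<in> borel_measurable borel \<Longrightarrow> (m :: (real^'n) \<times> real \<Rightarrow> ennreal) \<in> borel_measurable borel \<Longrightarrow>
      A \<noteq> 0 \<Longrightarrow> Carleson_le q1 m A \<Longrightarrow> tent_norm p1 q1 (\<lambda>z. k z * m z) \<le> ennreal C * (nt_norm p1 1 k * A)"
  shows "tent_norm p1 q1 (wav a b r1 (\<lambda>w. ennreal (kr (cell w) powr \<theta> * mr (cell w) powr \<phi> * h w powr \<rho>)))
    \<le> ennreal (C * M powr \<theta> * (L powr \<rho> * A powr \<phi>))"
proof -
  let ?m = "\<lambda>z. ennreal (K powr (1 / enn2real q0)) * wav D D q0 m z"
  let ?k = "\<lambda>z. cpow (whsup D k z) \<theta>"
  note nonneg = split_exponent_nonneg[OF sp(1)] split_exponent_nonneg[OF sp(2)] split_exponent_nonneg[OF sp(3)]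
  have le: "wav a b r1 (\<lambda>w. ennreal (kr (cell w) powr \<theta> * mr (cell w) powr \<phi> * h w powr \<rho>)) z
      \<le> ?k z * (ennreal (L powr \<rho>) * cpow (?m z) \<phi>)" if z: "0 < snd z" for z
  proof -
    have "wav a b r1 (\<lambda>w. ennreal (kr (cell w) powr \<theta> * mr (cell w) powr \<phi> * h w powr \<rho>)) z
      \<le> avg_on r1 (whitney a b (fst z) (snd z)) (\<lambda>w. (?k z * cpow (?m z) \<phi>) * cpow (ennreal (h w)) \<rho>)"
      unfolding wav_def[of a b r1]
    proof (rule avg_on_mono_AE, intro AE_I2 impI)
      fix w assume w: "w \<in> whitney a b (fst z) (snd z)"
      have "ennreal (kr (cell w) powr \<theta>) \<le> ?k z"
        by (rule order_trans[OF powr_le_cpow[OF kr(1)] cpow_mono[OF nonneg(1)]])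
           (rule order_trans[OF kr(2) SUP_cell_le_whsup[OF w]])
      moreover have "ennreal (mr (cell w) powr \<phi>) \<le> cpow (?m z) \<phi>"
        by (rule order_trans[OF powr_le_cpow[OF mr(1)] cpow_mono[OF nonneg(2)]])
           (rule order_trans[OF mr(2) avg_cell_le_wav_D[OF q(1) w]])
      moreover have "ennreal (h w powr \<rho>) \<le> cpow (ennreal (h w)) \<rho>" by (rule powr_le_cpow[OF h(2)])
      ultimately have "ennreal (kr (cell w) powr \<theta>) * ennreal (mr (cell w) powr \<phi>) * ennreal (h w powr \<rho>)
        \<le> (?k z * cpow (?m z) \<phi>) * cpow (ennreal (h w)) \<rho>"
        by (intro mult_mono) auto
      then show "ennreal (kr (cell w) powr \<theta> * mr (cell w) powr \<phi> * h w powr \<rho>)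
        \<le> (?k z * cpow (?m z) \<phi>) * cpow (ennreal (h w)) \<rho>"
        by (simp add: ennreal_mult)
    qed
    also have "\<dots> \<le> (?k z * cpow (?m z) \<phi>) * wav a b r1 (\<lambda>w. cpow (ennreal (h w)) \<rho>) z"
      unfolding wav_def[of a b r1] using r by (intro avg_on_cmult_le) auto
    also have "\<dots> \<le> (?k z * cpow (?m z) \<phi>) * ennreal (L powr \<rho>)"
      using h z by (intro mult_left_mono wav_cpow[OF r sp(3)]) auto
    finally show ?thesis by (simp add: mult_ac)
  qed
  have "Carleson_le q1 (\<lambda>z. ennreal (L powr \<rho>) * cpow (?m z) \<phi>) (ennreal (L powr \<rho>) * ennreal (A powr \<phi>))"
  proof (rule Carleson_le_mult[of q1 top q1])
    show "Carleson_le q1 (\<lambda>z. cpow (?m z) \<phi>) (ennreal (A powr \<phi>))"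
      using q sp m by (intro Carleson_le_cpow[of q0]) auto
  qed (use q in \<open>auto simp: Carleson_le_def\<close>)
  then have "tent_norm p1 q1 (\<lambda>z. ?k z * (ennreal (L powr \<rho>) * cpow (?m z) \<phi>))
    \<le> ennreal C * (nt_norm p1 1 ?k * (ennreal (L powr \<rho>) * ennreal (A powr \<phi>)))"
    using h(1) m(1) by (intro C(2)) (auto simp: ennreal_zero_less_mult_iff simp flip: ennreal_mult)
  also have "\<dots> \<le> ennreal C * (ennreal (M powr \<theta>) * (ennreal (L powr \<rho>) * ennreal (A powr \<phi>)))"
    using D p sp(1) k by (intro mult_left_mono mult_right_mono nt_norm_cpow_whsup[of D p0]) auto
  also have "\<dots> = ennreal (C * M powr \<theta> * (L powr \<rho> * A powr \<phi>))"
    using C(1) by (simp add: ennreal_mult mult.assoc)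
  finally have bound: "tent_norm p1 q1 (\<lambda>z. ?k z * (ennreal (L powr \<rho>) * cpow (?m z) \<phi>)) \<le> ennreal (C * M powr \<theta> * (L powr \<rho> * A powr \<phi>))" .
  have "tent_norm p1 q1 (wav a b r1 (\<lambda>w. ennreal (kr (cell w) powr \<theta> * mr (cell w) powr \<phi> * h w powr \<rho>)))
    \<le> tent_norm p1 q1 (\<lambda>z. ?k z * (ennreal (L powr \<rho>) * cpow (?m z) \<phi>))"
    using p q le by (intro tent_norm_mono) auto
  then show ?thesis using bound by (rule order_trans)
qed

end

section \<open>Vanishing averages and norms\<close>

lemma avg_on_le_0_AE:
  assumes r: "0 < r" and [measurable]: "F \<in> borel_measurable borel" "S \<in> sets borel"
    and S: "emeasure lborel S \<noteq> 0" "emeasure lborel S \<noteq> top" and le: "avg_on r S F \<le> 0"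
  shows "AE w in lborel. w \<in> S \<longrightarrow> F w = 0"
proof (cases "r = top")
  case True
  then have "ess_sup_on S F \<le> 0" using le by (simp add: avg_on_def)
  then show ?thesis unfolding ess_sup_on_le_iff by simp
next
  case False
  have "(\<integral>\<^sup>+w\<in>S. epow (F w) (enn2real r) \<partial>lborel) = 0"
    using le avg_on_le_iff[OF r False S, of F 0] by simp
  then have "AE w in lborel. epow (F w) (enn2real r) * indicator S w = 0"
    by (subst (asm) nn_integral_0_iff_AE) auto
  then show ?thesis by eventually_elim (auto simp: indicator_def split: if_splits)
qed

text \<open>Instead of inspecting the four definitions, the product bound is applied with both
  factors zero.\<close>

lemma tent_norm_zero:
  fixes g :: "(real^'n) \<times> real \<Rightarrow> ennreal"
  assumes p: "0 < p" and q: "0 < q" and g: "\<And>z. 0 < snd z \<Longrightarrow> g z = 0"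
  shows "tent_norm p q g = 0"
proof -
  obtain C where C: "0 \<le> C" "\<And>k m A. k \<in> borel_measurable borel \<Longrightarrow> (m :: (real^'n) \<times> real \<Rightarrow> ennreal) \<in> borel_measurable borel \<Longrightarrow>
    A \<noteq> 0 \<Longrightarrow> Carleson_le q m A \<Longrightarrow> tent_norm p q (\<lambda>z. k z * m z) \<le> ennreal C * (nt_norm p 1 k * A)"
    using tent_norm_mult_le[OF p q] by blast
  let ?o = "\<lambda>z :: (real^'n) \<times> real. 0 :: ennreal"
  have "ntmax 1 ?o x = 0" for x :: "real^'n"
    unfolding ntmax_def by (auto intro: antisym SUP_least)
  moreover have "(SUP z\<in>{z. 0 < snd z}. ?o z) = 0" by (auto intro: antisym SUP_least)
  ultimately have "nt_norm p 1 ?o = 0" by (simp add: nt_norm_def)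
  moreover have "Carleson_le q ?o 1" by (simp add: Carleson_le_def)
  ultimately have "tent_norm p q (\<lambda>z. ?o z * ?o z) \<le> 0" using C(2)[of ?o ?o 1] by simp
  moreover have "tent_norm p q g \<le> tent_norm p q (\<lambda>z. ?o z * ?o z)"
    using p q g by (intro tent_norm_mono) auto
  ultimately show ?thesis by simp
qed

lemma T_norm_zero:
  assumes "0 < a" "1 < b" "0 < p" "0 < q" "0 < r"
  shows "T_norm a b p q r \<beta> (\<lambda>_ :: (real^'n) \<times> real. 0) = 0"
proof -
  have "T_norm a b p q r \<beta> (\<lambda>_ :: (real^'n) \<times> real. 0) = tent_norm p q (wav a b r (\<lambda>_ :: (real^'n) \<times> real. 0))"
    using assms by (intro T_norm_eq_tent_norm) auto
  also have "\<dots> = 0"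
  proof (rule tent_norm_zero)
    fix z :: "(real^'n) \<times> real"
    have "ess_sup_on (whitney a b (fst z) (snd z)) (\<lambda>_. 0) \<le> 0"
      unfolding ess_sup_on_le_iff by simp
    then have "ess_sup_on (whitney a b (fst z) (snd z)) (\<lambda>_. 0) = 0" by (simp only: le_zero_eq)
    then show "wav a b r (\<lambda>_. 0) z = 0"
      unfolding wav_def avg_on_def by simp
  qed (use assms in auto)
  finally show ?thesis .
qed

context whitney_grid begin

section \<open>Factorization of functions\<close>

lemma SUP_cell_le_nt_norm:
  assumes p: "0 < p" and z: "0 < snd z" and ap: "1 \<le> ap"
  shows "(SUP w\<in>Q (cell z). k w)
    \<le> ennreal ((1 / (unit_ball_vol (real CARD('n)) * (snd z / b) ^ CARD('n))) powr (1 / enn2real p)) * nt_norm p ap k"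
proof (rule SUP_least)
  fix w assume "w \<in> Q (cell z)"
  then have "w \<in> whitney a b (fst z) (snd z)" using Q_subset_whitney[OF z] by blast
  then have "snd z / b \<le> snd w" by simp
  then show "k w \<le> ennreal ((1 / (unit_ball_vol (real CARD('n)) * (snd z / b) ^ CARD('n))) powr (1 / enn2real p)) * nt_norm p ap k"
    using p z ap b by (intro nt_norm_local_bound) auto
qed

text \<open>The power \<open>t^\<beta>\<close> put into the function cancels the weight
  \<open>t^(-\<beta>)\<close> of the norm.\<close>

lemma T_norm_factor:
  fixes g :: "(real^'n) \<times> real \<Rightarrow> real"
  assumes pos: "0 < p" "0 < q" "0 < r" and [measurable]: "g \<in> borel_measurable borel" and g: "\<And>z. 0 \<le> g z"
    and le: "tent_norm p q (wav a b r (\<lambda>w. ennreal (g w))) \<le> ennreal c"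
  shows "in_T a b p q r \<beta> (\<lambda>z. complex_of_real (g z * snd z powr \<beta>))"
    "T_norm a b p q r \<beta> (\<lambda>z. complex_of_real (g z * snd z powr \<beta>)) \<le> ennreal c"
proof -
  have "(\<lambda>z. complex_of_real (g z * snd z powr \<beta>)) \<in> borel_measurable lborel" by simp
  then have meas: "(\<lambda>z. complex_of_real (g z * snd z powr \<beta>)) \<in> borel_measurable lebesgue"
    by (rule measurable_completion)
  have "T_norm a b p q r \<beta> (\<lambda>z. complex_of_real (g z * snd z powr \<beta>)) = tent_norm p q (wav a b r (\<lambda>w. ennreal (g w)))"
  proof (rule T_norm_eq_tent_norm[OF a b pos], intro AE_I2 impI)
    fix z :: "(real^'n) \<times> real" assume t: "0 < snd z"
    have "cmod (complex_of_real (g z * snd z powr \<beta>)) = g z * snd z powr \<beta>"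
      using g[of z] by (simp only: norm_of_real) simp
    moreover have "snd z powr \<beta> * snd z powr (- \<beta>) = 1" using t by (simp flip: powr_add)
    ultimately show "ennreal (g z) = ennreal (cmod (complex_of_real (g z * snd z powr \<beta>)) * snd z powr (- \<beta>))"
      by (simp only: mult.assoc mult_1_right)
  qed
  with le show "T_norm a b p q r \<beta> (\<lambda>z. complex_of_real (g z * snd z powr \<beta>)) \<le> ennreal c" by simp
  then have "T_norm a b p q r \<beta> (\<lambda>z. complex_of_real (g z * snd z powr \<beta>)) < top"
    by (rule le_less_trans) simp
  with meas show "in_T a b p q r \<beta> (\<lambda>z. complex_of_real (g z * snd z powr \<beta>))"
    by (simp add: in_T_def)
qed

text \<open>The construction is homogeneous: \<open>k\<close> carries the norm \<open>N\<close>, and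
  as each pair of exponents sums to one, the bounds for the two factors multiply to exactly
  \<open>C * N\<close>. A vanishing norm is treated apart, since the majorant is built from some
  \<open>N > 0\<close>.\<close>

lemma factorization:
  assumes p: "inverse p0 = inverse p1 + inverse p2" "0 < p0" "0 < p1" "0 < p2"
    and q: "inverse q0 = inverse q1 + inverse q2" "0 < q0" "0 < q1" "0 < q2"
    and r: "inverse r0 = inverse r1 + inverse r2" "0 < r0" "0 < r1" "0 < r2"
  obtains C where "0 \<le> C" "\<And>f0 :: (real^'n) \<times> real \<Rightarrow> complex. in_T a b p0 q0 r0 (\<beta>1 + \<beta>2) f0 \<Longrightarrow>
    \<exists>f1 f2. in_T a b p1 q1 r1 \<beta>1 f1 \<and> in_T a b p2 q2 r2 \<beta>2 f2 \<and>
      (AE z in lebesgue. snd z > 0 \<longrightarrow> cmod (f0 z) = cmod (f1 z) * cmod (f2 z)) \<and>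
      T_norm a b p1 q1 r1 \<beta>1 f1 * T_norm a b p2 q2 r2 \<beta>2 f2 \<le> ennreal C * T_norm a b p0 q0 r0 (\<beta>1 + \<beta>2) f0"
proof -
  let ?ap = "(D + 1) * D"
  have "1 * 1 \<le> ?ap" using D by (intro mult_mono) auto
  then have ap: "1 \<le> ?ap" by simp
  obtain \<theta>1 \<theta>2 where \<theta>: "split_exponent p0 p1 \<theta>1" "split_exponent p0 p2 \<theta>2" "\<theta>1 + \<theta>2 = 1"
    using split_exponents_exist[OF p] by blast
  obtain \<phi>1 \<phi>2 where \<phi>: "split_exponent q0 q1 \<phi>1" "split_exponent q0 q2 \<phi>2" "\<phi>1 + \<phi>2 = 1"
    using split_exponents_exist[OF q] by blast
  obtain \<rho>1 \<rho>2 where \<rho>: "split_exponent r0 r1 \<rho>1" "split_exponent r0 r2 \<rho>2" "\<rho>1 + \<rho>2 = 1"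
    using split_exponents_exist[OF r] by blast
  \<comment> \<open>Valid also for \<open>x = 0\<close> with a zero exponent, because
    \<open>0 powr 0 = 0\<close>.\<close>
  have split: "x powr s * x powr t = x" if "s + t = 1" "0 \<le> x" for x s t :: real
    using that by (simp flip: powr_add)
  obtain C1 where C1: "1 \<le> C1" "\<And>(w :: (real^'n) \<times> real \<Rightarrow> ennreal) N. w \<in> borel_measurable borel \<Longrightarrow> 0 < N \<Longrightarrow>
    tent_norm p0 q0 w \<le> ennreal N \<Longrightarrow> (p0 = top \<longrightarrow> q0 = top \<longrightarrow> (\<forall>z. 0 < snd z \<longrightarrow> w z \<le> ennreal N)) \<Longrightarrow>
    tent_factors p0 q0 ?ap C1 N w"
    using tent_norm_factorization[OF p(2) q(2) ap] by blast
  obtain K5 where K5: "1 \<le> K5" "\<And>(m :: (real^'n) \<times> real \<Rightarrow> ennreal) A. m \<in> borel_measurable borel \<Longrightarrow>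
    Carleson_le q0 m A \<Longrightarrow> Carleson_le q0 (wav D D q0 m) (ennreal K5 * A)"
    using Carleson_wav[OF D q(2)] by blast
  obtain K7 where K7: "1 \<le> K7" "\<And>(m :: (real^'n) \<times> real \<Rightarrow> ennreal) A z. m \<in> borel_measurable borel \<Longrightarrow>
    Carleson_le q0 m A \<Longrightarrow> 0 < snd z \<Longrightarrow> wav D D q0 m z \<le> ennreal K7 * A"
    using wav_le_Carleson[OF D q(2)] by blast
  obtain M1 where M1: "0 \<le> M1" "\<And>k m A. k \<in> borel_measurable borel \<Longrightarrow> (m :: (real^'n) \<times> real \<Rightarrow> ennreal) \<in> borel_measurable borel \<Longrightarrow>
    A \<noteq> 0 \<Longrightarrow> Carleson_le q1 m A \<Longrightarrow> tent_norm p1 q1 (\<lambda>z. k z * m z) \<le> ennreal M1 * (nt_norm p1 1 k * A)"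
    using tent_norm_mult_le[OF p(3) q(3)] by blast
  obtain M2 where M2: "0 \<le> M2" "\<And>k m A. k \<in> borel_measurable borel \<Longrightarrow> (m :: (real^'n) \<times> real \<Rightarrow> ennreal) \<in> borel_measurable borel \<Longrightarrow>
    A \<noteq> 0 \<Longrightarrow> Carleson_le q2 m A \<Longrightarrow> tent_norm p2 q2 (\<lambda>z. k z * m z) \<le> ennreal M2 * (nt_norm p2 1 k * A)"
    using tent_norm_mult_le[OF p(4) q(4)] by blast
  define K1 K2 where "K1 = K powr (1 / enn2real r0)" and "K2 = K powr (1 / enn2real q0)"
  have K12: "0 < K1" "0 < K2" using K by (auto simp: K1_def K2_def)
  \<comment> \<open>One \<open>K1\<close> comes from the majorant on cells, the other from the
    return from cells to boxes. \<open>A\<close> collects the comparison of cells with enlarged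
    boxes, the averaging of the Carleson condition and its initial constant.\<close>
  define L A where "L = K1 * K1" and "A = K2 * (K5 * C1)"
  have LA: "0 < L" "0 < A" using K12 K5 C1 by (auto simp: L_def A_def)
  define C where "C = M1 * M2 * C1 * L * A"
  have C: "0 \<le> C" using M1 M2 C1 LA by (simp add: C_def)
  show ?thesis
  proof (rule that[OF C])
    fix f0 :: "(real^'n) \<times> real \<Rightarrow> complex"
    assume f0: "in_T a b p0 q0 r0 (\<beta>1 + \<beta>2) f0"
    obtain F0 where F0 [measurable]: "F0 \<in> borel_measurable borel" and F0': "\<And>z. 0 \<le> F0 z"
      "AE z in lborel. 0 < snd z \<longrightarrow> F0 z = cmod (f0 z) * snd z powr (- (\<beta>1 + \<beta>2))"
      using f0 borel_modulus[of f0 "\<beta>1 + \<beta>2"] unfolding in_T_def by blast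
    let ?F = "\<lambda>z. ennreal (F0 z)"
    define w where "w = wav a b r0 ?F"
    have [measurable]: "w \<in> borel_measurable borel" unfolding w_def by measurable
    have T0: "T_norm a b p0 q0 r0 (\<beta>1 + \<beta>2) f0 = tent_norm p0 q0 w"
      unfolding w_def using a b p q r F0'(2) by (intro T_norm_eq_tent_norm) (auto elim!: eventually_mono)
    have fin: "tent_norm p0 q0 w < top" using f0 T0 by (auto simp: in_T_def)
    \<comment> \<open>Stated for every positive \<open>N\<close> not below the norm: if the norm
      vanishes, arbitrarily small \<open>N\<close> are used, otherwise the norm itself.\<close>
    have majorant: "\<exists>k m. m \<in> borel_measurable borel \<and> nt_norm p0 ?ap k \<le> ennreal (C1 * N) \<and> Carleson_le q0 m (ennreal C1) \<and>
        (\<forall>z. 0 < snd z \<longrightarrow> avg_on r0 (Q (cell z)) ?F \<le> ennreal K1 * ((SUP w\<in>Q (cell z). k w) * avg_on q0 (Q (cell z)) m))"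
      if N: "0 < N" "tent_norm p0 q0 w \<le> ennreal N" for N
    proof -
      have "w z \<le> ennreal N" if "p0 = top" "q0 = top" "0 < snd z" for z
        unfolding w_def using N that a b r by (intro wav_le_tent_norm_top) (auto simp: w_def)
      then have "tent_factors p0 q0 ?ap C1 N w" using N by (intro C1(2)) auto
      then obtain k m where km: "m \<in> borel_measurable borel" "nt_norm p0 ?ap k \<le> ennreal (C1 * N)"
        "Carleson_le q0 m (ennreal C1)" "AE z in lborel. 0 < snd z \<longrightarrow> w z \<le> k z * m z"
        unfolding tent_factors_def by blast
      have "avg_on r0 (Q (cell z)) ?F \<le> ennreal K1 * ((SUP w\<in>Q (cell z). k w) * avg_on q0 (Q (cell z)) m)" if "0 < snd z" for z
        unfolding K1_def using km(1,4) r q that by (intro avg_cell_majorant) (auto simp: w_def)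
      with km show ?thesis by blast
    qed
    have cell_m: "avg_on q0 (Q (cell z)) m \<le> ennreal (K2 * (K7 * C1))"
      if "m \<in> borel_measurable borel" "Carleson_le q0 m (ennreal C1)" "0 < snd z" for m z
    proof -
      have "avg_on q0 (Q (cell z)) m \<le> ennreal K2 * wav D D q0 m z"
        unfolding K2_def using self_whitney[OF that(3)] by (rule avg_cell_le_wav_D[OF q(2)])
      also have "\<dots> \<le> ennreal K2 * (ennreal K7 * ennreal C1)"
        using K7(2)[OF that] by (intro mult_left_mono) auto
      finally show ?thesis using K12 K7 C1 by (simp add: ennreal_mult)
    qed
    define \<sigma> where "\<sigma> z = (1 / (unit_ball_vol (real CARD('n)) * (snd z / b) ^ CARD('n))) powr (1 / enn2real p0)" for z :: "(real^'n) \<times> real"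
    have cell_k: "(SUP w\<in>Q (cell z). k w) \<le> ennreal (\<sigma> z * (C1 * N))"
      if "nt_norm p0 ?ap k \<le> ennreal (C1 * N)" "0 < snd z" for k z N
    proof -
      have "(SUP w\<in>Q (cell z). k w) \<le> ennreal (\<sigma> z) * nt_norm p0 ?ap k"
        unfolding \<sigma>_def by (rule SUP_cell_le_nt_norm[OF p(2) that(2) ap])
      also have "\<dots> \<le> ennreal (\<sigma> z) * ennreal (C1 * N)" using that(1) by (rule mult_left_mono) simp
      also have "\<dots> = ennreal (\<sigma> z * (C1 * N))" by (rule ennreal_mult'[symmetric]) (simp add: \<sigma>_def)
      finally show ?thesis .
    qed
    show "\<exists>f1 f2. in_T a b p1 q1 r1 \<beta>1 f1 \<and> in_T a b p2 q2 r2 \<beta>2 f2 \<and>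
      (AE z in lebesgue. snd z > 0 \<longrightarrow> cmod (f0 z) = cmod (f1 z) * cmod (f2 z)) \<and>
      T_norm a b p1 q1 r1 \<beta>1 f1 * T_norm a b p2 q2 r2 \<beta>2 f2 \<le> ennreal C * T_norm a b p0 q0 r0 (\<beta>1 + \<beta>2) f0"
    proof (cases "tent_norm p0 q0 w = 0")
      case True
      have "AE w in lborel. 0 < snd w \<longrightarrow> ?F w = 0"
      proof (rule cells_AE)
        fix z :: "(real^'n) \<times> real" assume z: "0 < snd z"
        have "avg_on r0 (Q (cell z)) ?F \<le> 0"
        proof (rule ennreal_le_epsilon)
          fix e :: real assume e: "0 < e"
          \<comment> \<open>\<open>B\<close> depends on the cell but not on \<open>N\<close>, so the
            average over the cell is at most \<open>B * N\<close> for every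
            \<open>N > 0\<close>.\<close>
          define B where "B = K1 * (\<sigma> z * C1 * (K2 * (K7 * C1)))"
          have B: "0 \<le> B" using K12 C1 K7 by (simp add: B_def \<sigma>_def)
          define N where "N = e / (B + 1)"
          have N: "0 < N" using e B by (simp add: N_def)
          obtain k m where km: "m \<in> borel_measurable borel" "nt_norm p0 ?ap k \<le> ennreal (C1 * N)" "Carleson_le q0 m (ennreal C1)"
            "avg_on r0 (Q (cell z)) ?F \<le> ennreal K1 * ((SUP w\<in>Q (cell z). k w) * avg_on q0 (Q (cell z)) m)"
            using majorant[OF N] True z by (auto simp del: split_paired_All)
          have "avg_on r0 (Q (cell z)) ?F \<le> ennreal K1 * (ennreal (\<sigma> z * (C1 * N)) * ennreal (K2 * (K7 * C1)))"
            using km z by (intro order_trans[OF km(4)] mult_left_mono mult_mono cell_k cell_m) auto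
          also have "\<dots> = ennreal (B * N)"
            using K12 K7 C1 N by (simp add: B_def \<sigma>_def mult_ac flip: ennreal_mult)
          also have "B * N \<le> e" using B e by (simp add: N_def field_simps)
          finally show "avg_on r0 (Q (cell z)) ?F \<le> 0 + ennreal e" by (simp add: ennreal_leI)
        qed
        then show "AE w in lborel. w \<in> Q (cell z) \<longrightarrow> ?F w = 0"
          using r emeasure_Q[OF z] by (intro avg_on_le_0_AE[of r0]) auto
      qed
      then have "AE z in lborel. 0 < snd z \<longrightarrow> cmod (f0 z) = 0"
        using F0'(2)
      proof eventually_elim
        case (elim z)
        show ?case
        proof
          assume t: "0 < snd z"
          then have "F0 z = 0" using elim F0'(1)[of z] by simp
          then show "cmod (f0 z) = 0" using elim t by simp
        qed
      qed
      then have "AE z in lebesgue. snd z > 0 \<longrightarrow> cmod (f0 z) = cmod (0 :: complex) * cmod (0 :: complex)"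
        by (simp add: AE_completion)
      then show ?thesis
        using a b p q r by (intro exI[of _ "\<lambda>_. 0"]) (simp add: T_norm_zero in_T_def)
    next
      case False
      define N where "N = enn2real (tent_norm p0 q0 w)"
      have N: "0 < N" "tent_norm p0 q0 w = ennreal N"
        using False fin by (auto simp: N_def enn2real_positive_iff zero_less_iff_neq_zero)
      obtain k m where [measurable]: "m \<in> borel_measurable borel" and km: "nt_norm p0 ?ap k \<le> ennreal (C1 * N)" "Carleson_le q0 m (ennreal C1)"
        and maj: "\<And>z. 0 < snd z \<Longrightarrow> avg_on r0 (Q (cell z)) ?F \<le> ennreal K1 * ((SUP w\<in>Q (cell z). k w) * avg_on q0 (Q (cell z)) m)"
        using majorant[OF N(1)] N(2) by (metis order_refl)
      \<comment> \<open>Real values permit quotients and real powers in the factors. No infinite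
        value is lost on nonempty cells, by the bounds \<open>cell_k\<close> and
        \<open>cell_m\<close>.\<close>
      define kr mr where "kr i = enn2real (SUP w\<in>Q i. k w)" and "mr i = enn2real (avg_on q0 (Q i) m)" for i
      have [measurable]: "(\<lambda>z. kr (cell z)) \<in> borel_measurable borel" "(\<lambda>z. mr (cell z)) \<in> borel_measurable borel"
        by (auto intro!: measurable_compose[OF cell_measurable])
      have kr: "0 \<le> kr i" "ennreal (kr i) \<le> (SUP w\<in>Q i. k w)" and mr: "0 \<le> mr i" "ennreal (mr i) \<le> avg_on q0 (Q i) m" for i
        by (auto simp: kr_def mr_def ennreal_enn2real_if)
      have maj': "avg_on r0 (Q (cell z)) ?F \<le> ennreal (K1 * (kr (cell z) * mr (cell z)))" if z: "0 < snd z" for z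
      proof -
        have "(SUP w\<in>Q (cell z). k w) < top" by (rule le_less_trans[OF cell_k[OF km(1) z]]) simp
        moreover have "avg_on q0 (Q (cell z)) m < top" by (rule le_less_trans[OF cell_m[OF _ km(2) z]]) simp_all
        ultimately have "(SUP w\<in>Q (cell z). k w) = ennreal (kr (cell z))" "avg_on q0 (Q (cell z)) m = ennreal (mr (cell z))"
          by (simp_all add: kr_def mr_def)
        then show ?thesis using maj[OF z] K12 kr mr by (simp add: ennreal_mult)
      qed
      \<comment> \<open>On cells where the denominator vanishes, division by zero gives
        \<open>h = 0\<close>. By the majorant \<open>F0\<close> is zero almost everywhere on such a
        cell, so \<open>F0 = kr * mr * h\<close> persists there.\<close>
      define h where "h z = F0 z / (kr (cell z) * mr (cell z))" for z
      have [measurable]: "h \<in> borel_measurable borel" unfolding h_def by measurable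
      have h0: "0 \<le> h z" for z unfolding h_def using F0' kr mr by simp
      have hL: "wav a b r0 (\<lambda>w. ennreal (h w)) z \<le> ennreal L" if z: "0 < snd z" for z
      proof -
        have "wav a b r0 (\<lambda>w. ennreal (h w)) z \<le> ennreal (K powr (1 / enn2real r0)) * ennreal K1"
        proof (rule wav_le_of_cells[OF r(2) _ _ z])
          fix z :: "(real^'n) \<times> real" assume z: "0 < snd z"
          let ?x = "kr (cell z) * mr (cell z)"
          have "avg_on r0 (Q (cell z)) (\<lambda>w. ennreal (h w)) \<le> avg_on r0 (Q (cell z)) (\<lambda>w. ennreal (1 / ?x) * ?F w)"
          proof (rule avg_on_mono_AE, intro AE_I2 impI)
            fix w assume "w \<in> Q (cell z)"
            then have "h w = 1 / ?x * F0 w" by (simp add: h_def mem_Q)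
            then show "ennreal (h w) \<le> ennreal (1 / ?x) * ?F w" by (simp only: ennreal_mult''[OF F0'(1)] order_refl)
          qed
          also have "\<dots> \<le> ennreal (1 / ?x) * avg_on r0 (Q (cell z)) ?F" using r by (intro avg_on_cmult_le) auto
          also have "\<dots> \<le> ennreal (1 / ?x) * ennreal (K1 * ?x)" by (intro mult_left_mono maj'[OF z]) simp
          also have "\<dots> = ennreal (1 / ?x * (K1 * ?x))" using kr mr by (intro ennreal_mult'[symmetric]) simp
          also have "\<dots> \<le> ennreal K1" using K12 by (intro ennreal_leI) simp
          finally show "avg_on r0 (Q (cell z)) (\<lambda>w. ennreal (h w)) \<le> ennreal K1" .
        qed measurable
        then show ?thesis using K12 by (simp add: L_def K1_def ennreal_mult)
      qed
      have F0_eq: "AE w in lborel. 0 < snd w \<longrightarrow> F0 w = kr (cell w) * mr (cell w) * h w"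
      proof (rule cells_AE)
        fix z :: "(real^'n) \<times> real" assume z: "0 < snd z"
        show "AE w in lborel. w \<in> Q (cell z) \<longrightarrow> F0 w = kr (cell w) * mr (cell w) * h w"
        proof (cases "kr (cell z) * mr (cell z) = 0")
          case True
          have "AE w in lborel. w \<in> Q (cell z) \<longrightarrow> ?F w = 0"
            using r emeasure_Q[OF z] maj'[OF z] True by (intro avg_on_le_0_AE[of r0]) auto
          then show ?thesis
          proof eventually_elim
            case (elim w)
            then show ?case using True F0'(1)[of w] by (auto simp: mem_Q)
          qed
        next
          case False
          then show ?thesis by (intro AE_I2) (simp add: h_def mem_Q)
        qed
      qed
      have mA: "Carleson_le q0 (\<lambda>z. ennreal K2 * wav D D q0 m z) (ennreal A)"
      proof -
        have "Carleson_le q0 (\<lambda>z. ennreal K2 * wav D D q0 m z) (ennreal K2 * (ennreal K5 * ennreal C1))"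
          using q K5(2)[OF _ km(2)] by (intro Carleson_le_mult[of q0 top q0]) (auto simp: Carleson_le_def)
        then show ?thesis using K12 K5 C1 by (simp add: A_def ennreal_mult)
      qed
      have M: "0 < C1 * N" using C1 N by simp
      define g1 g2 where "g1 z = kr (cell z) powr \<theta>1 * mr (cell z) powr \<phi>1 * h z powr \<rho>1"
        and "g2 z = kr (cell z) powr \<theta>2 * mr (cell z) powr \<phi>2 * h z powr \<rho>2" for z
      have [measurable]: "g1 \<in> borel_measurable borel" "g2 \<in> borel_measurable borel"
        unfolding g1_def g2_def by measurable
      have g0: "0 \<le> g1 z" "0 \<le> g2 z" for z by (simp_all add: g1_def g2_def)
      have g12: "g1 z * g2 z = kr (cell z) * mr (cell z) * h z" for z
      proof -
        have "g1 z * g2 z = (kr (cell z) powr \<theta>1 * kr (cell z) powr \<theta>2) * (mr (cell z) powr \<phi>1 * mr (cell z) powr \<phi>2) * (h z powr \<rho>1 * h z powr \<rho>2)"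
          by (simp add: g1_def g2_def mult_ac)
        then show ?thesis using split \<theta>(3) \<phi>(3) \<rho>(3) kr(1) mr(1) h0 by simp
      qed
      let ?c1 = "M1 * (C1 * N) powr \<theta>1 * (L powr \<rho>1 * A powr \<phi>1)"
      let ?c2 = "M2 * (C1 * N) powr \<theta>2 * (L powr \<rho>2 * A powr \<phi>2)"
      have 1: "tent_norm p1 q1 (wav a b r1 (\<lambda>w. ennreal (g1 w))) \<le> ennreal ?c1"
        unfolding g1_def
        by (rule tent_norm_factor_le[OF p(2,3) q(2,3) r(2,3) \<theta>(1) \<phi>(1) \<rho>(1) _ _ M km(1) LA(2) mA[unfolded K2_def] LA(1) h0 hL kr mr M1]) measurable
      have 2: "tent_norm p2 q2 (wav a b r2 (\<lambda>w. ennreal (g2 w))) \<le> ennreal ?c2"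
        unfolding g2_def
        by (rule tent_norm_factor_le[OF p(2,4) q(2,4) r(2,4) \<theta>(2) \<phi>(2) \<rho>(2) _ _ M km(1) LA(2) mA[unfolded K2_def] LA(1) h0 hL kr mr M2]) measurable
      define f1 f2 where "f1 z = complex_of_real (g1 z * snd z powr \<beta>1)" and "f2 z = complex_of_real (g2 z * snd z powr \<beta>2)" for z
      have T1: "in_T a b p1 q1 r1 \<beta>1 f1" "T_norm a b p1 q1 r1 \<beta>1 f1 \<le> ennreal ?c1"
        unfolding f1_def using T_norm_factor[OF p(3) q(3) r(3) _ g0(1) 1] by simp_all
      have T2: "in_T a b p2 q2 r2 \<beta>2 f2" "T_norm a b p2 q2 r2 \<beta>2 f2 \<le> ennreal ?c2"
        unfolding f2_def using T_norm_factor[OF p(4) q(4) r(4) _ g0(2) 2] by simp_all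
      have "AE z in lborel. snd z > 0 \<longrightarrow> cmod (f0 z) = cmod (f1 z) * cmod (f2 z)"
        using F0_eq F0'(2)
      proof eventually_elim
        case (elim z)
        show ?case
        proof
          assume t: "0 < snd z"
          have "cmod (f1 z) = g1 z * snd z powr \<beta>1" "cmod (f2 z) = g2 z * snd z powr \<beta>2"
            using g0[of z] unfolding f1_def f2_def by (simp_all only: norm_of_real abs_mult) simp_all
          then have "cmod (f1 z) * cmod (f2 z) = (g1 z * g2 z) * snd z powr (\<beta>1 + \<beta>2)"
            by (simp add: powr_add mult_ac)
          also have "\<dots> = cmod (f0 z) * (snd z powr (- (\<beta>1 + \<beta>2)) * snd z powr (\<beta>1 + \<beta>2))"
          proof -
            have "g1 z * g2 z = cmod (f0 z) * snd z powr (- (\<beta>1 + \<beta>2))" using elim t g12[of z] by simp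
            then show ?thesis by (simp only: mult.assoc)
          qed
          also have "snd z powr (- (\<beta>1 + \<beta>2)) * snd z powr (\<beta>1 + \<beta>2) = 1"
            using t by (simp only: powr_add[symmetric]) simp
          finally show "cmod (f0 z) = cmod (f1 z) * cmod (f2 z)" by simp
        qed
      qed
      then have "AE z in lebesgue. snd z > 0 \<longrightarrow> cmod (f0 z) = cmod (f1 z) * cmod (f2 z)" by (rule AE_completion)
      moreover have "T_norm a b p1 q1 r1 \<beta>1 f1 * T_norm a b p2 q2 r2 \<beta>2 f2 \<le> ennreal C * T_norm a b p0 q0 r0 (\<beta>1 + \<beta>2) f0"
      proof -
        have "T_norm a b p1 q1 r1 \<beta>1 f1 * T_norm a b p2 q2 r2 \<beta>2 f2 \<le> ennreal ?c1 * ennreal ?c2"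
          using T1 T2 by (intro mult_mono) auto
        also have "\<dots> = ennreal (?c1 * ?c2)" using M1 by (intro ennreal_mult'[symmetric]) simp
        also have "?c1 * ?c2 = M1 * M2 * ((C1 * N) powr \<theta>1 * (C1 * N) powr \<theta>2) * ((L powr \<rho>1 * L powr \<rho>2) * (A powr \<phi>1 * A powr \<phi>2))"
          by (simp add: mult_ac)
        also have "\<dots> = C * N"
          using split[OF \<theta>(3), of "C1 * N"] split[OF \<rho>(3), of L] split[OF \<phi>(3), of A] M LA by (simp add: C_def mult_ac)
        finally show ?thesis using T0 N C by (simp add: ennreal_mult)
      qed
      ultimately show ?thesis using T1(1) T2(1) by blast
    qed
  qed
qed

end

theorem theorem3p4:
  fixes a1 a2 :: real and p q r :: "nat \<Rightarrow> ennreal" and \<beta> :: "nat \<Rightarrow> real"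
  assumes "0 < a1" and "a1 < 1 / a2" and "1 / a2 < 1"
    and "\<forall>i\<in>{0,1,2}. 0 < p i \<and> 0 < q i \<and> 0 < r i"
    and "inverse (p 0) = inverse (p 1) + inverse (p 2)"
    and "inverse (q 0) = inverse (q 1) + inverse (q 2)"
    and "inverse (r 0) = inverse (r 1) + inverse (r 2)"
    and "\<beta> 0 = \<beta> 1 + \<beta> 2"
  shows "(\<exists>C::real. \<forall>f1 f2 :: (real^'n) \<times> real \<Rightarrow> complex.
            in_T a1 a2 (p 1) (q 1) (r 1) (\<beta> 1) f1 \<and> in_T a1 a2 (p 2) (q 2) (r 2) (\<beta> 2) f2 \<longrightarrow>
              in_T a1 a2 (p 0) (q 0) (r 0) (\<beta> 0) (\<lambda>z. f1 z * f2 z) \<and>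
              T_norm a1 a2 (p 0) (q 0) (r 0) (\<beta> 0) (\<lambda>z. f1 z * f2 z)
                \<le> ennreal C * T_norm a1 a2 (p 1) (q 1) (r 1) (\<beta> 1) f1
                             * T_norm a1 a2 (p 2) (q 2) (r 2) (\<beta> 2) f2)
       \<and> (\<exists>C::real. \<forall>f0 :: (real^'n) \<times> real \<Rightarrow> complex.
            in_T a1 a2 (p 0) (q 0) (r 0) (\<beta> 0) f0 \<longrightarrow>
              (\<exists>f1 f2. in_T a1 a2 (p 1) (q 1) (r 1) (\<beta> 1) f1 \<and> in_T a1 a2 (p 2) (q 2) (r 2) (\<beta> 2) f2 \<and>
                 (AE z in lebesgue. snd z > 0 \<longrightarrow> cmod (f0 z) = cmod (f1 z) * cmod (f2 z)) \<and>
                 T_norm a1 a2 (p 1) (q 1) (r 1) (\<beta> 1) f1 * T_norm a1 a2 (p 2) (q 2) (r 2) (\<beta> 2) f2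
                   \<le> ennreal C * T_norm a1 a2 (p 0) (q 0) (r 0) (\<beta> 0) f0))"
proof (rule conjI)
  have "0 < 1 / a2" using assms(1,2) by linarith
  then have "0 < a2" by simp
  then have a2: "1 < a2" using assms(3) by simp
  have pos: "0 < p 0" "0 < p 1" "0 < p 2" "0 < q 0" "0 < q 1" "0 < q 2" "0 < r 0" "0 < r 1" "0 < r 2"
    using assms(4) by auto
  note p = assms(5) pos(1-3) and q = assms(6) pos(4-6) and r = assms(7) pos(7-9)
  obtain C where C: "0 \<le> C" "\<And>f1 f2 :: (real^'n) \<times> real \<Rightarrow> complex.
    in_T a1 a2 (p 1) (q 1) (r 1) (\<beta> 1) f1 \<Longrightarrow> in_T a1 a2 (p 2) (q 2) (r 2) (\<beta> 2) f2 \<Longrightarrow>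
    T_norm a1 a2 (p 0) (q 0) (r 0) (\<beta> 1 + \<beta> 2) (\<lambda>z. f1 z * f2 z)
      \<le> ennreal C * T_norm a1 a2 (p 1) (q 1) (r 1) (\<beta> 1) f1 * T_norm a1 a2 (p 2) (q 2) (r 2) (\<beta> 2) f2"
    using multiplication[OF assms(1) a2 p q r] by blast
  show "\<exists>C::real. \<forall>f1 f2 :: (real^'n) \<times> real \<Rightarrow> complex.
            in_T a1 a2 (p 1) (q 1) (r 1) (\<beta> 1) f1 \<and> in_T a1 a2 (p 2) (q 2) (r 2) (\<beta> 2) f2 \<longrightarrow>
              in_T a1 a2 (p 0) (q 0) (r 0) (\<beta> 0) (\<lambda>z. f1 z * f2 z) \<and>
              T_norm a1 a2 (p 0) (q 0) (r 0) (\<beta> 0) (\<lambda>z. f1 z * f2 z)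
                \<le> ennreal C * T_norm a1 a2 (p 1) (q 1) (r 1) (\<beta> 1) f1
                             * T_norm a1 a2 (p 2) (q 2) (r 2) (\<beta> 2) f2"
  proof (intro exI[of _ C] allI impI, elim conjE)
    fix f1 f2 :: "(real^'n) \<times> real \<Rightarrow> complex"
    assume f: "in_T a1 a2 (p 1) (q 1) (r 1) (\<beta> 1) f1" "in_T a1 a2 (p 2) (q 2) (r 2) (\<beta> 2) f2"
    have le: "T_norm a1 a2 (p 0) (q 0) (r 0) (\<beta> 0) (\<lambda>z. f1 z * f2 z)
        \<le> ennreal C * T_norm a1 a2 (p 1) (q 1) (r 1) (\<beta> 1) f1 * T_norm a1 a2 (p 2) (q 2) (r 2) (\<beta> 2) f2"
      using C(2)[OF f] assms(8) by simp
    also have "\<dots> < top" using f by (simp add: in_T_def ennreal_mult_less_top)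
    finally have "in_T a1 a2 (p 0) (q 0) (r 0) (\<beta> 0) (\<lambda>z. f1 z * f2 z)"
      using f by (auto simp: in_T_def)
    with le show "in_T a1 a2 (p 0) (q 0) (r 0) (\<beta> 0) (\<lambda>z. f1 z * f2 z) \<and>
      T_norm a1 a2 (p 0) (q 0) (r 0) (\<beta> 0) (\<lambda>z. f1 z * f2 z)
        \<le> ennreal C * T_norm a1 a2 (p 1) (q 1) (r 1) (\<beta> 1) f1 * T_norm a1 a2 (p 2) (q 2) (r 2) (\<beta> 2) f2"
      by blast
  qed
  obtain cell :: "(real^'n) \<times> real \<Rightarrow> int \<times> (int^'n)" and D K where "whitney_grid a1 a2 D K cell"
  proof (rule whitney_partition[OF assms(1) a2, where 'n = 'n])
    fix cell :: "(real^'n) \<times> real \<Rightarrow> int \<times> (int^'n)" and D K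
    assume "1 < D" "1 \<le> K" "cell \<in> borel \<rightarrow>\<^sub>M count_space UNIV"
      "\<And>z w. 0 < snd z \<Longrightarrow> 0 < snd w \<Longrightarrow> cell w = cell z \<Longrightarrow> w \<in> whitney a1 a2 (fst z) (snd z)"
      "\<And>z w w'. w \<in> whitney a1 a2 (fst z) (snd z) \<Longrightarrow> 0 < snd w' \<Longrightarrow> cell w' = cell w \<Longrightarrow> w' \<in> whitney D D (fst z) (snd z)"
      "\<And>z w. w \<in> whitney a1 a2 (fst z) (snd z) \<Longrightarrow>
        emeasure lborel (whitney D D (fst z) (snd z)) \<le> ennreal K * emeasure lborel {w'. 0 < snd w' \<and> cell w' = cell w}"
      "\<And>z :: (real^'n) \<times> real. 0 < snd z \<Longrightarrow> emeasure lborel (whitney D D (fst z) (snd z)) \<le> ennreal K * emeasure lborel (whitney a1 a2 (fst z) (snd z))"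
    then have "whitney_grid a1 a2 D K cell"
      using assms(1) a2 by (intro whitney_grid.intro)
    then show thesis by (rule that)
  qed
  then interpret whitney_grid a1 a2 D K cell .
  obtain C where C: "0 \<le> C" "\<And>f0 :: (real^'n) \<times> real \<Rightarrow> complex. in_T a1 a2 (p 0) (q 0) (r 0) (\<beta> 1 + \<beta> 2) f0 \<Longrightarrow>
    \<exists>f1 f2. in_T a1 a2 (p 1) (q 1) (r 1) (\<beta> 1) f1 \<and> in_T a1 a2 (p 2) (q 2) (r 2) (\<beta> 2) f2 \<and>
      (AE z in lebesgue. snd z > 0 \<longrightarrow> cmod (f0 z) = cmod (f1 z) * cmod (f2 z)) \<and>
      T_norm a1 a2 (p 1) (q 1) (r 1) (\<beta> 1) f1 * T_norm a1 a2 (p 2) (q 2) (r 2) (\<beta> 2) f2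
        \<le> ennreal C * T_norm a1 a2 (p 0) (q 0) (r 0) (\<beta> 1 + \<beta> 2) f0"
    using factorization[OF p q r, of "\<beta> 1" "\<beta> 2"] by blast
  show "\<exists>C::real. \<forall>f0 :: (real^'n) \<times> real \<Rightarrow> complex.
            in_T a1 a2 (p 0) (q 0) (r 0) (\<beta> 0) f0 \<longrightarrow>
              (\<exists>f1 f2. in_T a1 a2 (p 1) (q 1) (r 1) (\<beta> 1) f1 \<and> in_T a1 a2 (p 2) (q 2) (r 2) (\<beta> 2) f2 \<and>
                 (AE z in lebesgue. snd z > 0 \<longrightarrow> cmod (f0 z) = cmod (f1 z) * cmod (f2 z)) \<and>
                 T_norm a1 a2 (p 1) (q 1) (r 1) (\<beta> 1) f1 * T_norm a1 a2 (p 2) (q 2) (r 2) (\<beta> 2) f2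
                   \<le> ennreal C * T_norm a1 a2 (p 0) (q 0) (r 0) (\<beta> 0) f0)"
    unfolding assms(8) by (intro exI[of _ C] allI impI C(2))
qed

end
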